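(* Suppose $P$ is weakly communicating. Let $\widehat\pi$ be a bias-optimal policy of the empirical average-reward MDP $(\widehat P,r)$, let $\widehat h^\star$ be the optimal bias of $(\widehat P,r)$, and let $\widehat\gamma^\star$ be the (random) smallest discount factor $\bar\gamma\in[0,1)$ such that for every $\gamma\in[\bar\gamma,1)$ there exists $c\in\mathbb R$ (possibly depending on $\gamma$) with $$\big\|\widehat V^\star_\gamma-\widehat h^\star-c\mathbf 1\big\|_\infty\le \tfrac1n .$$ There is an absolute constant $C>0$ such that for every $\delta\in(0,1)$, with probability at least $1-\delta$ the following holds: if $\widehat P$ is weakly communicating, then $$\rho^\star-\rho^{\widehat\pi}\le \sqrt{\frac{C\log^3\!\big(\frac{SAn}{\delta(1-\widehat\gamma^\star)}\big)}{n}\Big(\|h^\star\|_{\mathrm{sp}}+\|\widehat h^\star\|_{\mathrm{sp}}+1\Big)}\;\mathbf 1 .$$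
   Context: $\mathcal S$ is a finite state set with $S$ elements, $\mathcal A$ a finite action set with $A$ elements. A transition kernel $P$ gives distributions $P(\cdot\mid s,a)$ on $\mathcal S$; the reward $r:\mathcal S\times\mathcal A\to[0,1]$ is deterministic and known. Policies are stationary Markov, possibly randomized; $P_\pi(s,s')=\sum_a\pi(a|s)P(s'|s,a)$, $r_\pi(s)=\sum_a\pi(a|s)r(s,a)$. Empirical kernel: for each $(s,a)$, $n$ i.i.d. samples $S^1_{s,a},\dots,S^n_{s,a}\sim P(\cdot|s,a)$ are drawn (independently across pairs) and $\widehat P(s'|s,a)=\frac1n\sum_{i=1}^n\mathbb 1\{S^i_{s,a}=s'\}$. For $\gamma\in(0,1)$, $V^\pi_\gamma=(I-\gamma P_\pi)^{-1}r_\pi$ and $V^\star_\gamma=\max_\pi V^\pi_\gamma$ (elementwise). $P^\infty_\pi$ is the Cesàro limit of $P_\pi^t$; the gain is $\rho^\pi=P^\infty_\pi r_\pi$ and the bias is $h^\pi=\mathrm{C\text{-}lim}_{T\to\infty}\sum_{t=0}^{T-1}(P_\pi^t r_\pi-\rho^\pi)$ (Cesàro limit). A deterministic policy $\pi^\star$ is Blackwell-optimal if for some $\bar\gamma<1$, $V^{\pi^\star}_\gamma\ge V^\pi_\gamma$ for all policies $\pi$ and all $\gamma\in[\bar\gamma,1)$; $\rho^\star=\rho^{\pi^\star}$ is the optimal gain and $h^\star=h^{\pi^\star}$ the optimal bias. A policy is bias-optimal if its gain equals $\rho^\star$ and its bias equals $h^\star$. Quantities computed with $\widehat P$ in place of $P$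 carry hats ($\widehat V^\star_\gamma$, $\widehat h^\star$, etc.). $\|x\|_{\mathrm{sp}}=\max_s x(s)-\min_s x(s)$; $\mathbf 1$ is the all-ones vector; vector inequalities are elementwise. An MDP is weakly communicating if $\mathcal S$ splits into a set of states transient under every stationary policy and a set in which every state is reachable from every other under some policy. *)

theory Defs
  imports "HOL-Probability.Probability"
begin

text \<open>States are {..<S}, actions are {..<A} (natural numbers), so that the constant
  in the main theorem can be quantified uniformly over S, A.
  A kernel is a function K s a s' = K(s'|s,a); a (randomized, stationary Markov)
  policy is a function p s a = p(a|s); vectors are functions nat => real and
  matrices functions nat => nat => real (only entries below S matter).\<close>

type_synonym kernel = "nat \<Rightarrow> nat \<Rightarrow> nat \<Rightarrow> real"
type_synonym policy = "nat \<Rightarrow> nat \<Rightarrow> real"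

definition is_policy :: "nat \<Rightarrow> nat \<Rightarrow> policy \<Rightarrow> bool" where
  "is_policy S A p \<longleftrightarrow>
     (\<forall>s<S. (\<forall>a<A. 0 \<le> p s a) \<and> (\<Sum>a<A. p s a) = 1)"

definition is_det_policy :: "nat \<Rightarrow> nat \<Rightarrow> policy \<Rightarrow> bool" where
  "is_det_policy S A p \<longleftrightarrow> is_policy S A p \<and> (\<forall>s<S. \<forall>a<A. p s a \<in> {0, 1})"

definition Ppol :: "nat \<Rightarrow> kernel \<Rightarrow> policy \<Rightarrow> nat \<Rightarrow> nat \<Rightarrow> real" where
  "Ppol A K p s s' = (\<Sum>a<A. p s a * K s a s')"

definition rpol :: "nat \<Rightarrow> (nat \<Rightarrow> nat \<Rightarrow> real) \<Rightarrow> policy \<Rightarrow> nat \<Rightarrow> real" where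
  "rpol A r p s = (\<Sum>a<A. p s a * r s a)"

fun mpow :: "nat \<Rightarrow> (nat \<Rightarrow> nat \<Rightarrow> real) \<Rightarrow> nat \<Rightarrow> nat \<Rightarrow> nat \<Rightarrow> real" where
  "mpow S M 0 s s' = (if s = s' then 1 else 0)"
| "mpow S M (Suc t) s s' = (\<Sum>u<S. mpow S M t s u * M u s')"

definition mvec :: "nat \<Rightarrow> (nat \<Rightarrow> nat \<Rightarrow> real) \<Rightarrow> (nat \<Rightarrow> real) \<Rightarrow> nat \<Rightarrow> real" where
  "mvec S M v s = (\<Sum>s'<S. M s s' * v s')"

text \<open>Discounted value V^pi_gamma = (I - gamma P_pi)^{-1} r_pi, written as its Neumann series.\<close>
definition Vpol :: "nat \<Rightarrow> nat \<Rightarrow> kernel \<Rightarrow> (nat \<Rightarrow> nat \<Rightarrow> real) \<Rightarrow> policy \<Rightarrow> real \<Rightarrow> nat \<Rightarrow> real" where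
  "Vpol S A K r p \<gamma> s = (\<Sum>t. \<gamma> ^ t * mvec S (mpow S (Ppol A K p) t) (rpol A r p) s)"

definition Vstar :: "nat \<Rightarrow> nat \<Rightarrow> kernel \<Rightarrow> (nat \<Rightarrow> nat \<Rightarrow> real) \<Rightarrow> real \<Rightarrow> nat \<Rightarrow> real" where
  "Vstar S A K r \<gamma> s = (SUP p\<in>{p. is_policy S A p}. Vpol S A K r p \<gamma> s)"

definition cesaro_lim :: "(nat \<Rightarrow> real) \<Rightarrow> real" where
  "cesaro_lim x = lim (\<lambda>N. (\<Sum>k\<le>N. x k) / real (Suc N))"

definition Pinf :: "nat \<Rightarrow> nat \<Rightarrow> kernel \<Rightarrow> policy \<Rightarrow> nat \<Rightarrow> nat \<Rightarrow> real" where
  "Pinf S A K p s s' = cesaro_lim (\<lambda>t. mpow S (Ppol A K p) t s s')"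

definition gain :: "nat \<Rightarrow> nat \<Rightarrow> kernel \<Rightarrow> (nat \<Rightarrow> nat \<Rightarrow> real) \<Rightarrow> policy \<Rightarrow> nat \<Rightarrow> real" where
  "gain S A K r p = mvec S (Pinf S A K p) (rpol A r p)"

definition bias :: "nat \<Rightarrow> nat \<Rightarrow> kernel \<Rightarrow> (nat \<Rightarrow> nat \<Rightarrow> real) \<Rightarrow> policy \<Rightarrow> nat \<Rightarrow> real" where
  "bias S A K r p s = cesaro_lim (\<lambda>T. \<Sum>t<T.
       mvec S (mpow S (Ppol A K p) t) (rpol A r p) s - gain S A K r p s)"

definition blackwell_optimal :: "nat \<Rightarrow> nat \<Rightarrow> kernel \<Rightarrow> (nat \<Rightarrow> nat \<Rightarrow> real) \<Rightarrow> policy \<Rightarrow> bool" where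
  "blackwell_optimal S A K r p \<longleftrightarrow> is_det_policy S A p \<and>
     (\<exists>\<gamma>b<1. \<forall>q. is_policy S A q \<longrightarrow>
        (\<forall>\<gamma>. \<gamma>b \<le> \<gamma> \<and> \<gamma> < 1 \<longrightarrow> (\<forall>s<S. Vpol S A K r q \<gamma> s \<le> Vpol S A K r p \<gamma> s)))"

definition opt_gain :: "nat \<Rightarrow> nat \<Rightarrow> kernel \<Rightarrow> (nat \<Rightarrow> nat \<Rightarrow> real) \<Rightarrow> nat \<Rightarrow> real" where
  "opt_gain S A K r = gain S A K r (SOME p. blackwell_optimal S A K r p)"

definition opt_bias :: "nat \<Rightarrow> nat \<Rightarrow> kernel \<Rightarrow> (nat \<Rightarrow> nat \<Rightarrow> real) \<Rightarrow> nat \<Rightarrow> real" where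
  "opt_bias S A K r = bias S A K r (SOME p. blackwell_optimal S A K r p)"

definition bias_optimal :: "nat \<Rightarrow> nat \<Rightarrow> kernel \<Rightarrow> (nat \<Rightarrow> nat \<Rightarrow> real) \<Rightarrow> policy \<Rightarrow> bool" where
  "bias_optimal S A K r p \<longleftrightarrow> is_policy S A p \<and>
     (\<forall>s<S. gain S A K r p s = opt_gain S A K r s \<and> bias S A K r p s = opt_bias S A K r s)"

definition reach :: "nat \<Rightarrow> nat \<Rightarrow> kernel \<Rightarrow> policy \<Rightarrow> nat \<Rightarrow> nat \<Rightarrow> bool" where
  "reach S A K p s s' \<longleftrightarrow> (\<exists>t. mpow S (Ppol A K p) t s s' > 0)"

definition transient :: "nat \<Rightarrow> nat \<Rightarrow> kernel \<Rightarrow> policy \<Rightarrow> nat \<Rightarrow> bool" where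
  "transient S A K p s \<longleftrightarrow> (\<exists>s'<S. reach S A K p s s' \<and> \<not> reach S A K p s' s)"

definition weakly_communicating :: "nat \<Rightarrow> nat \<Rightarrow> kernel \<Rightarrow> bool" where
  "weakly_communicating S A K \<longleftrightarrow> (\<exists>C\<subseteq>{..<S}.
     (\<forall>s<S. s \<notin> C \<longrightarrow> (\<forall>p. is_policy S A p \<longrightarrow> transient S A K p s)) \<and>
     (\<forall>s\<in>C. \<forall>s'\<in>C. \<exists>p. is_policy S A p \<and> reach S A K p s s'))"

definition supnorm :: "nat \<Rightarrow> (nat \<Rightarrow> real) \<Rightarrow> real" where
  "supnorm S v = Max ((\<lambda>s. \<bar>v s\<bar>) ` {..<S})"

definition spnorm :: "nat \<Rightarrow> (nat \<Rightarrow> real) \<Rightarrow> real" where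
  "spnorm S v = Max (v ` {..<S}) - Min (v ` {..<S})"

text \<open>Samples: omega ((s,a),i) is the i-th sample S^{i+1}_{s,a}, i < n.\<close>
definition emp_kernel :: "nat \<Rightarrow> ((nat \<times> nat) \<times> nat \<Rightarrow> nat) \<Rightarrow> kernel" where
  "emp_kernel n \<omega> s a s' = real (card {i. i < n \<and> \<omega> ((s, a), i) = s'}) / real n"

definition sample_pmf :: "nat \<Rightarrow> nat \<Rightarrow> nat \<Rightarrow> (nat \<Rightarrow> nat \<Rightarrow> nat pmf) \<Rightarrow> ((nat \<times> nat) \<times> nat \<Rightarrow> nat) pmf" where
  "sample_pmf S A n P = Pi_pmf (({..<S} \<times> {..<A}) \<times> {..<n}) 0 (\<lambda>((s, a), i). P s a)"

definition gamma_star :: "nat \<Rightarrow> nat \<Rightarrow> nat \<Rightarrow> kernel \<Rightarrow> (nat \<Rightarrow> nat \<Rightarrow> real) \<Rightarrow> real" where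
  "gamma_star S A n K r = Inf {\<gamma>b. 0 \<le> \<gamma>b \<and> \<gamma>b < 1 \<and>
     (\<forall>\<gamma>. \<gamma>b \<le> \<gamma> \<and> \<gamma> < 1 \<longrightarrow>
        (\<exists>c. supnorm S (\<lambda>s. Vstar S A K r \<gamma> s - opt_bias S A K r s - c) \<le> 1 / real n))}"

end

theory Submission
  imports Defs "Jordan_Normal_Form.Determinant"
begin

text \<open>For a stochastic matrix the discounted value is a rational function of the discount factor
  with at most a simple pole at 1; its Laurent expansion there yields the gain, the bias and the
  Poisson equation, and the eventually constant sign of rational functions yields Blackwell optimality.

  The suboptimality splits into two gain differences of one policy under two kernels. Each equals
  a stationary average of \<open>(P' - P) h\<close> with \<open>h\<close> one of the two optimal biases. Bernstein's inequality
  bounds \<open>(P' - P) h\<close> by a standard deviation, and the stationary average of the variance of \<open>h\<close> is in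
  turn at most its span times one plus the same deviation, by telescoping \<open>h\<^sup>2\<close> along the Poisson equation.

  The empirical bias is not independent of the samples. It is replaced by the empirical
  discounted value at a factor \<open>1 - 2\<^sup>-\<^sup>k\<close> above \<open>gamma_star\<close>, which agrees with it up to a constant and
  an error \<open>1/n\<close>, and this by a value iteration in which the value at the state in question is pinned
  to a grid point. A union bound over grid points and \<open>k\<close> gives the logarithm.\<close>

text \<open>The threshold \<open>gamma_star\<close> depends on all samples, so no discount factor
  tied to it can be fixed beforehand. The scales 1 - 2^-k are coarse enough that their failure
  probabilities can be summed in advance, and fine enough that the scale finally selected satisfies
  2^k <= 2 / (1 - gamma_star).

  Pinning is cheap because an error in the pinned value is not amplified: value iteration contracts
  at the other states, so spacing 1/n on an interval of length 2^k suffices.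

  All random events concern one-step averages at single state-action pairs, never a policy. Hence
  the bound holds for all bias-optimal empirical policies at once. Bias optimality matters since the
  policy has to satisfy the Poisson equation with exactly the optimal empirical bias, the vector
  that the discounted values approximate.

  Weak communication makes the optimal gain constant over states. In the empirical model this lets a
  single constant absorb the pole of the discounted value; in both models it removes the gain from
  the difference of one-step averages.\<close>

definition stochastic :: "nat \<Rightarrow> (nat \<Rightarrow> nat \<Rightarrow> real) \<Rightarrow> bool" where
  "stochastic S M \<longleftrightarrow> (\<forall>s<S. (\<forall>s'<S. 0 \<le> M s s') \<and> (\<Sum>s'<S. M s s') = 1)"

section \<open>Averages against stochastic matrices and their powers\<close>

lemma mvec_cong: "(\<And>t. t < S \<Longrightarrow> u t = v t) \<Longrightarrow> mvec S M u s = mvec S M v s"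
  by (simp add: mvec_def)

lemma mvec_add: "mvec S M (\<lambda>t. u t + v t) s = mvec S M u s + mvec S M v s"
  by (simp add: mvec_def algebra_simps sum.distrib)

lemma mvec_diff: "mvec S M (\<lambda>t. u t - v t) s = mvec S M u s - mvec S M v s"
  by (simp add: mvec_def algebra_simps sum_subtractf)

lemma mvec_scale: "mvec S M (\<lambda>t. c * v t) s = c * mvec S M v s"
  by (simp add: mvec_def algebra_simps sum_distrib_left)

lemma mvec_const: "stochastic S M \<Longrightarrow> s < S \<Longrightarrow> mvec S M (\<lambda>_. c) s = c"
  by (simp add: mvec_def stochastic_def flip: sum_distrib_right)

lemma mvec_mono:
  "stochastic S M \<Longrightarrow> s < S \<Longrightarrow> (\<And>t. t < S \<Longrightarrow> u t \<le> v t) \<Longrightarrow> mvec S M u s \<le> mvec S M v s"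
  unfolding mvec_def stochastic_def by (intro sum_mono mult_left_mono) auto

lemma mvec_abs_le:
  assumes "stochastic S M" "s < S" "\<And>t. t < S \<Longrightarrow> \<bar>v t\<bar> \<le> B"
  shows "\<bar>mvec S M v s\<bar> \<le> B"
proof -
  have "mvec S M v s \<le> mvec S M (\<lambda>_. B) s"
    using assms by (intro mvec_mono) (auto simp: abs_le_iff)
  moreover have "mvec S M (\<lambda>_. -B) s \<le> mvec S M v s"
    using assms by (intro mvec_mono) (auto simp: abs_le_iff minus_le_iff)
  ultimately show ?thesis
    using mvec_const[OF assms(1,2)] by (simp add: abs_le_iff)
qed

lemma mvec_mpow_Suc: "mvec S (mpow S M (Suc t)) v s = mvec S (mpow S M t) (mvec S M v) s"
proof -
  have "mvec S (mpow S M (Suc t)) v s = (\<Sum>s'<S. \<Sum>u<S. mpow S M t s u * M u s' * v s')"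
    by (simp add: mvec_def sum_distrib_right)
  also have "\<dots> = (\<Sum>u<S. \<Sum>s'<S. mpow S M t s u * M u s' * v s')"
    by (rule sum.swap)
  finally show ?thesis by (simp add: mvec_def sum_distrib_left algebra_simps)
qed

lemma mvec_mpow_0: "s < S \<Longrightarrow> mvec S (mpow S M 0) v s = v s"
  by (simp add: mvec_def if_distrib[of "\<lambda>x. x * _"] cong: if_cong)

lemma mvec_mpow_Suc':
  "s < S \<Longrightarrow> mvec S (mpow S M (Suc t)) v s = mvec S M (mvec S (mpow S M t) v) s"
proof (induction t arbitrary: v)
  case 0
  have "mvec S M v s = mvec S M (mvec S (mpow S M 0) v) s"
    by (rule mvec_cong) (simp add: mvec_mpow_0 del: mpow.simps)
  then show ?case using 0
    by (simp only: mvec_mpow_Suc[of S M 0] mvec_mpow_0)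
next
  case (Suc t)
  have "mvec S (mpow S M (Suc (Suc t))) v s = mvec S (mpow S M (Suc t)) (mvec S M v) s"
    by (rule mvec_mpow_Suc)
  also have "\<dots> = mvec S M (mvec S (mpow S M t) (mvec S M v)) s"
    using Suc by blast
  also have "mvec S (mpow S M t) (mvec S M v) = mvec S (mpow S M (Suc t)) v"
    by (rule ext) (simp only: mvec_mpow_Suc)
  finally show ?case .
qed

lemma stochastic_mpow:
  assumes "stochastic S M"
  shows "stochastic S (mpow S M t)"
proof (induction t)
  case 0
  then show ?case by (auto simp: stochastic_def)
next
  case (Suc t)
  have "(\<Sum>s'<S. mpow S M (Suc t) s s') = 1" if "s < S" for s
  proof -
    have "(\<Sum>s'<S. mpow S M (Suc t) s s') = mvec S (mpow S M (Suc t)) (\<lambda>_. 1) s"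
      by (simp add: mvec_def)
    also have "\<dots> = mvec S (mpow S M t) (mvec S M (\<lambda>_. 1)) s"
      by (rule mvec_mpow_Suc)
    also have "\<dots> = mvec S (mpow S M t) (\<lambda>_. 1) s"
      using mvec_const[OF assms] by (intro mvec_cong) auto
    also have "\<dots> = 1" using mvec_const[OF Suc that] .
    finally show ?thesis .
  qed
  moreover have "0 \<le> mpow S M (Suc t) s s'" if "s < S" "s' < S" for s s'
    using Suc assms that by (auto simp: stochastic_def intro!: sum_nonneg)
  ultimately show ?case by (auto simp: stochastic_def)
qed

section \<open>Discounted values of a stochastic matrix\<close>

text \<open>This is the resolvent (I - g M)^-1 applied to \<open>v\<close>. Policy values are
  instances by \<open>Vpol_eq_disc\<close>, so the analysis near discount 1 can be done for a bare
  matrix.\<close>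

definition disc :: "nat \<Rightarrow> (nat \<Rightarrow> nat \<Rightarrow> real) \<Rightarrow> (nat \<Rightarrow> real) \<Rightarrow> real \<Rightarrow> nat \<Rightarrow> real" where
  "disc S M v g s = (\<Sum>t. g ^ t * mvec S (mpow S M t) v s)"

lemma vector_bound: "\<exists>B\<ge>0. \<forall>t<S. \<bar>v t\<bar> \<le> (B::real)" for v :: "nat \<Rightarrow> real"
proof (intro exI conjI allI impI)
  show "0 \<le> (\<Sum>t<S. \<bar>v t\<bar>)" by (simp add: sum_nonneg)
  show "\<bar>v t\<bar> \<le> (\<Sum>t<S. \<bar>v t\<bar>)" if "t < S" for t
    using that by (intro member_le_sum) auto
qed

lemma disc_summable:
  assumes "stochastic S M" "s < S" "0 \<le> g" "g < 1"
  shows "summable (\<lambda>t. g ^ t * mvec S (mpow S M t) v s)"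
proof -
  obtain B where B: "\<And>t. t < S \<Longrightarrow> \<bar>v t\<bar> \<le> B" using vector_bound by blast
  show ?thesis
  proof (rule summable_comparison_test)
    show "\<exists>N. \<forall>t\<ge>N. norm (g ^ t * mvec S (mpow S M t) v s) \<le> g ^ t * B"
      using assms mvec_abs_le[OF stochastic_mpow[OF assms(1)] assms(2) B]
      by (auto simp: abs_mult intro!: mult_left_mono)
    show "summable (\<lambda>t. g ^ t * B)"
      using assms by (intro summable_mult2 summable_geometric) auto
  qed
qed

lemma disc_abs_le:
  assumes "stochastic S M" "s < S" "0 \<le> g" "g < 1" "\<And>t. t < S \<Longrightarrow> \<bar>v t\<bar> \<le> B"
  shows "\<bar>disc S M v g s\<bar> \<le> B / (1 - g)"
proof -
  have *: "\<bar>g ^ t * mvec S (mpow S M t) v s\<bar> \<le> g ^ t * B" for t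
    using assms mvec_abs_le[OF stochastic_mpow[OF assms(1)] assms(2,5)]
    by (auto simp: abs_mult intro!: mult_left_mono)
  have sm: "summable (\<lambda>t. g ^ t * B)"
    using assms by (intro summable_mult2 summable_geometric) auto
  have "summable (\<lambda>t. \<bar>g ^ t * mvec S (mpow S M t) v s\<bar>)"
    by (rule summable_comparison_test[OF _ sm]) (use * in auto)
  then have "\<bar>disc S M v g s\<bar> \<le> (\<Sum>t. \<bar>g ^ t * mvec S (mpow S M t) v s\<bar>)"
    unfolding disc_def by (rule summable_rabs)
  also have "\<dots> \<le> (\<Sum>t. g ^ t * B)"
    by (rule suminf_le) (use * sm in \<open>auto intro!: summable_comparison_test[OF _ sm]\<close>)
  also have "\<dots> = B / (1 - g)"
    using assms by (subst suminf_mult2[symmetric]) (auto simp: suminf_geometric summable_geometric)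
  finally show ?thesis .
qed

lemma disc_eq:
  assumes "stochastic S M" "s < S" "0 \<le> g" "g < 1"
  shows "disc S M v g s = v s + g * mvec S M (disc S M v g) s"
proof -
  have "disc S M v g s = g ^ 0 * mvec S (mpow S M 0) v s
          + (\<Sum>t. g ^ Suc t * mvec S (mpow S M (Suc t)) v s)"
    unfolding disc_def by (subst suminf_split_head[OF disc_summable[OF assms]]) simp
  also have "(\<Sum>t. g ^ Suc t * mvec S (mpow S M (Suc t)) v s)
      = (\<Sum>t. \<Sum>s'<S. g * (M s s' * (g ^ t * mvec S (mpow S M t) v s')))"
    using assms by (simp only: mvec_mpow_Suc') (simp add: mvec_def sum_distrib_left algebra_simps)
  also have "\<dots> = (\<Sum>s'<S. \<Sum>t. g * (M s s' * (g ^ t * mvec S (mpow S M t) v s')))"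
    using assms by (intro suminf_sum summable_mult disc_summable) auto
  also have "\<dots> = g * mvec S M (disc S M v g) s"
    unfolding mvec_def[of S M] sum_distrib_left disc_def using assms
    by (intro sum.cong refl) (simp add: suminf_mult summable_mult disc_summable)
  finally show ?thesis using assms by (simp add: mvec_mpow_0 del: mpow.simps)
qed

text \<open>Maximum principle: at a state where \<open>disc - u\<close> attains its maximum m, the
  fixed-point equation and the supersolution property give m <= g m, hence m <= 0.\<close>

lemma disc_le_supersolution:
  assumes M: "stochastic S M" and g: "0 \<le> g" "g < 1"
    and u: "\<And>s. s < S \<Longrightarrow> v s + g * mvec S M u s \<le> u s" and s: "s < S"
  shows "disc S M v g s \<le> u s"
proof -
  let ?e = "\<lambda>s. disc S M v g s - u s"
  define m where "m = Max (?e ` {..<S})"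
  have ne: "?e ` {..<S} \<noteq> {}" using s by auto
  then have "m \<in> ?e ` {..<S}" unfolding m_def by (intro Max_in) auto
  then obtain s0 where s0: "s0 < S" "m = ?e s0" by auto
  have le: "?e t \<le> m" if "t < S" for t using that unfolding m_def by (intro Max_ge) auto
  have "m \<le> g * mvec S M ?e s0"
    using u[OF s0(1)] disc_eq[OF M s0(1) g, of v] s0 by (simp add: mvec_diff algebra_simps)
  also have "mvec S M ?e s0 \<le> mvec S M (\<lambda>_. m) s0"
    using le by (intro mvec_mono M s0) auto
  finally have "m \<le> g * m" using g mvec_const[OF M s0(1)] by (simp add: mult_left_mono)
  then have "(1 - g) * m \<le> 0" by (simp add: algebra_simps)
  then have "m \<le> 0" using g by (simp add: mult_le_0_iff)
  then show ?thesis using le[OF s] by simp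
qed

lemma disc_ge_subsolution:
  assumes M: "stochastic S M" and g: "0 \<le> g" "g < 1"
    and u: "\<And>s. s < S \<Longrightarrow> u s \<le> v s + g * mvec S M u s" and s: "s < S"
  shows "u s \<le> disc S M v g s"
proof -
  have m: "mvec S M' (\<lambda>s. - w s) t = - mvec S M' w t" for M' w t
    by (simp add: mvec_def sum_negf)
  have "disc S M (\<lambda>s. - v s) g s \<le> - u s"
    by (rule disc_le_supersolution[OF M g _ s]) (use u in \<open>force simp: m\<close>)
  moreover have "disc S M (\<lambda>s. - v s) g s = - disc S M v g s"
    unfolding disc_def m using suminf_minus[OF disc_summable[OF M s g, of v]] by simp
  ultimately show ?thesis by simp
qed

section \<open>Rational dependence on the discount factor\<close>

text \<open>Evaluation as a ring homomorphism: the determinant of a polynomial matrix can be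
  evaluated entry by entry.\<close>

interpretation poly_eval: comm_ring_hom "\<lambda>p :: real poly. poly p g" for g
  by standard auto

text \<open>Cramer's rule over the polynomial ring. \<open>B\<close> is I - g M with g as the
  indeterminate, \<open>q\<close> its determinant, and the adjugate applied to \<open>v\<close>
  gives the numerators. The determinant is nonzero because at g = 0 the matrix is the
  identity.\<close>

lemma disc_rational:
  assumes M: "stochastic S M"
  obtains q :: "real poly" and p :: "nat \<Rightarrow> real poly" where "q \<noteq> 0"
    "\<And>s g. s < S \<Longrightarrow> 0 \<le> g \<Longrightarrow> g < 1 \<Longrightarrow> poly q g * disc S M v g s = poly (p s) g"
proof -
  define B where "B = mat S S (\<lambda>(i,j). [:of_bool (i = j), - M i j:])"
  define X where "X = adj_mat B"
  define q where "q = Determinant.det B"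
  define p where "p i = (\<Sum>j<S. [:v j:] * X $$ (i,j))" for i
  have B: "B \<in> carrier_mat S S" by (simp add: B_def)
  have X: "X \<in> carrier_mat S S" "X * B = q \<cdot>\<^sub>m 1\<^sub>m S"
    unfolding X_def q_def using adj_mat[OF B] by auto
  have XB: "(\<Sum>j<S. X $$ (i,j) * [:of_bool (j = k), - M j k:]) = (if i = k then q else 0)"
    if "i < S" "k < S" for i k
  proof -
    have "(X * B) $$ (i,k) = (\<Sum>j<S. X $$ (i,j) * B $$ (j,k))"
      using that B X(1) by (auto simp: scalar_prod_def atLeast0LessThan)
    then show ?thesis using that X(2) by (simp add: B_def if_distrib[of "\<lambda>x. q * x"] cong: if_cong del: mult_pCons_right)
  qed
  have "poly q 0 = Determinant.det (map_mat (\<lambda>p. poly p 0) B)"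
    unfolding q_def by simp
  also have "map_mat (\<lambda>p. poly p 0) B = 1\<^sub>m S"
    by (auto simp: B_def)
  finally have "q \<noteq> 0" by auto
  moreover have "poly q g * disc S M v g i = poly (p i) g" if "i < S" "0 \<le> g" "g < 1" for i g
  proof -
    let ?D = "disc S M v g"
    have "poly q g * ?D i = (\<Sum>k<S. poly (if i = k then q else 0) g * ?D k)"
      using that by (simp add: if_distrib[of "\<lambda>p. poly p _ * _"] cong: if_cong)
    also have "\<dots> = (\<Sum>k<S. \<Sum>j<S. poly (X $$ (i,j)) g * (of_bool (j = k) - g * M j k) * ?D k)"
      using that by (intro sum.cong refl) (simp add: XB[symmetric] poly_sum sum_distrib_left algebra_simps)
    also have "\<dots> = (\<Sum>j<S. \<Sum>k<S. poly (X $$ (i,j)) g * (of_bool (j = k) - g * M j k) * ?D k)"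
      by (rule sum.swap)
    also have "\<dots> = (\<Sum>j<S. poly (X $$ (i,j)) g * v j)"
    proof (intro sum.cong refl)
      fix j assume "j \<in> {..<S}"
      then have j: "j < S" by simp
      have "(\<Sum>k<S. poly (X $$ (i,j)) g * (of_bool (j = k) - g * M j k) * ?D k)
          = poly (X $$ (i,j)) g * ((\<Sum>k<S. of_bool (j = k) * ?D k) - g * (\<Sum>k<S. M j k * ?D k))"
        by (simp add: sum_distrib_left sum_subtractf algebra_simps)
      also have "(\<Sum>k<S. of_bool (j = k) * ?D k) = ?D j"
        using j by (simp add: of_bool_def if_distrib[of "\<lambda>x. x * _"] cong: if_cong)
      also have "?D j - g * (\<Sum>k<S. M j k * ?D k) = v j"
        using disc_eq[OF M j that(2,3), of v] by (simp add: mvec_def)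
      finally show "(\<Sum>k<S. poly (X $$ (i,j)) g * (of_bool (j = k) - g * M j k) * ?D k)
          = poly (X $$ (i,j)) g * v j" .
    qed
    finally show ?thesis by (simp add: p_def poly_sum mult.commute)
  qed
  ultimately show ?thesis using that by blast
qed

declare mpow.simps [simp del]

section \<open>Signs and expansions of rational functions to the right of 0\<close>

text \<open>The lowest nonzero coefficient decides the sign: a nonzero constant term wins by
  continuity, and a zero one leaves a factor x > 0 in front of a shorter polynomial.\<close>

lemma poly_eventually_sign:
  "(\<forall>\<^sub>F x in at_right 0. 0 < poly p x) \<or> (\<forall>\<^sub>F x in at_right 0. poly p x < 0) \<or> p = 0"
  for p :: "real poly"
proof (induction p)
  case 0
  then show ?case by simp
next
  case (pCons a p)
  show ?case
  proof (cases "a = 0")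
    case False
    have "((\<lambda>x. poly (pCons a p) x) \<longlongrightarrow> poly (pCons a p) 0) (at_right 0)"
      by (intro tendsto_intros)
    then have lim: "((\<lambda>x. poly (pCons a p) x) \<longlongrightarrow> a) (at_right 0)" by simp
    show ?thesis
      using False order_tendstoD(1)[OF lim, of 0] order_tendstoD(2)[OF lim, of 0] by (cases "0 < a") auto
  next
    case True
    have pos: "\<forall>\<^sub>F x in at_right (0::real). 0 < x" by (simp add: eventually_at_right_less)
    from True pCons consider "\<forall>\<^sub>F x in at_right 0. 0 < poly p x" | "\<forall>\<^sub>F x in at_right 0. poly p x < 0"
      by auto
    then show ?thesis
    proof cases
      case 1
      then have "\<forall>\<^sub>F x in at_right 0. 0 < poly (pCons a p) x"
        using pos by eventually_elim (simp add: True)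
      then show ?thesis by blast
    next
      case 2
      then have "\<forall>\<^sub>F x in at_right 0. poly (pCons a p) x < 0"
        using pos by eventually_elim (simp add: True mult_pos_neg)
      then show ?thesis by blast
    qed
  qed
qed

lemma poly_eventually_nonzero:
  assumes "p \<noteq> 0"
  shows "\<forall>\<^sub>F x in at_right 0. poly p x \<noteq> (0::real)"
  using poly_eventually_sign[of p] assms by (auto elim: eventually_mono)

lemma tendsto_poly_right: "((\<lambda>x. poly p x) \<longlongrightarrow> poly p 0) (at_right (0::real))"
  by (intro tendsto_intros)

lemma at_right_0_less_1: "\<forall>\<^sub>F x in at_right (0::real). 0 < x \<and> x < 1"
  unfolding eventually_at_right_field by (rule exI[of _ 1]) auto

text \<open>Since x f(x) stays bounded, every factor x of its denominator must cancel against the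
  numerator. What remains is regular at 0, and two exact divisions by x split off the coefficients
  \<open>a\<close> and \<open>b\<close>.\<close>

lemma rational_expansion:
  fixes p q :: "real poly"
  assumes q: "q \<noteq> 0" and f: "\<forall>\<^sub>F x in at_right 0. poly q x * f x = poly p x"
    and bd: "\<forall>\<^sub>F x in at_right 0. \<bar>x * f x\<bar> \<le> B"
  obtains a b w c where "\<forall>\<^sub>F x in at_right 0. f x = a / x + b + x * w x" "(w \<longlongrightarrow> c) (at_right 0)"
proof -
  \<comment> \<open>One factor x is removed per step: with \<open>F\<close> bounded the left side
    tends to 0, so \<open>P\<close> vanishes at 0 and is divisible by x.\<close>
  have cancel: "\<exists>P'. \<forall>\<^sub>F x in at_right 0. poly q' x * F x = poly P' x"
    if "\<forall>\<^sub>F x in at_right 0. x ^ m * poly q' x * F x = poly P x"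
      "\<forall>\<^sub>F x in at_right 0. \<bar>F x\<bar> \<le> B" for m and q' P :: "real poly" and F
    using that
  proof (induction m arbitrary: P)
    case 0
    then show ?case by auto
  next
    case (Suc m)
    have "((\<lambda>x. x ^ Suc m * poly q' x * F x) \<longlongrightarrow> 0) (at_right 0)"
    proof (rule Lim_null_comparison)
      show "\<forall>\<^sub>F x in at_right 0. norm (x ^ Suc m * poly q' x * F x) \<le> \<bar>x ^ Suc m * poly q' x\<bar> * B"
        using Suc(3) by eventually_elim (simp add: abs_mult mult_left_mono)
      have "((\<lambda>x. \<bar>x ^ Suc m * poly q' x\<bar> * B) \<longlongrightarrow> \<bar>0 ^ Suc m * poly q' 0\<bar> * B) (at_right 0)"
        by (intro tendsto_intros)
      then show "((\<lambda>x. \<bar>x ^ Suc m * poly q' x\<bar> * B) \<longlongrightarrow> 0) (at_right 0)" by simp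
    qed
    then have "((\<lambda>x. poly P x) \<longlongrightarrow> 0) (at_right 0)"
      using Suc(2) by (rule Lim_transform_eventually)
    then have "poly P 0 = 0" using tendsto_poly_right tendsto_unique trivial_limit_at_right_real by blast
    then have "[:0,1:] dvd P" using poly_eq_0_iff_dvd[of P 0] by simp
    then obtain P1 where P1: "P = [:0,1:] * P1" by (rule dvdE)
    have "\<forall>\<^sub>F x in at_right 0. x ^ m * poly q' x * F x = poly P1 x"
      using Suc(2) at_right_0_less_1 by eventually_elim (simp add: P1 algebra_simps)
    then show ?case using Suc by blast
  qed
  obtain q' where "q = [:-0,1:] ^ order 0 q * q'" and nd: "\<not> [:-0,1:] dvd q'"
    using order_decomp[OF q, of 0] by blast
  then have qq: "poly q x = x ^ order 0 q * poly q' x" for x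
    by (metis poly_mult poly_power poly_pCons poly_0 mult_zero_right add_0 mult_1_right add.right_neutral minus_zero)
  have q0: "poly q' 0 \<noteq> 0" using nd poly_eq_0_iff_dvd[of q' 0] by blast
  then have "q' \<noteq> 0" by auto
  have "\<forall>\<^sub>F x in at_right 0. x ^ order 0 q * poly q' x * (x * f x) = poly (pCons 0 p) x"
    using f by eventually_elim (simp add: qq algebra_simps)
  then obtain P where eq: "\<forall>\<^sub>F x in at_right 0. poly q' x * (x * f x) = poly P x"
    using cancel[OF _ bd] by blast
  have pos: "\<forall>\<^sub>F x in at_right (0::real). 0 < x" by (simp add: eventually_at_right_less)
  \<comment> \<open>\<open>a\<close>, and likewise \<open>b\<close> below, is chosen so that the
    remaining numerator vanishes at 0 and the next division by x is exact.\<close>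
  define a where "a = poly P 0 / poly q' 0"
  have "poly (P - [:a:] * q') 0 = 0" using q0 by (simp add: a_def)
  then have "[:0,1:] dvd P - [:a:] * q'" using poly_eq_0_iff_dvd[of "P - [:a:] * q'" 0] by simp
  then obtain P2 where P2: "P - [:a:] * q' = [:0,1:] * P2" by (rule dvdE)
  define b where "b = poly P2 0 / poly q' 0"
  have "poly (P2 - [:b:] * q') 0 = 0" using q0 by (simp add: b_def)
  then have "[:0,1:] dvd P2 - [:b:] * q'" using poly_eq_0_iff_dvd[of "P2 - [:b:] * q'" 0] by simp
  then obtain P3 where P3: "P2 - [:b:] * q' = [:0,1:] * P3" by (rule dvdE)
  have e2: "poly P x = a * poly q' x + x * poly P2 x" for x
    using arg_cong[OF P2, of "\<lambda>p. poly p x"] by simp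
  have e3: "poly P2 x = b * poly q' x + x * poly P3 x" for x
    using arg_cong[OF P3, of "\<lambda>p. poly p x"] by simp
  have "\<forall>\<^sub>F x in at_right 0. f x = a / x + b + x * (poly P3 x / poly q' x)"
    using eq poly_eventually_nonzero[OF \<open>q' \<noteq> 0\<close>] pos
    by eventually_elim (simp add: e2 e3 field_simps)
  moreover have "((\<lambda>x. poly P3 x / poly q' x) \<longlongrightarrow> poly P3 0 / poly q' 0) (at_right 0)"
    using q0 by (intro tendsto_intros)
  ultimately show ?thesis by (rule that)
qed

section \<open>Laurent expansion of the discounted value at discount 1\<close>

text \<open>The substitution g = 1 - x moves the pole to 0. The bound B / (1 - g) on the discounted
  value is what limits it to order one.\<close>

lemma laurent_exists:
  assumes M: "stochastic S M"
  obtains \<rho> h w w0 where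
    "\<And>s. s < S \<Longrightarrow> \<forall>\<^sub>F x in at_right 0. disc S M v (1 - x) s = \<rho> s / x + h s + x * w s x"
    "\<And>s. s < S \<Longrightarrow> (w s \<longlongrightarrow> w0 s) (at_right 0)"
proof -
  obtain q p where q: "q \<noteq> 0"
    "\<And>s g. s < S \<Longrightarrow> 0 \<le> g \<Longrightarrow> g < 1 \<Longrightarrow> poly q g * disc S M v g s = poly (p s) g"
    using disc_rational[OF M] by metis
  obtain B where B: "\<And>t. t < S \<Longrightarrow> \<bar>v t\<bar> \<le> B" using vector_bound by blast
  have ex: "\<exists>a b w c. (\<forall>\<^sub>F x in at_right 0. disc S M v (1 - x) s = a / x + b + x * w x)
      \<and> (w \<longlongrightarrow> c) (at_right 0)" if s: "s < S" for s
  proof -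
    let ?c = "\<lambda>p. pcompose p [:1,-1:]"
    have nz: "?c q \<noteq> 0" using q(1) by (simp add: pcompose_eq_0_iff)
    have e1: "\<forall>\<^sub>F x in at_right 0. poly (?c q) x * disc S M v (1 - x) s = poly (?c (p s)) x"
      using at_right_0_less_1 by eventually_elim (use q(2)[OF s] in \<open>simp add: poly_pcompose\<close>)
    have e2: "\<forall>\<^sub>F x in at_right 0. \<bar>x * disc S M v (1 - x) s\<bar> \<le> B"
      using at_right_0_less_1
    proof eventually_elim
      case (elim x)
      then show ?case using disc_abs_le[OF M s _ _ B, of "1 - x"]
        by (simp add: abs_mult field_simps)
    qed
    obtain a b w c where "\<forall>\<^sub>F x in at_right 0. disc S M v (1 - x) s = a / x + b + x * w x"
      "(w \<longlongrightarrow> c) (at_right 0)" by (rule rational_expansion[OF nz e1 e2])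
    then show ?thesis by (intro exI conjI)
  qed
  define r where "r s = (SOME (a, b, w, c).
    (\<forall>\<^sub>F x in at_right 0. disc S M v (1 - x) s = a / x + b + x * w x)
      \<and> (w \<longlongrightarrow> c) (at_right (0::real)))" for s
  have r: "case r s of (a, b, w, c) \<Rightarrow> 
    (\<forall>\<^sub>F x in at_right 0. disc S M v (1 - x) s = a / x + b + x * w x)
      \<and> (w \<longlongrightarrow> c) (at_right 0)" if s: "s < S" for s
  proof -
    obtain a b w c where *: "\<forall>\<^sub>F x in at_right 0. disc S M v (1 - x) s = a / x + b + x * w x"
      "(w \<longlongrightarrow> c) (at_right 0)" using ex[OF s] by (elim exE conjE)
    show ?thesis unfolding r_def
      by (rule someI[of _ "(a, b, w, c)"]) (simp only: prod.case, intro conjI *)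
  qed
  show ?thesis
  proof (rule that)
    fix s assume "s < S"
    note * = r[OF this, unfolded case_prod_beta]
    show "\<forall>\<^sub>F x in at_right 0. disc S M v (1 - x) s
        = fst (r s) / x + fst (snd (r s)) + x * fst (snd (snd (r s))) x"
      using * by (rule conjunct1)
    show "(fst (snd (snd (r s))) \<longlongrightarrow> snd (snd (snd (r s)))) (at_right 0)"
      using * by (rule conjunct2)
  qed
qed

text \<open>Uniqueness of the coefficients: once the earlier ones vanish, the next one is the limit
  of what is left after dividing by x.\<close>

lemma expansion_eq_0:
  assumes e: "\<forall>\<^sub>F x in at_right 0. a / x + b + x * c x = 0" and c: "(c \<longlongrightarrow> c0) (at_right (0::real))"
  shows "a = 0" "b = 0" "c0 = (0::real)"
proof -
  have e1: "\<forall>\<^sub>F x in at_right 0. a + x * (b + x * c x) = 0"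
    using e at_right_0_less_1 by eventually_elim (simp add: field_simps)
  have "((\<lambda>x. a + x * (b + x * c x)) \<longlongrightarrow> a + 0 * (b + 0 * c0)) (at_right 0)"
    by (intro tendsto_intros c)
  moreover have "((\<lambda>x. a + x * (b + x * c x)) \<longlongrightarrow> 0) (at_right 0)"
    using e1 by (rule tendsto_eventually)
  ultimately show a: "a = 0" using tendsto_unique trivial_limit_at_right_real by fastforce
  have e2: "\<forall>\<^sub>F x in at_right 0. b + x * c x = 0"
    using e1 at_right_0_less_1 by eventually_elim (simp add: a)
  have "((\<lambda>x. b + x * c x) \<longlongrightarrow> b + 0 * c0) (at_right 0)"
    by (intro tendsto_intros c)
  moreover have "((\<lambda>x. b + x * c x) \<longlongrightarrow> 0) (at_right 0)"
    using e2 by (rule tendsto_eventually)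
  ultimately show b: "b = 0" using tendsto_unique trivial_limit_at_right_real by fastforce
  have "\<forall>\<^sub>F x in at_right 0. c x = 0"
    using e2 at_right_0_less_1 by eventually_elim (simp add: b)
  then have "(c \<longlongrightarrow> 0) (at_right 0)" by (rule tendsto_eventually)
  then show "c0 = 0" using c tendsto_unique trivial_limit_at_right_real by blast
qed

text \<open>The expansion is inserted into the fixed-point equation and the coefficients of 1/x, 1
  and x are compared. The third equation puts \<open>M h\<close> into the range of M - I; this fixes
  the additive freedom that the Poisson equation leaves in \<open>h\<close>.\<close>

lemma laurent_equations:
  assumes M: "stochastic S M" and s: "s < S"
    and e: "\<And>s. s < S \<Longrightarrow> \<forall>\<^sub>F x in at_right 0. disc S M v (1 - x) s = \<rho> s / x + h s + x * w s x"
    and w: "\<And>s. s < S \<Longrightarrow> (w s \<longlongrightarrow> w0 s) (at_right 0)"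
  shows "mvec S M \<rho> s = \<rho> s" "v s = \<rho> s + h s - mvec S M h s"
    "mvec S M h s = mvec S M w0 s - w0 s"
proof -
  let ?m = "\<lambda>u. mvec S M u s"
  let ?c = "\<lambda>x. w s x - ?m (\<lambda>t. w t x) + ?m h + x * ?m (\<lambda>t. w t x)"
  have all: "\<forall>\<^sub>F x in at_right 0. \<forall>t\<in>{..<S}. disc S M v (1 - x) t = \<rho> t / x + h t + x * w t x"
    using e by (intro eventually_ball_finite) auto
  have ev: "\<forall>\<^sub>F x in at_right 0. (\<rho> s - ?m \<rho>) / x + (h s - v s - ?m h + ?m \<rho>) + x * ?c x = 0"
    using all at_right_0_less_1
  proof eventually_elim
    case (elim x)
    have "disc S M v (1 - x) s = v s + (1 - x) * ?m (disc S M v (1 - x))"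
      using disc_eq[OF M s, of "1 - x" v] elim by simp
    also have "?m (disc S M v (1 - x)) = ?m (\<lambda>t. 1 / x * \<rho> t + h t + x * w t x)"
      using elim by (intro mvec_cong) auto
    also have "\<dots> = ?m \<rho> / x + ?m h + x * ?m (\<lambda>t. w t x)"
      by (simp only: mvec_add mvec_scale) simp
    finally have eq: "\<rho> s / x + h s + x * w s x = v s + (1 - x) * (?m \<rho> / x + ?m h + x * ?m (\<lambda>t. w t x))"
      using elim s by auto
    have "(\<rho> s - ?m \<rho>) / x + (h s - v s - ?m h + ?m \<rho>) + x * ?c x
       = (\<rho> s / x + h s + x * w s x) - (v s + (1 - x) * (?m \<rho> / x + ?m h + x * ?m (\<lambda>t. w t x)))"
      using elim by (simp add: field_simps)
    then show ?case using eq by simp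
  qed
  have c: "(?c \<longlongrightarrow> w0 s - ?m w0 + ?m h + 0 * ?m w0) (at_right 0)"
    unfolding mvec_def by (intro tendsto_intros w s) auto
  note z = expansion_eq_0[OF ev c]
  show "?m \<rho> = \<rho> s" "v s = \<rho> s + h s - ?m h" "?m h = ?m w0 - w0 s" using z by auto
qed

section \<open>Cesaro limits, gain and bias\<close>

lemma average_tendsto_0:
  assumes "\<And>N. \<bar>\<Sum>k\<le>N. y k\<bar> \<le> (B::real)"
  shows "(\<lambda>N. (\<Sum>k\<le>N. y k) / real (Suc N)) \<longlonglongrightarrow> 0"
proof (rule Lim_null_comparison)
  show "\<forall>\<^sub>F N in sequentially. norm ((\<Sum>k\<le>N. y k) / real (Suc N)) \<le> B * inverse (real (Suc N))"
    using assms by (auto simp: divide_inverse abs_mult simp del: of_nat_Suc intro!: always_eventually mult_right_mono)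
  show "(\<lambda>N. B * inverse (real (Suc N))) \<longlonglongrightarrow> 0"
    using LIMSEQ_inverse_real_of_nat by (rule tendsto_mult_right_zero)
qed

lemma mvec_mpow_invariant:
  assumes "\<And>s. s < S \<Longrightarrow> mvec S M \<rho> s = \<rho> s" "s < S"
  shows "mvec S (mpow S M t) \<rho> s = \<rho> s"
proof (induction t)
  case 0
  show ?case using assms(2) by (rule mvec_mpow_0)
next
  case (Suc t)
  have "mvec S (mpow S M (Suc t)) \<rho> s = mvec S (mpow S M t) (mvec S M \<rho>) s" by (rule mvec_mpow_Suc)
  also have "\<dots> = mvec S (mpow S M t) \<rho> s" using assms(1) by (rule mvec_cong)
  finally show ?case using Suc by simp
qed

text \<open>Both averages telescope. By the Poisson equation the partial sums of
  \<open>M^t v - \<rho>\<close> are \<open>h - M^k h\<close>, and the averages of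
  \<open>M^k h\<close> vanish because \<open>M h = M w - w\<close> makes their sums bounded.\<close>

lemma average_limits:
  assumes M: "stochastic S M" and s: "s < S"
    and \<rho>: "\<And>s. s < S \<Longrightarrow> mvec S M \<rho> s = \<rho> s"
    and h: "\<And>s. s < S \<Longrightarrow> v s = \<rho> s + h s - mvec S M h s"
    and w: "\<And>s. s < S \<Longrightarrow> mvec S M h s = mvec S M w s - w s"
  shows "(\<lambda>N. (\<Sum>t\<le>N. mvec S (mpow S M t) v s) / real (Suc N)) \<longlonglongrightarrow> \<rho> s"
    and "(\<lambda>N. (\<Sum>k\<le>N. \<Sum>t<k. mvec S (mpow S M t) v s - \<rho> s) / real (Suc N)) \<longlonglongrightarrow> h s"
proof -
  let ?p = "\<lambda>t u. mvec S (mpow S M t) u s"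
  have bd: "\<exists>B. \<forall>t. \<bar>?p t u\<bar> \<le> B" for u
    using vector_bound[of S u] mvec_abs_le[OF stochastic_mpow[OF M] s, of u] by metis
  have pv: "?p t v = \<rho> s + (?p t h - ?p (Suc t) h)" for t
  proof -
    have "?p t v = ?p t (\<lambda>s. (\<rho> s + h s) - mvec S M h s)" using h by (intro mvec_cong) auto
    also have "\<dots> = ?p t \<rho> + ?p t h - ?p t (mvec S M h)" by (simp only: mvec_diff mvec_add)
    also have "?p t \<rho> = \<rho> s" using \<rho> s by (rule mvec_mpow_invariant)
    also have "?p t (mvec S M h) = ?p (Suc t) h" by (simp only: mvec_mpow_Suc)
    finally show ?thesis by simp
  qed
  have ph: "?p (Suc t) h = ?p (Suc t) w - ?p t w" for t
  proof -
    have "?p (Suc t) h = ?p t (mvec S M h)" by (simp only: mvec_mpow_Suc)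
    also have "\<dots> = ?p t (\<lambda>s. mvec S M w s - w s)" using w by (intro mvec_cong) auto
    finally show ?thesis by (simp only: mvec_diff mvec_mpow_Suc)
  qed
  have tel: "(\<Sum>t<k. ?p t h - ?p (Suc t) h) = ?p 0 h - ?p k h" for k
    by (rule sum_lessThan_telescope')
  obtain B where B: "\<And>t. \<bar>?p t h\<bar> \<le> B" using bd[of h] by blast
  have "(\<lambda>N. (\<Sum>t\<le>N. ?p t h - ?p (Suc t) h) / real (Suc N)) \<longlonglongrightarrow> 0"
  proof (rule average_tendsto_0)
    show "\<bar>\<Sum>t\<le>N. ?p t h - ?p (Suc t) h\<bar> \<le> 2 * B" for N
      using tel[of "Suc N"] B[of 0] B[of "Suc N"] by (simp add: lessThan_Suc_atMost)
  qed
  then have "(\<lambda>N. \<rho> s + (\<Sum>t\<le>N. ?p t h - ?p (Suc t) h) / real (Suc N)) \<longlonglongrightarrow> \<rho> s + 0"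
    by (intro tendsto_intros)
  moreover have "(\<Sum>t\<le>N. ?p t v) / real (Suc N) = \<rho> s + (\<Sum>t\<le>N. ?p t h - ?p (Suc t) h) / real (Suc N)" for N
    by (subst pv, subst sum.distrib) (simp add: field_simps)
  ultimately show "(\<lambda>N. (\<Sum>t\<le>N. ?p t v) / real (Suc N)) \<longlonglongrightarrow> \<rho> s" by (simp only: add_0_right)
  obtain B' where B': "\<And>t. \<bar>?p t w\<bar> \<le> B'" using bd[of w] by blast
  have "(\<lambda>N. (\<Sum>t\<le>N. ?p t h) / real (Suc N)) \<longlonglongrightarrow> 0"
  proof (rule average_tendsto_0)
    fix N
    have "(\<Sum>t\<le>N. ?p t h) = ?p 0 h + (\<Sum>t<N. ?p (Suc t) w - ?p t w)"
      unfolding ph[symmetric] by (rule sum.atMost_shift)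
    also have "(\<Sum>t<N. ?p (Suc t) w - ?p t w) = ?p N w - ?p 0 w"
      by (rule sum_lessThan_telescope)
    finally show "\<bar>\<Sum>t\<le>N. ?p t h\<bar> \<le> B + 2 * B'"
      using B[of 0] B'[of 0] B'[of N] by linarith
  qed
  then have "(\<lambda>N. h s - (\<Sum>t\<le>N. ?p t h) / real (Suc N)) \<longlonglongrightarrow> h s - 0"
    by (intro tendsto_intros)
  moreover have "(\<Sum>k\<le>N. \<Sum>t<k. ?p t v - \<rho> s) / real (Suc N) = h s - (\<Sum>t\<le>N. ?p t h) / real (Suc N)" for N
  proof -
    have "(\<Sum>t<k. ?p t v - \<rho> s) = h s - ?p k h" for k
      using tel[of k] mvec_mpow_0[OF s, of M h] by (simp only: pv add_diff_cancel_left')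
    then have "(\<Sum>k\<le>N. \<Sum>t<k. ?p t v - \<rho> s) = real (Suc N) * h s - (\<Sum>t\<le>N. ?p t h)"
      by (simp add: sum_subtractf)
    then show ?thesis by (simp add: field_simps)
  qed
  ultimately show "(\<lambda>N. (\<Sum>k\<le>N. \<Sum>t<k. ?p t v - \<rho> s) / real (Suc N)) \<longlonglongrightarrow> h s" by (simp only: diff_0_right)
qed

text \<open>\<open>Pinf\<close>, \<open>gain\<close> and \<open>bias\<close> see the policy only
  through \<open>Ppol\<close> and \<open>rpol\<close>. This definition and the next two take a bare
  matrix and reward vector instead.\<close>

definition limmat :: "nat \<Rightarrow> (nat \<Rightarrow> nat \<Rightarrow> real) \<Rightarrow> nat \<Rightarrow> nat \<Rightarrow> real" where
  "limmat S M s s' = cesaro_lim (\<lambda>t. mpow S M t s s')"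

definition mgain :: "nat \<Rightarrow> (nat \<Rightarrow> nat \<Rightarrow> real) \<Rightarrow> (nat \<Rightarrow> real) \<Rightarrow> nat \<Rightarrow> real" where
  "mgain S M v = mvec S (limmat S M) v"

definition mbias :: "nat \<Rightarrow> (nat \<Rightarrow> nat \<Rightarrow> real) \<Rightarrow> (nat \<Rightarrow> real) \<Rightarrow> nat \<Rightarrow> real" where
  "mbias S M v s = cesaro_lim (\<lambda>T. \<Sum>t<T. mvec S (mpow S M t) v s - mgain S M v s)"

lemma cesaro_limI:
  "(\<lambda>N. (\<Sum>k\<le>N. x k) / real (Suc N)) \<longlonglongrightarrow> l \<Longrightarrow> cesaro_lim x = l"
  unfolding cesaro_lim_def by (rule limI)

text \<open>\<open>cesaro_lim\<close> is a \<open>lim\<close> and is informative only once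
  convergence is known. A single matrix entry is handled by taking the indicator vector of
  \<open>s'\<close> as reward.\<close>

lemma limmat_tendsto:
  assumes M: "stochastic S M" and s: "s < S" "s' < S"
  shows "(\<lambda>N. (\<Sum>t\<le>N. mpow S M t s s') / real (Suc N)) \<longlonglongrightarrow> limmat S M s s'"
proof -
  let ?v = "\<lambda>t. if t = s' then 1 else (0::real)"
  obtain \<rho> h w w0 where
    e: "\<And>s. s < S \<Longrightarrow> \<forall>\<^sub>F x in at_right 0. disc S M ?v (1 - x) s = \<rho> s / x + h s + x * w s x"
    "\<And>s. s < S \<Longrightarrow> (w s \<longlongrightarrow> w0 s) (at_right 0)"
    by (rule laurent_exists[OF M, where v = ?v]) (rule that)
  have "mvec S (mpow S M t) ?v s = mpow S M t s s'" for t
    using s by (simp add: mvec_def if_distrib[of "\<lambda>x. _ * x"] cong: if_cong)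
  then have "(\<lambda>N. (\<Sum>t\<le>N. mpow S M t s s') / real (Suc N)) \<longlonglongrightarrow> \<rho> s"
    using average_limits(1)[OF M s(1), of \<rho> ?v h w0] laurent_equations[OF M _ e] by simp
  then show ?thesis using cesaro_limI unfolding limmat_def by metis
qed

lemma mgain_tendsto:
  assumes M: "stochastic S M" and s: "s < S"
  shows "(\<lambda>N. (\<Sum>t\<le>N. mvec S (mpow S M t) v s) / real (Suc N)) \<longlonglongrightarrow> mgain S M v s"
proof -
  have "(\<Sum>t\<le>N. mvec S (mpow S M t) v s) / real (Suc N)
      = (\<Sum>s'<S. (\<Sum>t\<le>N. mpow S M t s s') / real (Suc N) * v s')" for N
    unfolding mvec_def sum_distrib_right sum_divide_distrib by (subst sum.swap) (simp add: field_simps)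
  then show ?thesis unfolding mgain_def mvec_def[of S "limmat S M"]
    by (simp only:) (intro tendsto_intros limmat_tendsto M s, auto)
qed

lemma stochastic_limmat:
  assumes M: "stochastic S M"
  shows "stochastic S (limmat S M)"
  unfolding stochastic_def
proof (intro allI impI conjI)
  fix s assume s: "s < S"
  show "0 \<le> limmat S M s s'" if "s' < S" for s'
    using limmat_tendsto[OF M s that] stochastic_mpow[OF M] s that
    by (intro LIMSEQ_le_const) (auto simp: stochastic_def intro!: divide_nonneg_nonneg sum_nonneg)
  have "(\<lambda>N. (\<Sum>t\<le>N. mvec S (mpow S M t) (\<lambda>_. 1) s) / real (Suc N)) \<longlonglongrightarrow> 1"
    by (simp add: mvec_const[OF stochastic_mpow[OF M] s] field_simps del: of_nat_Suc)
  then have "mgain S M (\<lambda>_. 1) s = 1"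
    using mgain_tendsto[OF M s] LIMSEQ_unique by blast
  then show "(\<Sum>s'<S. limmat S M s s') = 1" by (simp add: mgain_def mvec_def)
qed

text \<open>Shifting the averaging window by one step changes the sum only by its two end terms, so
  the rows of the limit are stationary distributions.\<close>

lemma limmat_invariant:
  assumes M: "stochastic S M" and s: "s < S"
  shows "mvec S (limmat S M) (mvec S M v) s = mvec S (limmat S M) v s"
proof -
  let ?p = "\<lambda>t u. mvec S (mpow S M t) u s"
  obtain B where B: "\<And>t. \<bar>?p t v\<bar> \<le> B"
    using vector_bound[of S v] mvec_abs_le[OF stochastic_mpow[OF M] s, of v] by metis
  have "(\<lambda>N. (\<Sum>t\<le>N. ?p (Suc t) v - ?p t v) / real (Suc N)) \<longlonglongrightarrow> 0"
  proof (rule average_tendsto_0)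
    show "\<bar>\<Sum>t\<le>N. ?p (Suc t) v - ?p t v\<bar> \<le> 2 * B" for N
      using sum_lessThan_telescope[of "\<lambda>t. ?p t v" "Suc N"] B[of 0] B[of "Suc N"]
      by (simp add: lessThan_Suc_atMost)
  qed
  moreover have "(\<lambda>N. (\<Sum>t\<le>N. ?p t (mvec S M v)) / real (Suc N) - (\<Sum>t\<le>N. ?p t v) / real (Suc N))
      \<longlonglongrightarrow> mgain S M (mvec S M v) s - mgain S M v s"
    by (intro tendsto_diff mgain_tendsto M s)
  then have "(\<lambda>N. (\<Sum>t\<le>N. ?p (Suc t) v - ?p t v) / real (Suc N)) \<longlonglongrightarrow> mgain S M (mvec S M v) s - mgain S M v s"
    by (simp only: mvec_mpow_Suc[symmetric] sum_subtractf diff_divide_distrib)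
  ultimately show ?thesis unfolding mgain_def using LIMSEQ_unique by fastforce
qed

text \<open>The abstract Laurent coefficients satisfy the hypotheses of
  \<open>average_limits\<close>, so uniqueness of limits identifies them with the gain and the bias
  defined by Cesaro averages.\<close>

lemma laurent_mgain_mbias:
  assumes M: "stochastic S M"
  obtains w w0 where
    "\<And>s. s < S \<Longrightarrow> \<forall>\<^sub>F x in at_right 0. disc S M v (1 - x) s = mgain S M v s / x + mbias S M v s + x * w s x"
    "\<And>s. s < S \<Longrightarrow> (w s \<longlongrightarrow> w0 s) (at_right 0)"
    "\<And>s. s < S \<Longrightarrow> mvec S M (mgain S M v) s = mgain S M v s"
    "\<And>s. s < S \<Longrightarrow> v s = mgain S M v s + mbias S M v s - mvec S M (mbias S M v) s"
proof -
  obtain \<rho> h w w0 where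
    e: "\<And>s. s < S \<Longrightarrow> \<forall>\<^sub>F x in at_right 0. disc S M v (1 - x) s = \<rho> s / x + h s + x * w s x"
    "\<And>s. s < S \<Longrightarrow> (w s \<longlongrightarrow> w0 s) (at_right 0)"
    by (rule laurent_exists[OF M, where v = v]) (rule that)
  note eq = laurent_equations[OF M _ e]
  have g: "mgain S M v s = \<rho> s" if "s < S" for s
    using average_limits(1)[OF M that eq(1,2,3)] mgain_tendsto[OF M that] LIMSEQ_unique by blast
  have b: "mbias S M v s = h s" if "s < S" for s
    unfolding mbias_def g[OF that] using average_limits(2)[OF M that eq(1,2,3)] by (rule cesaro_limI)
  show ?thesis
  proof (rule that[of w w0])
    show "mvec S M (mgain S M v) s = mgain S M v s" if "s < S" for s
      using mvec_cong[of S "mgain S M v" \<rho> M s] eq(1)[OF that] g that by simp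
    show "v s = mgain S M v s + mbias S M v s - mvec S M (mbias S M v) s" if "s < S" for s
      using mvec_cong[of S "mbias S M v" h M s] eq(2)[OF that] g b that by simp
  qed (use e g b in auto)
qed

lemma mgain_invariant: "stochastic S M \<Longrightarrow> s < S \<Longrightarrow> mvec S M (mgain S M v) s = mgain S M v s"
  by (rule laurent_mgain_mbias)

lemma poisson_equation:
  "stochastic S M \<Longrightarrow> s < S \<Longrightarrow> v s = mgain S M v s + mbias S M v s - mvec S M (mbias S M v) s"
  by (rule laurent_mgain_mbias)

lemma disc_minus_gain_tendsto:
  assumes M: "stochastic S M" and s: "s < S"
  shows "((\<lambda>x. disc S M v (1 - x) s - mgain S M v s / x) \<longlongrightarrow> mbias S M v s) (at_right 0)"
proof -
  obtain w w0 where
    "\<And>s. s < S \<Longrightarrow> \<forall>\<^sub>F x in at_right 0. disc S M v (1 - x) s = mgain S M v s / x + mbias S M v s + x * w s x"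
    "\<And>s. s < S \<Longrightarrow> (w s \<longlongrightarrow> w0 s) (at_right 0)"
    by (rule laurent_mgain_mbias[OF M, where v = v]) (rule that)
  note e = this(1)[OF s] and w = this(2)[OF s]
  have "((\<lambda>x. mbias S M v s + x * w s x) \<longlongrightarrow> mbias S M v s + 0 * w0 s) (at_right 0)"
    by (intro tendsto_intros w)
  moreover have "\<forall>\<^sub>F x in at_right 0. mbias S M v s + x * w s x = disc S M v (1 - x) s - mgain S M v s / x"
    using e by eventually_elim simp
  ultimately show ?thesis by (auto dest: Lim_transform_eventually)
qed

lemma disc_scaled_tendsto:
  assumes M: "stochastic S M" and s: "s < S"
  shows "((\<lambda>x. x * disc S M v (1 - x) s) \<longlongrightarrow> mgain S M v s) (at_right 0)"
proof -
  have "((\<lambda>x. mgain S M v s + x * (disc S M v (1 - x) s - mgain S M v s / x))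
      \<longlongrightarrow> mgain S M v s + 0 * mbias S M v s) (at_right 0)"
    by (intro tendsto_intros disc_minus_gain_tendsto M s)
  moreover have "\<forall>\<^sub>F x in at_right 0. mgain S M v s + x * (disc S M v (1 - x) s - mgain S M v s / x)
      = x * disc S M v (1 - x) s"
    using at_right_0_less_1 by eventually_elim (simp add: field_simps)
  ultimately show ?thesis by (auto dest: Lim_transform_eventually)
qed

section \<open>Kernels, policies and comparison of two policies near discount 1\<close>

definition is_kernel :: "nat \<Rightarrow> nat \<Rightarrow> kernel \<Rightarrow> bool" where
  "is_kernel S A K \<longleftrightarrow> (\<forall>a<A. stochastic S (\<lambda>s. K s a))"

lemma stochastic_Ppol:
  assumes K: "is_kernel S A K" and p: "is_policy S A p"
  shows "stochastic S (Ppol A K p)"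
  unfolding stochastic_def
proof (intro allI impI conjI)
  fix s assume s: "s < S"
  show "0 \<le> Ppol A K p s s'" if "s' < S" for s'
    using K p s that by (auto simp: Ppol_def is_kernel_def stochastic_def is_policy_def intro!: sum_nonneg)
  have "(\<Sum>s'<S. Ppol A K p s s') = (\<Sum>a<A. p s a * (\<Sum>s'<S. K s a s'))"
    unfolding Ppol_def sum_distrib_left by (rule sum.swap)
  also have "\<dots> = 1" using K p s by (simp add: is_kernel_def stochastic_def is_policy_def)
  finally show "(\<Sum>s'<S. Ppol A K p s s') = 1" .
qed

lemma mvec_Ppol: "mvec S (Ppol A K p) v s = (\<Sum>a<A. p s a * mvec S (\<lambda>s. K s a) v s)"
  unfolding mvec_def Ppol_def sum_distrib_left sum_distrib_right
  by (subst sum.swap) (simp add: mult.assoc)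

lemma Vpol_eq_disc: "Vpol S A K r p g s = disc S (Ppol A K p) (rpol A r p) g s"
  by (simp add: Vpol_def disc_def)

lemma Pinf_eq_limmat: "Pinf S A K p = limmat S (Ppol A K p)"
  by (intro ext) (simp add: Pinf_def limmat_def)

lemma gain_eq_mgain: "gain S A K r p = mgain S (Ppol A K p) (rpol A r p)"
  by (simp add: gain_def mgain_def Pinf_eq_limmat)

lemma bias_eq_mbias: "bias S A K r p s = mbias S (Ppol A K p) (rpol A r p) s"
  by (simp add: bias_def mbias_def gain_eq_mgain)

text \<open>The difference of the two values is p/q - p'/q'. Multiplying it by the square of q q'
  clears the denominators without tracking their sign, so its sign is that of one polynomial, which
  is constant near 0.\<close>

lemma disc_comparison_eventually_constant:
  assumes M: "stochastic S M" and M': "stochastic S M'" and s: "s < S"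
  shows "(\<forall>\<^sub>F x in at_right 0. disc S M v (1 - x) s \<le> disc S M' v' (1 - x) s)
    \<or> (\<forall>\<^sub>F x in at_right 0. \<not> disc S M v (1 - x) s \<le> disc S M' v' (1 - x) s)"
proof -
  obtain q p where q: "q \<noteq> 0"
    "\<And>g. 0 \<le> g \<Longrightarrow> g < 1 \<Longrightarrow> poly q g * disc S M v g s = poly (p s) g"
    using disc_rational[OF M] s by metis
  obtain q' p' where q': "q' \<noteq> 0"
    "\<And>g. 0 \<le> g \<Longrightarrow> g < 1 \<Longrightarrow> poly q' g * disc S M' v' g s = poly (p' s) g"
    using disc_rational[OF M'] s by metis
  let ?c = "\<lambda>p. pcompose p [:1,-1::real:]"
  have nz: "?c q \<noteq> 0" "?c q' \<noteq> 0" using q q' by (simp_all add: pcompose_eq_0_iff)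
  let ?f = "?c ((p s * q' - p' s * q) * (q * q'))"
  have ev: "\<forall>\<^sub>F x in at_right 0. (0 < poly ?f x \<longleftrightarrow> disc S M v (1 - x) s > disc S M' v' (1 - x) s)
     \<and> (poly ?f x < 0 \<longleftrightarrow> disc S M v (1 - x) s < disc S M' v' (1 - x) s)"
    using poly_eventually_nonzero[OF nz(1)] poly_eventually_nonzero[OF nz(2)] at_right_0_less_1
  proof eventually_elim
    case (elim x)
    let ?y = "1 - x"
    have "poly ?f x = (poly q ?y * poly q' ?y)\<^sup>2 * (disc S M v ?y s - disc S M' v' ?y s)"
      using q(2)[of ?y, symmetric] q'(2)[of ?y, symmetric] elim
      by (simp add: poly_pcompose power2_eq_square algebra_simps)
    moreover have "0 < (poly q ?y * poly q' ?y)\<^sup>2" using elim by (simp add: poly_pcompose)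
    ultimately show ?case by (simp add: zero_less_mult_iff mult_less_0_iff)
  qed
  have "(\<forall>\<^sub>F x in at_right 0. 0 < poly ?f x) \<or> (\<forall>\<^sub>F x in at_right 0. poly ?f x \<le> 0)"
    using poly_eventually_sign[of ?f]
  proof (elim disjE)
    assume "\<forall>\<^sub>F x in at_right 0. poly ?f x < 0"
    then have "\<forall>\<^sub>F x in at_right 0. poly ?f x \<le> 0" by (rule eventually_mono) simp
    then show ?thesis ..
  qed auto
  then consider "\<forall>\<^sub>F x in at_right 0. 0 < poly ?f x" | "\<forall>\<^sub>F x in at_right 0. poly ?f x \<le> 0"
    by blast
  then show ?thesis
  proof cases
    case 1
    then have "\<forall>\<^sub>F x in at_right 0. \<not> disc S M v (1 - x) s \<le> disc S M' v' (1 - x) s"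
      using ev by eventually_elim auto
    then show ?thesis ..
  next
    case 2
    then have "\<forall>\<^sub>F x in at_right 0. disc S M v (1 - x) s \<le> disc S M' v' (1 - x) s"
      using ev by eventually_elim auto
    then show ?thesis ..
  qed
qed

definition det_policy :: "(nat \<Rightarrow> nat) \<Rightarrow> policy" where
  "det_policy d s a = (if a = d s then 1 else 0)"

lemma sum_det_policy: "d s < A \<Longrightarrow> (\<Sum>a<A. det_policy d s a * f a) = f (d s)"
  by (simp add: det_policy_def if_distrib[of "\<lambda>x. x * _"] cong: if_cong)

lemma is_det_policy_det_policy:
  "d \<in> {..<S} \<rightarrow>\<^sub>E {..<A} \<Longrightarrow> is_det_policy S A (det_policy d)"
  using sum_det_policy[of d _ A "\<lambda>_. 1"]
  by (auto simp: is_det_policy_def is_policy_def det_policy_def PiE_def Pi_def)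

lemma policy_average_le:
  assumes "is_policy S A p" "s < S" "\<And>a. a < A \<Longrightarrow> f a \<le> B"
  shows "(\<Sum>a<A. p s a * f a) \<le> B"
proof -
  have "(\<Sum>a<A. p s a * f a) \<le> (\<Sum>a<A. p s a * B)"
    using assms by (intro sum_mono mult_left_mono) (auto simp: is_policy_def)
  also have "\<dots> = B" using assms by (simp add: is_policy_def flip: sum_distrib_right)
  finally show ?thesis .
qed

section \<open>Bellman optimality and Blackwell-optimal policies\<close>

locale finite_mdp =
  fixes S A :: nat and K :: kernel and r :: "nat \<Rightarrow> nat \<Rightarrow> real"
  assumes S_pos: "1 \<le> S" and A_pos: "1 \<le> A" and kernel: "is_kernel S A K"
    and reward: "\<And>s a. s < S \<Longrightarrow> a < A \<Longrightarrow> 0 \<le> r s a \<and> r s a \<le> 1"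
begin

abbreviation "kv a v \<equiv> mvec S (\<lambda>s. K s a) v"
abbreviation "val p \<equiv> Vpol S A K r p"
abbreviation "dets \<equiv> {..<S} \<rightarrow>\<^sub>E {..<A}"

lemma stoch_a: "a < A \<Longrightarrow> stochastic S (\<lambda>s. K s a)"
  using kernel by (simp add: is_kernel_def)

lemmas stoch_p = stochastic_Ppol[OF kernel]

lemma rpol_bounds:
  assumes p: "is_policy S A p" and s: "s < S"
  shows "0 \<le> rpol A r p s" "rpol A r p s \<le> 1"
proof -
  show "0 \<le> rpol A r p s" using p s reward by (auto simp: rpol_def is_policy_def intro!: sum_nonneg)
  show "rpol A r p s \<le> 1" unfolding rpol_def using p s reward by (intro policy_average_le[of S]) auto
qed

lemma det_ok: "d \<in> dets \<Longrightarrow> is_policy S A (det_policy d)"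
  using is_det_policy_det_policy by (auto simp: is_det_policy_def)

lemma val_bounds:
  assumes p: "is_policy S A p" and s: "s < S" and g: "0 \<le> g" "g < 1"
  shows "0 \<le> val p g s" "val p g s \<le> 1 / (1 - g)"
proof -
  show "val p g s \<le> 1 / (1 - g)"
    using disc_abs_le[OF stoch_p[OF p] s g, of "rpol A r p" 1] rpol_bounds[OF p]
    unfolding Vpol_eq_disc by auto
  have "(\<lambda>_. 0) s \<le> disc S (Ppol A K p) (rpol A r p) g s"
    by (rule disc_ge_subsolution[OF stoch_p[OF p] g _ s])
      (use rpol_bounds[OF p] mvec_const[OF stoch_p[OF p]] in auto)
  then show "0 \<le> val p g s" by (simp add: Vpol_eq_disc)
qed

lemma val_eq:
  assumes p: "is_policy S A p" and s: "s < S" and g: "0 \<le> g" "g < 1"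
  shows "val p g s = (\<Sum>a<A. p s a * (r s a + g * kv a (val p g) s))"
proof -
  have "val p g s = rpol A r p s + g * mvec S (Ppol A K p) (val p g) s"
    using disc_eq[OF stoch_p[OF p] s g] by (simp add: Vpol_eq_disc mvec_def)
  then show ?thesis by (simp add: rpol_def mvec_Ppol sum.distrib sum_distrib_left algebra_simps)
qed

lemma val_le:
  assumes p: "is_policy S A p" and s: "s < S" and g: "0 \<le> g" "g < 1"
    and u: "\<And>s a. s < S \<Longrightarrow> a < A \<Longrightarrow> r s a + g * kv a u s \<le> u s"
  shows "val p g s \<le> u s"
  unfolding Vpol_eq_disc
proof (rule disc_le_supersolution[OF stoch_p[OF p] g _ s])
  fix s assume s: "s < S"
  have "(\<Sum>a<A. p s a * (r s a + g * kv a u s)) \<le> u s"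
    using p s u by (intro policy_average_le[of S]) auto
  then show "rpol A r p s + g * mvec S (Ppol A K p) u s \<le> u s"
    by (simp add: rpol_def mvec_Ppol sum.distrib sum_distrib_left algebra_simps)
qed

lemma val_ge:
  assumes p: "is_policy S A p" and s: "s < S" and g: "0 \<le> g" "g < 1"
    and u: "\<And>s. s < S \<Longrightarrow> u s \<le> (\<Sum>a<A. p s a * (r s a + g * kv a u s))"
  shows "u s \<le> val p g s"
  unfolding Vpol_eq_disc
proof (rule disc_ge_subsolution[OF stoch_p[OF p] g _ s])
  fix s assume s: "s < S"
  show "u s \<le> rpol A r p s + g * mvec S (Ppol A K p) u s"
    using u[OF s] by (simp add: rpol_def mvec_Ppol sum.distrib sum_distrib_left algebra_simps)
qed

lemma finite_dets: "finite dets" by (intro finite_PiE) auto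

lemma dets_nonempty: "dets \<noteq> {}" using A_pos by (auto simp: PiE_eq_empty_iff lessThan_empty_iff)

text \<open>A deterministic policy maximising the sum of its values admits no improving switch.\<close>
lemma ex_bellman:
  assumes g: "0 \<le> g" "g < 1"
  obtains d where "d \<in> dets"
    "\<And>s a. s < S \<Longrightarrow> a < A \<Longrightarrow> r s a + g * kv a (val (det_policy d) g) s \<le> val (det_policy d) g s"
proof -
  define \<Phi> where "\<Phi> d = (\<Sum>s<S. val (det_policy d) g s)" for d
  have "finite (\<Phi> ` dets)" "\<Phi> ` dets \<noteq> {}" using finite_dets dets_nonempty by auto
  then have "Max (\<Phi> ` dets) \<in> \<Phi> ` dets" by (rule Max_in)
  then obtain d where d: "d \<in> dets" "\<Phi> d = Max (\<Phi> ` dets)" by auto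
  have max: "\<Phi> d' \<le> \<Phi> d" if "d' \<in> dets" for d'
    unfolding d(2) using that finite_dets by (intro Max_ge) auto
  have "r s a + g * kv a (val (det_policy d) g) s \<le> val (det_policy d) g s" if sa: "s < S" "a < A" for s a
  proof (rule ccontr)
    let ?V = "val (det_policy d) g"
    assume c: "\<not> ?thesis"
    define d' where "d' = d(s := a)"
    let ?V' = "val (det_policy d') g"
    have d': "d' \<in> dets" using d sa by (auto simp: d'_def PiE_def extensional_def)
    have dd: "d t < A" "d' t < A" if "t < S" for t using d d' that by auto
    have eqV: "?V t = r t (d t) + g * kv (d t) ?V t" if "t < S" for t
      using val_eq[OF det_ok[OF d(1)] that g] by (simp add: sum_det_policy dd that)
    have eqV': "?V' t = r t (d' t) + g * kv (d' t) ?V' t" if "t < S" for t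
      using val_eq[OF det_ok[OF d'] that g] by (simp add: sum_det_policy dd that)
    have le: "?V t \<le> ?V' t" if t: "t < S" for t
    proof (rule val_ge[OF det_ok[OF d'] t g])
      fix t assume t: "t < S"
      show "?V t \<le> (\<Sum>b<A. det_policy d' t b * (r t b + g * kv b ?V t))"
        using c eqV[OF t] by (simp add: sum_det_policy dd t) (auto simp: d'_def)
    qed
    have "?V s < r s a + g * kv a ?V s" using c by simp
    also have "\<dots> \<le> r s a + g * kv a ?V' s"
      using le sa g by (intro add_left_mono mult_left_mono mvec_mono stoch_a) auto
    also have "\<dots> = ?V' s" using eqV'[OF sa(1)] by (simp add: d'_def)
    finally have "\<Phi> d < \<Phi> d'"
      unfolding \<Phi>_def using le sa by (intro sum_strict_mono_ex1) auto
    then show False using max[OF d'] by simp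
  qed
  then show ?thesis using that d(1) by blast
qed

lemma Vstar_eqI:
  assumes d: "d \<in> dets" and s: "s < S"
    and le: "\<And>p. is_policy S A p \<Longrightarrow> val p g s \<le> val (det_policy d) g s"
  shows "Vstar S A K r g s = val (det_policy d) g s"
  unfolding Vstar_def using det_ok[OF d] le by (intro cSup_eq_maximum) auto

text \<open>The policy from \<open>ex_bellman\<close> has a value that is a supersolution for every
  policy. The supremum in \<open>Vstar\<close> is therefore an attained maximum, by one
  deterministic policy in all states together.\<close>

lemma Vstar_bellman:
  assumes g: "0 \<le> g" "g < 1"
  shows "\<And>s a. s < S \<Longrightarrow> a < A \<Longrightarrow> r s a + g * kv a (Vstar S A K r g) s \<le> Vstar S A K r g s"
    and "\<And>s. s < S \<Longrightarrow> \<exists>a<A. Vstar S A K r g s = r s a + g * kv a (Vstar S A K r g) s"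
    and "\<And>s. s < S \<Longrightarrow> 0 \<le> Vstar S A K r g s \<and> Vstar S A K r g s \<le> 1 / (1 - g)"
    and "\<And>s p. s < S \<Longrightarrow> is_policy S A p \<Longrightarrow> val p g s \<le> Vstar S A K r g s"
    and "\<exists>d\<in>dets. \<forall>s<S. Vstar S A K r g s = val (det_policy d) g s"
proof -
  obtain d where d: "d \<in> dets"
    "\<And>s a. s < S \<Longrightarrow> a < A \<Longrightarrow> r s a + g * kv a (val (det_policy d) g) s \<le> val (det_policy d) g s"
    using ex_bellman[OF g] by blast
  have V: "Vstar S A K r g s = val (det_policy d) g s" if "s < S" for s
    using val_le[OF _ that g d(2)] by (intro Vstar_eqI d(1) that) auto
  have kv: "kv a (Vstar S A K r g) s = kv a (val (det_policy d) g) s" for a s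
    using V by (intro mvec_cong) auto
  show "r s a + g * kv a (Vstar S A K r g) s \<le> Vstar S A K r g s" if "s < S" "a < A" for s a
    using d(2) that V by (simp add: kv)
  show "0 \<le> Vstar S A K r g s \<and> Vstar S A K r g s \<le> 1 / (1 - g)" if "s < S" for s
    using val_bounds[OF det_ok[OF d(1)] that g] V that by simp
  show "val p g s \<le> Vstar S A K r g s" if "s < S" "is_policy S A p" for s p
    using val_le[OF that(2,1) g d(2)] V that by simp
  show "\<exists>a<A. Vstar S A K r g s = r s a + g * kv a (Vstar S A K r g) s" if s: "s < S" for s
  proof (intro exI conjI)
    show "d s < A" using d(1) s by auto
    then show "Vstar S A K r g s = r s (d s) + g * kv (d s) (Vstar S A K r g) s"
      using val_eq[OF det_ok[OF d(1)] s g] V[OF s] by (simp add: sum_det_policy kv)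
  qed
  show "\<exists>d\<in>dets. \<forall>s<S. Vstar S A K r g s = val (det_policy d) g s" using d V by blast
qed

text \<open>Whether a given deterministic policy beats all others is eventually constant as x tends
  to 0. If it were eventually false for each of the finitely many policies, some discount factor
  would have no optimal deterministic policy, contradicting \<open>Vstar_bellman\<close>.\<close>

lemma blackwell_exists: "\<exists>p. blackwell_optimal S A K r p"
proof -
  define Opt where "Opt d x \<longleftrightarrow> (\<forall>e\<in>dets. \<forall>s\<in>{..<S}. val (det_policy e) (1 - x) s \<le> val (det_policy d) (1 - x) s)" for d x
  have const: "(\<forall>\<^sub>F x in at_right 0. Opt d x) \<or> (\<forall>\<^sub>F x in at_right 0. \<not> Opt d x)" if d: "d \<in> dets" for d
  proof (cases "\<forall>e\<in>dets. \<forall>s\<in>{..<S}. \<forall>\<^sub>F x in at_right 0. val (det_policy e) (1 - x) s \<le> val (det_policy d) (1 - x) s")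
    case True
    then have "\<forall>\<^sub>F x in at_right 0. Opt d x"
      unfolding Opt_def using finite_dets by (intro eventually_ball_finite ballI) auto
    then show ?thesis ..
  next
    case False
    then obtain e s where es: "e \<in> dets" "s < S"
      "\<not> (\<forall>\<^sub>F x in at_right 0. val (det_policy e) (1 - x) s \<le> val (det_policy d) (1 - x) s)" by auto
    then have "\<forall>\<^sub>F x in at_right 0. \<not> val (det_policy e) (1 - x) s \<le> val (det_policy d) (1 - x) s"
      using disc_comparison_eventually_constant[OF stoch_p[OF det_ok[OF es(1)]] stoch_p[OF det_ok[OF d]] es(2),
          of "rpol A r (det_policy e)" "rpol A r (det_policy d)"] unfolding Vpol_eq_disc by blast
    then have "\<forall>\<^sub>F x in at_right 0. \<not> Opt d x"
      by eventually_elim (use es in \<open>auto simp: Opt_def\<close>)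
    then show ?thesis ..
  qed
  have "\<exists>d\<in>dets. \<forall>\<^sub>F x in at_right 0. Opt d x"
  proof (rule ccontr)
    assume "\<not> ?thesis"
    then have "\<forall>\<^sub>F x in at_right 0. \<forall>d\<in>dets. \<not> Opt d x"
      using const finite_dets by (intro eventually_ball_finite) blast+
    then have "\<forall>\<^sub>F x in at_right (0::real). False"
      using at_right_0_less_1
    proof eventually_elim
      case (elim x)
      then have g: "0 \<le> 1 - x" "1 - x < 1" by auto
      obtain d where d: "d \<in> dets" "\<forall>s<S. Vstar S A K r (1 - x) s = val (det_policy d) (1 - x) s"
        using Vstar_bellman(5)[OF g] by blast
      have "Opt d x" unfolding Opt_def
      proof (intro ballI)
        fix e s assume "e \<in> dets" "s \<in> {..<S}"
        then show "val (det_policy e) (1 - x) s \<le> val (det_policy d) (1 - x) s"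
          using Vstar_bellman(4)[OF g, of s "det_policy e"] det_ok[of e] d(2) by (simp only: lessThan_iff)
      qed
      then show False using elim(1) d(1) by blast
    qed
    then show False by (simp add: trivial_limit_at_right_real)
  qed
  then obtain d where d: "d \<in> dets" "\<forall>\<^sub>F x in at_right 0. Opt d x" by blast
  from d(2) at_right_0_less_1 have "\<forall>\<^sub>F x in at_right 0. Opt d x \<and> 0 < x \<and> x < 1"
    by (rule eventually_conj)
  then obtain b where b: "b > 0" "\<And>x. 0 < x \<Longrightarrow> x < b \<Longrightarrow> Opt d x \<and> x < 1"
    unfolding eventually_at_right_field by blast
  \<comment> \<open>Half of \<open>b\<close>, because the threshold itself is an admissible discount
    factor while \<open>b(2)\<close> requires 1 - g < b strictly.\<close>
  have "val q g s \<le> val (det_policy d) g s"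
    if q: "is_policy S A q" and g: "1 - b / 2 \<le> g" "g < 1" and s: "s < S" for q g s
  proof -
    have o: "Opt d (1 - g)" "1 - g < 1" using b(2)[of "1 - g"] b(1) g by auto
    then have g': "0 \<le> g" by simp
    obtain e where e: "e \<in> dets" "\<forall>s<S. Vstar S A K r g s = val (det_policy e) g s"
      using Vstar_bellman(5)[OF g' g(2)] by blast
    have "val q g s \<le> Vstar S A K r g s" using Vstar_bellman(4)[OF g' g(2) s q] .
    also have "\<dots> = val (det_policy e) g s" using e s by simp
    also have "\<dots> \<le> val (det_policy d) g s" using o e s by (auto simp: Opt_def)
    finally show ?thesis .
  qed
  then have "blackwell_optimal S A K r (det_policy d)"
    unfolding blackwell_optimal_def using is_det_policy_det_policy[OF d(1)] b(1)
    by (intro conjI exI[of _ "1 - b / 2"]) auto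
  then show ?thesis by blast
qed

text \<open>The choice hidden in \<open>opt_gain\<close> and \<open>opt_bias\<close>; with existence
  proved, the chosen policy is known to be Blackwell-optimal.\<close>

definition "bw = (SOME p. blackwell_optimal S A K r p)"

lemma bw: "blackwell_optimal S A K r bw"
  unfolding bw_def using blackwell_exists by (rule someI_ex)

lemma bw_policy: "is_policy S A bw"
  using bw by (simp add: blackwell_optimal_def is_det_policy_def)

lemma opt_gain_bw: "opt_gain S A K r = gain S A K r bw"
  and opt_bias_bw: "opt_bias S A K r = bias S A K r bw"
  by (simp_all add: opt_gain_def opt_bias_def bw_def)

lemma bw_eventually:
  "\<forall>\<^sub>F x in at_right 0. 0 < x \<and> x < 1 \<and> (\<forall>q. is_policy S A q \<longrightarrow> (\<forall>s<S. val q (1 - x) s \<le> val bw (1 - x) s))"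
proof -
  obtain gb where gb: "gb < 1" "\<And>q g s. is_policy S A q \<Longrightarrow> gb \<le> g \<Longrightarrow> g < 1 \<Longrightarrow> s < S \<Longrightarrow> val q g s \<le> val bw g s"
    using bw unfolding blackwell_optimal_def by blast
  have "\<forall>\<^sub>F x in at_right 0. \<forall>q. is_policy S A q \<longrightarrow> (\<forall>s<S. val q (1 - x) s \<le> val bw (1 - x) s)"
    unfolding eventually_at_right_field by (rule exI[of _ "1 - gb"]) (use gb in auto)
  then show ?thesis using at_right_0_less_1 by eventually_elim auto
qed

lemma Vstar_bw_eventually:
  "\<forall>\<^sub>F x in at_right 0. \<forall>s<S. Vstar S A K r (1 - x) s = val bw (1 - x) s"
  using bw_eventually
proof eventually_elim
  case (elim x)
  then have g: "0 \<le> 1 - x" "1 - x < 1" by auto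
  obtain d where d: "d \<in> dets" "\<forall>s<S. Vstar S A K r (1 - x) s = val (det_policy d) (1 - x) s"
    using Vstar_bellman(5)[OF g] by blast
  then show ?case using elim Vstar_bellman(4)[OF g _ bw_policy] det_ok[OF d(1)] by (auto intro!: antisym)
qed

text \<open>Multiplied by x = 1 - g, discounted values tend to gains, so domination near discount 1
  passes to the limit.\<close>

lemma gain_le_opt_gain:
  assumes p: "is_policy S A p" and s: "s < S"
  shows "gain S A K r p s \<le> opt_gain S A K r s"
proof (rule tendsto_le)
  show "((\<lambda>x. x * val p (1 - x) s) \<longlongrightarrow> gain S A K r p s) (at_right 0)"
    unfolding gain_eq_mgain Vpol_eq_disc using stoch_p[OF p] s by (rule disc_scaled_tendsto)
  show "((\<lambda>x. x * val bw (1 - x) s) \<longlongrightarrow> opt_gain S A K r s) (at_right 0)"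
    unfolding opt_gain_bw gain_eq_mgain Vpol_eq_disc using stoch_p[OF bw_policy] s by (rule disc_scaled_tendsto)
  show "\<forall>\<^sub>F x in at_right 0. x * val p (1 - x) s \<le> x * val bw (1 - x) s"
    using bw_eventually by eventually_elim (use p s in auto)
qed simp

text \<open>The Bellman inequality multiplied by x = 1 - g: in the limit the reward term disappears
  and only the gains remain.\<close>

lemma opt_gain_superharmonic:
  assumes s: "s < S" and a: "a < A"
  shows "kv a (opt_gain S A K r) s \<le> opt_gain S A K r s"
proof (rule tendsto_le)
  have lim: "((\<lambda>x. x * val bw (1 - x) t) \<longlongrightarrow> opt_gain S A K r t) (at_right 0)" if "t < S" for t
    unfolding opt_gain_bw gain_eq_mgain Vpol_eq_disc using stoch_p[OF bw_policy] that by (rule disc_scaled_tendsto)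
  then show "((\<lambda>x. x * val bw (1 - x) s) \<longlongrightarrow> opt_gain S A K r s) (at_right 0)" using s .
  have "((\<lambda>x. x * r s a + (1 - x) * kv a (\<lambda>t. x * val bw (1 - x) t) s)
      \<longlongrightarrow> 0 * r s a + (1 - 0) * kv a (opt_gain S A K r) s) (at_right 0)"
    unfolding mvec_def by (intro tendsto_intros lim) auto
  then show "((\<lambda>x. x * r s a + (1 - x) * kv a (\<lambda>t. x * val bw (1 - x) t) s)
      \<longlongrightarrow> kv a (opt_gain S A K r) s) (at_right 0)" by simp
  show "\<forall>\<^sub>F x in at_right 0. x * r s a + (1 - x) * kv a (\<lambda>t. x * val bw (1 - x) t) s \<le> x * val bw (1 - x) s"
    using Vstar_bw_eventually at_right_0_less_1
  proof eventually_elim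
    case (elim x)
    have "r s a + (1 - x) * kv a (Vstar S A K r (1 - x)) s \<le> Vstar S A K r (1 - x) s"
      using elim s a by (intro Vstar_bellman) auto
    moreover have "kv a (Vstar S A K r (1 - x)) s = kv a (val bw (1 - x)) s"
      using elim by (intro mvec_cong) auto
    ultimately have "r s a + (1 - x) * kv a (val bw (1 - x)) s \<le> val bw (1 - x) s" using elim s by simp
    then have "x * (r s a + (1 - x) * kv a (val bw (1 - x)) s) \<le> x * val bw (1 - x) s"
      using elim by (intro mult_left_mono) auto
    then show ?case unfolding mvec_scale by (simp add: algebra_simps)
  qed
qed simp

lemma Vstar_minus_gain_tendsto:
  assumes s: "s < S"
  shows "((\<lambda>x. Vstar S A K r (1 - x) s - opt_gain S A K r s / x) \<longlongrightarrow> opt_bias S A K r s) (at_right 0)"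
proof -
  have "((\<lambda>x. val bw (1 - x) s - opt_gain S A K r s / x) \<longlongrightarrow> opt_bias S A K r s) (at_right 0)"
    unfolding opt_gain_bw opt_bias_bw gain_eq_mgain bias_eq_mbias Vpol_eq_disc
    using stoch_p[OF bw_policy] s by (rule disc_minus_gain_tendsto)
  moreover have "\<forall>\<^sub>F x in at_right 0. val bw (1 - x) s - opt_gain S A K r s / x
      = Vstar S A K r (1 - x) s - opt_gain S A K r s / x"
    using Vstar_bw_eventually by eventually_elim (use s in simp)
  ultimately show ?thesis by (rule Lim_transform_eventually)
qed

end

section \<open>Reachability and constancy of the optimal gain\<close>

lemma mpow_add:
  "t < S \<Longrightarrow> mpow S M (a + b) s t = (\<Sum>u<S. mpow S M a s u * mpow S M b u t)"
proof (induction b arbitrary: t)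
  case 0
  then show ?case by (simp add: mpow.simps if_distrib[of "\<lambda>x. _ * x"] cong: if_cong)
next
  case (Suc b)
  have "mpow S M (a + Suc b) s t = (\<Sum>v<S. \<Sum>u<S. mpow S M a s u * mpow S M b u v * M v t)"
    using Suc.IH by (simp add: mpow.simps sum_distrib_right)
  also have "\<dots> = (\<Sum>u<S. \<Sum>v<S. mpow S M a s u * mpow S M b u v * M v t)"
    by (rule sum.swap)
  finally show ?case by (simp add: mpow.simps sum_distrib_left mult.assoc)
qed

lemma mpow_closed_eq_0:
  assumes B: "\<And>u t. u \<in> B \<Longrightarrow> t < S \<Longrightarrow> t \<notin> B \<Longrightarrow> M u t = (0::real)" and s: "s \<in> B"
  shows "t < S \<Longrightarrow> t \<notin> B \<Longrightarrow> mpow S M k s t = 0"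
proof (induction k arbitrary: t)
  case 0
  then show ?case using s by (auto simp: mpow.simps)
next
  case (Suc k)
  have "mpow S M k s u * M u t = 0" if "u < S" for u
    using Suc B that by (cases "u \<in> B") auto
  then show ?case unfolding mpow.simps by (intro sum.neutral) auto
qed

lemma reach_trans:
  assumes M: "stochastic S (Ppol A K p)" and st: "s < S" "u < S" "t < S"
    and "reach S A K p s u" "reach S A K p u t"
  shows "reach S A K p s t"
proof -
  obtain a b where ab: "mpow S (Ppol A K p) a s u > 0" "mpow S (Ppol A K p) b u t > 0"
    using assms by (auto simp: reach_def)
  have nn: "0 \<le> mpow S (Ppol A K p) k x y" if "x < S" "y < S" for k x y
    using stochastic_mpow[OF M] that by (simp add: stochastic_def)
  have "0 < mpow S (Ppol A K p) a s u * mpow S (Ppol A K p) b u t" using ab by simp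
  also have "\<dots> \<le> (\<Sum>u<S. mpow S (Ppol A K p) a s u * mpow S (Ppol A K p) b u t)"
    using st nn by (intro member_le_sum) auto
  finally show ?thesis unfolding reach_def using mpow_add[OF st(3)] by metis
qed

text \<open>A state of a closed set with the fewest reachable states is recurrent.\<close>
lemma closed_set_has_recurrent_state:
  assumes M: "stochastic S (Ppol A K p)" and B: "B \<subseteq> {..<S}" "B \<noteq> {}"
    and closed: "\<And>u t. u \<in> B \<Longrightarrow> t < S \<Longrightarrow> t \<notin> B \<Longrightarrow> Ppol A K p u t = 0"
  shows "\<exists>s\<in>B. \<not> transient S A K p s"
proof -
  define R where "R s = {t. t < S \<and> reach S A K p s t}" for s
  obtain s where s: "s \<in> B" "\<And>t. t \<in> B \<Longrightarrow> card (R s) \<le> card (R t)"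
    using ex_has_least_nat[of "\<lambda>s. s \<in> B" _ "\<lambda>s. card (R s)"] B(2) by blast
  have "reach S A K p t s" if t: "t < S" "reach S A K p s t" for t
  proof -
    have sS: "s < S" using s B by auto
    have "t \<in> B"
    proof (rule ccontr)
      assume "t \<notin> B"
      then have "mpow S (Ppol A K p) k s t = 0" for k
        using mpow_closed_eq_0[of B S "Ppol A K p" s t k] closed s(1) t(1) by blast
      then show False using t(2) by (simp add: reach_def)
    qed
    have "R t \<subseteq> R s" unfolding R_def using reach_trans[OF M sS t(1) _ t(2)] by blast
    moreover have "finite (R s)" unfolding R_def by simp
    ultimately have "R t = R s" using s(2)[OF \<open>t \<in> B\<close>] by (simp add: card_seteq)
    moreover have "s \<in> R s" using sS by (auto simp: R_def reach_def mpow.simps intro!: exI[of _ 0])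
    ultimately show ?thesis by (auto simp: R_def)
  qed
  then show ?thesis using s(1) unfolding transient_def by blast
qed

text \<open>The numbers \<open>u t - m\<close> are nonnegative with average at most 0, so the
  weights sit on their zeros.\<close>

lemma support_of_minimal_average:
  assumes M: "stochastic S M" and s: "s < S" and m: "\<And>t. t < S \<Longrightarrow> m \<le> u t"
    and le: "mvec S M u s \<le> m" and t: "t < S" "u t \<noteq> m"
  shows "M s t = 0"
proof -
  have "(\<Sum>t<S. M s t * (u t - m)) = mvec S M u s - mvec S M (\<lambda>_. m) s"
    by (simp add: mvec_def algebra_simps sum_subtractf)
  also have "\<dots> \<le> 0" using le mvec_const[OF M s] by simp
  finally have le0: "(\<Sum>t<S. M s t * (u t - m)) \<le> 0" .
  have nn: "0 \<le> M s t * (u t - m)" if "t < S" for t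
    using M s m[OF that] that by (simp add: stochastic_def)
  have "M s t * (u t - m) \<le> (\<Sum>t<S. M s t * (u t - m))"
    using nn t by (intro member_le_sum) auto
  then have "M s t * (u t - m) = 0" using le0 nn[OF t(1)] by linarith
  then show ?thesis using t by simp
qed

context finite_mdp
begin

text \<open>States of minimal gain form a set closed under every policy, by superharmonicity; states
  of maximal gain form a set closed under \<open>bw\<close>, by invariance of its gain. Each set
  contains a state recurrent under \<open>bw\<close>, hence in the communicating class. Some policy
  leads from the first to the second, yet cannot leave the minimal set, so minimum and maximum
  agree.\<close>

lemma opt_gain_constant:
  assumes wc: "weakly_communicating S A K"
  obtains c where "\<And>s. s < S \<Longrightarrow> opt_gain S A K r s = c" "0 \<le> c" "c \<le> 1"
proof -
  let ?\<rho> = "opt_gain S A K r"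
  obtain C where C: "C \<subseteq> {..<S}" "\<forall>s<S. s \<notin> C \<longrightarrow> (\<forall>p. is_policy S A p \<longrightarrow> transient S A K p s)"
    "\<forall>s\<in>C. \<forall>s'\<in>C. \<exists>p. is_policy S A p \<and> reach S A K p s s'"
    using wc unfolding weakly_communicating_def by (elim exE conjE)
  have ne: "{..<S} \<noteq> {}" using S_pos by (auto simp: lessThan_empty_iff)
  define m where "m = Min (?\<rho> ` {..<S})"
  define m' where "m' = Max (?\<rho> ` {..<S})"
  have m: "m \<le> ?\<rho> t" "?\<rho> t \<le> m'" if "t < S" for t
    unfolding m_def m'_def using that by auto
  have "m \<in> ?\<rho> ` {..<S}" "m' \<in> ?\<rho> ` {..<S}"
    unfolding m_def m'_def using ne by (simp_all add: Min_in Max_in)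
  then have ne': "{s. s < S \<and> ?\<rho> s = m} \<noteq> {}" "{s. s < S \<and> ?\<rho> s = m'} \<noteq> {}" by auto
  have closed: "Ppol A K p s t = 0" if p: "is_policy S A p" and s: "s < S" "?\<rho> s = m" and t: "t < S" "?\<rho> t \<noteq> m" for p s t
  proof -
    have "K s a t = 0" if "a < A" for a
      by (rule support_of_minimal_average[OF stoch_a[OF that] s(1), where u = ?\<rho> and m = m])
        (use m t opt_gain_superharmonic[OF s(1) that] s(2) in auto)
    then show ?thesis by (simp add: Ppol_def)
  qed
  \<comment> \<open>The gain is negated so that the lemma on minimal averages applies to the
    maximum.\<close>
  have closed': "Ppol A K bw s t = 0" if s: "s < S" "?\<rho> s = m'" and t: "t < S" "?\<rho> t \<noteq> m'" for s t
  proof (rule support_of_minimal_average[OF stoch_p[OF bw_policy] s(1), where u = "\<lambda>s. -1 * ?\<rho> s" and m = "-m'"])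
    show "mvec S (Ppol A K bw) (\<lambda>s. -1 * ?\<rho> s) s \<le> - m'"
      unfolding mvec_scale opt_gain_bw gain_eq_mgain
      using mgain_invariant[OF stoch_p[OF bw_policy] s(1)] s(2) by (simp add: opt_gain_bw gain_eq_mgain)
  qed (use m t in auto)
  obtain s1 where s1: "s1 < S" "?\<rho> s1 = m'" "\<not> transient S A K bw s1"
    using closed_set_has_recurrent_state[OF stoch_p[OF bw_policy] _ ne'(2)] closed' by blast
  obtain s0 where s0: "s0 < S" "?\<rho> s0 = m" "\<not> transient S A K bw s0"
    using closed_set_has_recurrent_state[OF stoch_p[OF bw_policy] _ ne'(1)] closed[OF bw_policy] by blast
  have "s0 \<in> C" "s1 \<in> C" using C(2) s0 s1 bw_policy by auto
  then have "\<exists>p. is_policy S A p \<and> reach S A K p s0 s1" using C(3) by auto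
  then obtain p where p: "is_policy S A p" "reach S A K p s0 s1" by blast
  have "?\<rho> s1 = m"
  proof (rule ccontr)
    assume "?\<rho> s1 \<noteq> m"
    then have "mpow S (Ppol A K p) k s0 s1 = 0" for k
      using mpow_closed_eq_0[of "{s. s < S \<and> ?\<rho> s = m}" S "Ppol A K p" s0 s1 k] closed[OF p(1)] s0 s1 by blast
    then show False using p(2) by (simp add: reach_def)
  qed
  then have "m = m'" using s1 by simp
  then have const: "?\<rho> s = m" if "s < S" for s using m[OF that] by simp
  \<comment> \<open>Centering rewards at 1/2 yields both bounds on the gain from a single
    absolute-value estimate.\<close>
  have half: "\<bar>rpol A r bw t - 1/2\<bar> \<le> 1/2" if "t < S" for t
    using rpol_bounds[OF bw_policy that] by linarith
  have "\<bar>mgain S (Ppol A K bw) (\<lambda>s. rpol A r bw s - 1/2) s0\<bar> \<le> 1/2"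
    unfolding mgain_def using stochastic_limmat[OF stoch_p[OF bw_policy]] s0(1) half
    by (rule mvec_abs_le)
  then have "\<bar>m - 1/2\<bar> \<le> 1/2"
    using s0 unfolding mgain_def mvec_diff by (simp add: mvec_const[OF stochastic_limmat[OF stoch_p[OF bw_policy]] s0(1)] opt_gain_bw gain_eq_mgain mgain_def)
  then have "0 \<le> m" "m \<le> 1" by linarith+
  then show ?thesis using that[of m] const by blast
qed

section \<open>The discount threshold and pinned value iteration\<close>

lemma supnorm_le_iff: "supnorm S v \<le> e \<longleftrightarrow> (\<forall>s<S. \<bar>v s\<bar> \<le> e)"
  unfolding supnorm_def using S_pos by (subst Max_le_iff) (auto simp: lessThan_empty_iff)

text \<open>The set in \<open>gamma_star\<close> is nonempty because \<open>Vstar - gain/x\<close>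
  tends to the bias and the gain is a constant c, so c / (1 - g) serves as the shift. An infimum is
  only approached, hence the approximation is claimed for g strictly above it.\<close>

lemma gamma_star_properties:
  assumes wc: "weakly_communicating S A K" and n: "1 \<le> n"
  shows "0 \<le> gamma_star S A n K r" "gamma_star S A n K r < 1"
    "\<And>g. gamma_star S A n K r < g \<Longrightarrow> g < 1 \<Longrightarrow>
      \<exists>c. \<forall>s<S. \<bar>Vstar S A K r g s - opt_bias S A K r s - c\<bar> \<le> 1 / real n"
proof -
  define Pr where "Pr g \<longleftrightarrow> (\<exists>c. \<forall>s<S. \<bar>Vstar S A K r g s - opt_bias S A K r s - c\<bar> \<le> 1 / real n)" for g
  define G where "G = {gb. 0 \<le> gb \<and> gb < 1 \<and> (\<forall>g. gb \<le> g \<and> g < 1 \<longrightarrow> Pr g)}"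
  have star: "gamma_star S A n K r = Inf G"
    unfolding gamma_star_def G_def Pr_def supnorm_le_iff ..
  obtain c where c: "\<And>s. s < S \<Longrightarrow> opt_gain S A K r s = c" using opt_gain_constant[OF wc] by blast
  have "\<forall>\<^sub>F x in at_right 0. \<forall>s\<in>{..<S}. \<bar>Vstar S A K r (1 - x) s - opt_gain S A K r s / x - opt_bias S A K r s\<bar> < 1 / real n"
    using Vstar_minus_gain_tendsto n by (intro eventually_ball_finite) (auto simp: tendsto_iff dist_real_def)
  then obtain b where b: "b > 0" "\<And>x. 0 < x \<Longrightarrow> x < b \<Longrightarrow>
      \<forall>s\<in>{..<S}. \<bar>Vstar S A K r (1 - x) s - opt_gain S A K r s / x - opt_bias S A K r s\<bar> < 1 / real n"
    unfolding eventually_at_right_field by blast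
  have pr: "Pr g" if "max 0 (1 - b / 2) \<le> g" "g < 1" for g
    unfolding Pr_def
  proof (intro exI allI impI)
    fix s assume s: "s < S"
    have x: "0 < 1 - g" "1 - g < b" using that b(1) by auto
    then show "\<bar>Vstar S A K r g s - opt_bias S A K r s - c / (1 - g)\<bar> \<le> 1 / real n"
      using b(2)[OF x] s c[OF s] by (force simp: algebra_simps)
  qed
  then have G: "max 0 (1 - b / 2) \<in> G" using b(1) by (auto simp: G_def)
  have bdd: "bdd_below G" unfolding G_def by (rule bdd_belowI[of _ 0]) auto
  show "0 \<le> gamma_star S A n K r" unfolding star
    by (rule cInf_greatest) (use G in blast, simp add: G_def)
  have "Inf G \<le> max 0 (1 - b / 2)" using G bdd by (rule cInf_lower)
  then show "gamma_star S A n K r < 1" unfolding star using b(1) by simp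
  fix g assume g: "gamma_star S A n K r < g" "g < 1"
  then obtain gb where "gb \<in> G" "gb < g" using cInf_lessD[of G g] G unfolding star by blast
  then have "Pr g" using g(2) by (auto simp: G_def)
  then show "\<exists>c. \<forall>s<S. \<bar>Vstar S A K r g s - opt_bias S A K r s - c\<bar> \<le> 1 / real n"
    by (simp add: Pr_def)
qed

end

text \<open>Value iteration with the value of the state \<open>s\<close> pinned to \<open>u\<close>. It does not read the
  transition rows of \<open>s\<close>, so for the empirical kernel it is independent of the samples drawn at \<open>s\<close>.\<close>
fun pinned :: "nat \<Rightarrow> nat \<Rightarrow> kernel \<Rightarrow> (nat \<Rightarrow> nat \<Rightarrow> real) \<Rightarrow> real \<Rightarrow> nat \<Rightarrow> real \<Rightarrow> nat \<Rightarrow> nat \<Rightarrow> real" where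
  "pinned S A K r g s u 0 t = 0"
| "pinned S A K r g s u (Suc m) t = (if t = s then u else
     Max ((\<lambda>a. r t a + g * mvec S (\<lambda>s. K s a) (pinned S A K r g s u m) t) ` {..<A}))"

lemma pinned_cong:
  "(\<And>t a. t \<noteq> s \<Longrightarrow> K t a = K' t a) \<Longrightarrow> pinned S A K r g s u m t = pinned S A K' r g s u m t"
proof (induction m arbitrary: t)
  case (Suc m)
  then have "pinned S A K r g s u m = pinned S A K' r g s u m" by blast
  then show ?case using Suc.prems by (simp add: mvec_def)
qed simp

context finite_mdp
begin

text \<open>At the pinned state the error is exactly that of \<open>u\<close>, while elsewhere a
  Bellman step multiplies the worst error by g. So the pinning error enters with factor 1, and the
  starting error, at most 1 / (1 - g), decays geometrically.\<close>

lemma pinned_error: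
  assumes g: "0 \<le> g" "g < 1" and s: "s < S" and t: "t < S"
  shows "\<bar>pinned S A K r g s u m t - Vstar S A K r g t\<bar> \<le> \<bar>u - Vstar S A K r g s\<bar> + g ^ m / (1 - g)"
  using t
proof (induction m arbitrary: t)
  case 0
  then show ?case
    using Vstar_bellman(3)[OF g 0] abs_ge_zero[of "u - Vstar S A K r g s"] by (simp del: abs_ge_zero)
next
  case (Suc m)
  let ?V = "Vstar S A K r g" and ?W = "pinned S A K r g s u m" and ?e = "\<bar>u - Vstar S A K r g s\<bar>"
  show ?case
  proof (cases "t = s")
    case True
    then show ?thesis using g by simp
  next
    case False
    let ?f = "\<lambda>a. r t a + g * kv a ?W t"
    let ?E = "?e + g ^ m / (1 - g)"
    have E: "g * ?E \<le> ?e + g ^ Suc m / (1 - g)"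
      using g mult_right_mono[of g 1 ?e] by (simp add: algebra_simps)
    have diff: "\<bar>g * kv a ?W t - g * kv a ?V t\<bar> \<le> g * ?E" if a: "a < A" for a
    proof -
      have "\<bar>kv a (\<lambda>t. ?W t - ?V t) t\<bar> \<le> ?E"
        using Suc.IH by (intro mvec_abs_le stoch_a a Suc.prems)
      then show ?thesis using g by (simp add: mvec_diff abs_mult mult_left_mono flip: right_diff_distrib)
    qed
    have fin: "finite (?f ` {..<A})" "?f ` {..<A} \<noteq> {}" using A_pos by (auto simp: lessThan_empty_iff)
    have "Max (?f ` {..<A}) \<le> ?V t + g * ?E"
    proof (rule Max.boundedI[OF fin])
      fix y assume "y \<in> ?f ` {..<A}"
      then obtain a where a: "a < A" "y = ?f a" by auto
      then show "y \<le> ?V t + g * ?E"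
        using diff[OF a(1)] Vstar_bellman(1)[OF g Suc.prems a(1)] by (simp add: abs_le_iff)
    qed
    \<comment> \<open>The upper bound used the Bellman inequality for all actions; the lower bound
      needs an action attaining equality.\<close>
    moreover have "?V t - g * ?E \<le> Max (?f ` {..<A})"
    proof -
      obtain a where a: "a < A" "?V t = r t a + g * kv a ?V t"
        using Vstar_bellman(2)[OF g Suc.prems] by blast
      have "?V t - g * ?E \<le> ?f a" using diff[OF a(1)] a(2) by (simp add: abs_le_iff)
      also have "\<dots> \<le> Max (?f ` {..<A})" using fin a by (intro Max_ge) auto
      finally show ?thesis .
    qed
    ultimately have "\<bar>Max (?f ` {..<A}) - ?V t\<bar> \<le> ?e + g ^ Suc m / (1 - g)"
      using E by linarith
    then show ?thesis using False by simp
  qed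
qed

end

section \<open>One-step variances and stationary averages\<close>

abbreviation krow :: "nat \<Rightarrow> kernel \<Rightarrow> nat \<Rightarrow> (nat \<Rightarrow> real) \<Rightarrow> nat \<Rightarrow> real" where
  "krow S K a v s \<equiv> mvec S (\<lambda>s. K s a) v s"

definition kvar :: "nat \<Rightarrow> kernel \<Rightarrow> (nat \<Rightarrow> real) \<Rightarrow> nat \<Rightarrow> nat \<Rightarrow> real" where
  "kvar S K h s a = krow S K a (\<lambda>t. (h t)\<^sup>2) s - (krow S K a h s)\<^sup>2"

lemma krow_stochastic: "is_kernel S A K \<Longrightarrow> a < A \<Longrightarrow> stochastic S (\<lambda>s. K s a)"
  by (simp add: is_kernel_def)

lemma krow_shift:
  assumes "is_kernel S A K" "s < S" "a < A"
  shows "krow S K a (\<lambda>t. h t - c) s = krow S K a h s - c"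
  using mvec_const[OF krow_stochastic[OF assms(1,3)] assms(2)] by (simp add: mvec_diff)

lemma kvar_eq_centered:
  assumes "is_kernel S A K" "s < S" "a < A"
  shows "krow S K a (\<lambda>t. (h t - c)\<^sup>2) s = kvar S K h s a + (krow S K a h s - c)\<^sup>2"
proof -
  have "krow S K a (\<lambda>t. (h t - c)\<^sup>2) s = krow S K a (\<lambda>t. (h t)\<^sup>2 - 2 * c * h t + c\<^sup>2) s"
    by (intro mvec_cong) (simp add: power2_diff)
  also have "\<dots> = krow S K a (\<lambda>t. (h t)\<^sup>2) s - 2 * c * krow S K a h s + c\<^sup>2"
    using mvec_const[OF krow_stochastic[OF assms(1,3)] assms(2)]
    by (simp only: mvec_add mvec_diff mvec_scale)
  finally show ?thesis by (simp add: kvar_def power2_diff)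
qed

lemma kvar_nonneg:
  assumes "is_kernel S A K" "s < S" "a < A"
  shows "0 \<le> kvar S K h s a"
proof -
  have "0 \<le> krow S K a (\<lambda>t. (h t - krow S K a h s)\<^sup>2) s"
    using krow_stochastic[OF assms(1,3)] assms(2) unfolding mvec_def stochastic_def
    by (intro sum_nonneg) auto
  then show ?thesis using kvar_eq_centered[OF assms, of h "krow S K a h s"] by simp
qed

lemma kvar_shift:
  assumes "is_kernel S A K" "s < S" "a < A"
  shows "kvar S K (\<lambda>t. h t - c) s a = kvar S K h s a"
  using kvar_eq_centered[OF assms, of h c] krow_shift[OF assms, of h c] by (simp add: kvar_def)

text \<open>With \<open>\<mu>\<close> a row of \<open>limmat\<close>, this averages over the
  long-run frequencies of state-action pairs.\<close>

definition sa_mean :: "nat \<Rightarrow> nat \<Rightarrow> (nat \<Rightarrow> real) \<Rightarrow> policy \<Rightarrow> (nat \<Rightarrow> nat \<Rightarrow> real) \<Rightarrow> real" where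
  "sa_mean S A \<mu> p f = (\<Sum>s<S. \<mu> s * (\<Sum>a<A. p s a * f s a))"

definition is_dist :: "nat \<Rightarrow> (nat \<Rightarrow> real) \<Rightarrow> bool" where
  "is_dist S \<mu> \<longleftrightarrow> (\<forall>s<S. 0 \<le> \<mu> s) \<and> (\<Sum>s<S. \<mu> s) = 1"

lemma sa_mean_add: "sa_mean S A \<mu> p (\<lambda>s a. f s a + g s a) = sa_mean S A \<mu> p f + sa_mean S A \<mu> p g"
  by (simp add: sa_mean_def algebra_simps sum.distrib)

lemma sa_mean_diff: "sa_mean S A \<mu> p (\<lambda>s a. f s a - g s a) = sa_mean S A \<mu> p f - sa_mean S A \<mu> p g"
  by (simp add: sa_mean_def algebra_simps sum_subtractf)

lemma sa_mean_scale: "sa_mean S A \<mu> p (\<lambda>s a. c * f s a) = c * sa_mean S A \<mu> p f"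
  by (simp add: sa_mean_def algebra_simps sum_distrib_left)

lemma sa_mean_state:
  "is_policy S A p \<Longrightarrow> sa_mean S A \<mu> p (\<lambda>s a. u s) = (\<Sum>s<S. \<mu> s * u s)"
  unfolding sa_mean_def is_policy_def by (simp flip: sum_distrib_right)

lemma sa_mean_const:
  "is_dist S \<mu> \<Longrightarrow> is_policy S A p \<Longrightarrow> sa_mean S A \<mu> p (\<lambda>s a. c) = c"
  by (simp add: sa_mean_state is_dist_def flip: sum_distrib_right)

lemma sa_mean_mono:
  assumes "is_dist S \<mu>" "is_policy S A p" "\<And>s a. s < S \<Longrightarrow> a < A \<Longrightarrow> f s a \<le> g s a"
  shows "sa_mean S A \<mu> p f \<le> sa_mean S A \<mu> p g"
  using assms unfolding sa_mean_def is_dist_def is_policy_def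
  by (intro sum_mono mult_left_mono) auto

text \<open>Jensen's inequality for the square root, read off from the nonnegative mean of (sqrt f -
  y)^2 with y the mean of sqrt f.\<close>

lemma sa_mean_sqrt_le:
  assumes \<mu>: "is_dist S \<mu>" and p: "is_policy S A p" and f: "\<And>s a. s < S \<Longrightarrow> a < A \<Longrightarrow> 0 \<le> f s a"
  shows "sa_mean S A \<mu> p (\<lambda>s a. sqrt (f s a)) \<le> sqrt (sa_mean S A \<mu> p f)"
proof (rule real_le_rsqrt)
  let ?E = "sa_mean S A \<mu> p"
  let ?y = "?E (\<lambda>s a. sqrt (f s a))"
  have "0 = ?E (\<lambda>s a. 0)" by (simp add: sa_mean_def)
  also have "\<dots> \<le> ?E (\<lambda>s a. f s a - 2 * ?y * sqrt (f s a) + ?y\<^sup>2)"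
  proof (rule sa_mean_mono[OF \<mu> p])
    fix s a assume "s < S" "a < A"
    have "0 \<le> (sqrt (f s a) - ?y)\<^sup>2" by simp
    also have "\<dots> = f s a - 2 * ?y * sqrt (f s a) + ?y\<^sup>2"
      using f[OF \<open>s < S\<close> \<open>a < A\<close>] by (simp add: power2_diff)
    finally show "0 \<le> f s a - 2 * ?y * sqrt (f s a) + ?y\<^sup>2" .
  qed
  also have "\<dots> = ?E f - 2 * ?y * ?y + ?y\<^sup>2"
    using sa_mean_const[OF \<mu> p] by (simp only: sa_mean_add sa_mean_diff sa_mean_scale)
  finally show "?y\<^sup>2 \<le> ?E f" by (simp add: power2_eq_square)
qed

lemma is_dist_limmat: "stochastic S M \<Longrightarrow> s < S \<Longrightarrow> is_dist S (limmat S M s)"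
  using stochastic_limmat[of S M] by (simp add: stochastic_def is_dist_def)

lemma sa_mean_krow_stationary:
  assumes N: "is_kernel S A N" and p: "is_policy S A p" and s: "s < S"
  shows "sa_mean S A (limmat S (Ppol A N p) s) p (\<lambda>s a. krow S N a u s)
     = (\<Sum>t<S. limmat S (Ppol A N p) s t * u t)"
  using limmat_invariant[OF stochastic_Ppol[OF N p] s, of u]
  by (simp add: sa_mean_def mvec_def[of S "limmat S (Ppol A N p)"] mvec_Ppol)

text \<open>The Poisson equation of \<open>L\<close> is averaged over a stationary distribution of
  \<open>N\<close>. Stationarity turns the mean of \<open>h\<close> into the mean of
  \<open>N h\<close>, leaving only the kernel difference. A row of \<open>limmat\<close> is
  stationary even if the chain has several recurrent classes.\<close>

lemma gain_difference:
  assumes N: "is_kernel S A N" and p: "is_policy S A p" and s: "s < S"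
    and poisson: "\<And>s. s < S \<Longrightarrow> rpol A r p s = c + h s - (\<Sum>a<A. p s a * krow S L a h s)"
  shows "c - gain S A N r p s
    = sa_mean S A (limmat S (Ppol A N p) s) p (\<lambda>s a. krow S L a h s - krow S N a h s)"
proof -
  let ?\<mu> = "limmat S (Ppol A N p) s"
  have \<mu>: "is_dist S ?\<mu>" using stochastic_Ppol[OF N p] s by (rule is_dist_limmat)
  have "gain S A N r p s = (\<Sum>t<S. ?\<mu> t * rpol A r p t)"
    by (simp add: gain_eq_mgain mgain_def mvec_def)
  also have "\<dots> = (\<Sum>t<S. c * ?\<mu> t + ?\<mu> t * h t - ?\<mu> t * (\<Sum>a<A. p t a * krow S L a h t))"
    by (intro sum.cong refl) (simp add: poisson algebra_simps)
  also have "\<dots> = c + (\<Sum>t<S. ?\<mu> t * h t) - sa_mean S A ?\<mu> p (\<lambda>s a. krow S L a h s)"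
    using \<mu> by (simp add: sum.distrib sum_subtractf sa_mean_def is_dist_def flip: sum_distrib_left)
  finally show ?thesis
    by (simp add: sa_mean_diff sa_mean_krow_stationary[OF N p s])
qed

text \<open>This is the telescoping of squares: the gap factors as (h - Y)(h + Y), where Y is the
  policy average of \<open>y\<close>. The first factor is small by the approximate Poisson equation,
  the second at most 2H.\<close>

lemma second_moment_gap:
  assumes \<mu>: "is_dist S \<mu>" and p: "is_policy S A p"
    and h: "\<And>s. s < S \<Longrightarrow> 0 \<le> h s \<and> h s \<le> H"
    and y: "\<And>s a. s < S \<Longrightarrow> a < A \<Longrightarrow> 0 \<le> y s a \<and> y s a \<le> H"
    and e: "\<And>s. s < S \<Longrightarrow> \<bar>h s - (\<Sum>a<A. p s a * y s a)\<bar> \<le> e s"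
  shows "(\<Sum>s<S. \<mu> s * (h s)\<^sup>2) - sa_mean S A \<mu> p (\<lambda>s a. (y s a)\<^sup>2) \<le> 2 * H * (\<Sum>s<S. \<mu> s * e s)"
proof -
  have pt: "(h s)\<^sup>2 - (\<Sum>a<A. p s a * (y s a)\<^sup>2) \<le> 2 * H * e s" if s: "s < S" for s
  proof -
    let ?Y = "\<Sum>a<A. p s a * y s a"
    have p1: "(\<Sum>a<A. p s a) = 1" "\<And>a. a < A \<Longrightarrow> 0 \<le> p s a" using p s by (auto simp: is_policy_def)
    \<comment> \<open>Jensen over the actions: a randomized policy only increases the second moment
      of \<open>y\<close> over the square of its mean.\<close>
    have "0 \<le> (\<Sum>a<A. p s a * (y s a - ?Y)\<^sup>2)" using p1 by (intro sum_nonneg) auto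
    also have "\<dots> = (\<Sum>a<A. p s a * (y s a)\<^sup>2 - 2 * ?Y * (p s a * y s a) + ?Y\<^sup>2 * p s a)"
      by (intro sum.cong refl) (simp add: power2_eq_square algebra_simps)
    also have "\<dots> = (\<Sum>a<A. p s a * (y s a)\<^sup>2) - 2 * ?Y * ?Y + ?Y\<^sup>2 * (\<Sum>a<A. p s a)"
      by (simp only: sum.distrib sum_subtractf sum_distrib_left)
    finally have "?Y\<^sup>2 \<le> (\<Sum>a<A. p s a * (y s a)\<^sup>2)" by (simp add: p1 power2_eq_square)
    then have "(h s)\<^sup>2 - (\<Sum>a<A. p s a * (y s a)\<^sup>2) \<le> (h s - ?Y) * (h s + ?Y)"
      by (simp add: power2_eq_square algebra_simps)
    also have "\<dots> \<le> e s * (2 * H)"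
    proof (rule mult_mono)
      have "?Y \<le> H" using y s by (intro policy_average_le[OF p s]) auto
      then show "h s + ?Y \<le> 2 * H" using h[OF s] by simp
      have "0 \<le> ?Y" using p1 y s by (intro sum_nonneg) auto
      then show "0 \<le> h s + ?Y" using h[OF s] by simp
      show "h s - ?Y \<le> e s" "0 \<le> e s" using e[OF s] by linarith+
    qed
    finally show ?thesis by (simp add: algebra_simps)
  qed
  have "(\<Sum>s<S. \<mu> s * (h s)\<^sup>2) - sa_mean S A \<mu> p (\<lambda>s a. (y s a)\<^sup>2)
      = (\<Sum>s<S. \<mu> s * ((h s)\<^sup>2 - (\<Sum>a<A. p s a * (y s a)\<^sup>2)))"
    by (simp add: sa_mean_def right_diff_distrib sum_subtractf)
  also have "\<dots> \<le> (\<Sum>s<S. \<mu> s * (2 * H * e s))"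
    using pt \<mu> by (intro sum_mono mult_left_mono) (auto simp: is_dist_def)
  finally show ?thesis by (simp add: sum_distrib_left algebra_simps)
qed

lemma krow_bounds:
  assumes K: "is_kernel S A K" and "a < A" "s < S" and h: "\<And>s. s < S \<Longrightarrow> 0 \<le> h s \<and> h s \<le> H"
  shows "0 \<le> krow S K a h s \<and> krow S K a h s \<le> (H::real)"
proof -
  note M = krow_stochastic[OF K \<open>a < A\<close>]
  have "krow S K a (\<lambda>_. 0) s \<le> krow S K a h s" "krow S K a h s \<le> krow S K a (\<lambda>_. H) s"
    using h by (auto intro!: mvec_mono[OF M \<open>s < S\<close>])
  then show ?thesis by (simp add: mvec_const[OF M \<open>s < S\<close>])
qed

text \<open>The bound on \<open>v\<close> is quadratic in sqrt v. With z = (H + 1) l / N it yields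
  sqrt v <= 2 sqrt H + 2 H alpha, so alpha sqrt v <= 6 sqrt z + 16 z. Adding 30 z and using z <=
  sqrt z explains 52 = 6 + 16 + 30.\<close>

lemma self_bounding:
  fixes v l N H D :: real
  assumes "0 \<le> v" "0 \<le> l" "0 < N" "0 \<le> H" "D \<le> 1"
    and v: "v \<le> 2 * H * (1 + sqrt (8 * l / N) * sqrt v + 30 * (H + 1) * l / N)"
    and D: "D \<le> sqrt (8 * l / N) * sqrt v + 30 * (H + 1) * l / N"
  shows "D \<le> 52 * sqrt ((H + 1) * l / N)"
proof -
  define z where "z = (H + 1) * l / N"
  define \<alpha> where "\<alpha> = sqrt (8 * l / N)"
  have z: "0 \<le> z" "30 * (H + 1) * l / N = 30 * z" using assms by (auto simp: z_def)
  have \<alpha>: "0 \<le> \<alpha>" "\<alpha>\<^sup>2 = 8 * l / N" using assms by (auto simp: \<alpha>_def)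
  have H\<alpha>: "H * \<alpha>\<^sup>2 \<le> 8 * z"
    using assms unfolding \<alpha>(2) z_def by (simp add: field_simps)
  have sz: "(sqrt z)\<^sup>2 = z" "0 \<le> sqrt z" using z by auto
  show ?thesis
  \<comment> \<open>At this threshold 52 sqrt z reaches 1, where the trivial bound on
    \<open>D\<close> suffices. Below it, 30 z <= 1 simplifies the quadratic.\<close>
  proof (cases "1 / 52\<^sup>2 \<le> z")
    case True
    then have "1 / 52 \<le> sqrt z" by (intro real_le_rsqrt) (simp add: power_divide)
    then show ?thesis using \<open>D \<le> 1\<close> by (simp add: z_def)
  next
    case False
    then have z1: "z \<le> 1 / 30" by simp
    then have "sqrt z \<le> 1" by simp
    then have z_le: "z \<le> sqrt z" using sz mult_right_mono[of "sqrt z" 1 "sqrt z"] by (simp add: power2_eq_square)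
    have sv: "sqrt v * sqrt v = v" using \<open>0 \<le> v\<close> by simp
    have sH: "sqrt H * sqrt H = H" using \<open>0 \<le> H\<close> by simp
    have "2 * H * (1 + \<alpha> * sqrt v + 30 * z) \<le> 2 * H * (2 + \<alpha> * sqrt v)"
      using z1 \<open>0 \<le> H\<close> by (intro mult_left_mono) auto
    then have "v \<le> 4 * H + 2 * H * \<alpha> * sqrt v"
      using v unfolding z(2) \<alpha>_def[symmetric] by (simp add: algebra_simps)
    \<comment> \<open>Completing the square in sqrt v.\<close>
    then have "(sqrt v - H * \<alpha>)\<^sup>2 \<le> (2 * sqrt H)\<^sup>2 + (H * \<alpha>)\<^sup>2"
      using \<open>0 \<le> v\<close> \<open>0 \<le> H\<close> by (simp add: power2_diff power_mult_distrib mult_ac)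
    also have "\<dots> \<le> (2 * sqrt H + H * \<alpha>)\<^sup>2"
      using \<open>0 \<le> H\<close> \<alpha> by (simp add: power2_sum)
    finally have "\<bar>sqrt v - H * \<alpha>\<bar> \<le> \<bar>2 * sqrt H + H * \<alpha>\<bar>" by (simp add: abs_le_square_iff)
    moreover have "0 \<le> H * \<alpha>" "0 \<le> sqrt H" using \<open>0 \<le> H\<close> \<alpha> by auto
    ultimately have "sqrt v \<le> 2 * sqrt H + 2 * (H * \<alpha>)" by linarith
    then have "\<alpha> * sqrt v \<le> \<alpha> * (2 * sqrt H + 2 * (H * \<alpha>))" using \<alpha> by (intro mult_left_mono)
    also have "\<dots> = 2 * (\<alpha> * sqrt H) + 2 * (H * \<alpha>\<^sup>2)" by (simp add: power2_eq_square algebra_simps)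
    also have "\<alpha> * sqrt H \<le> 3 * sqrt z"
    proof (rule power2_le_imp_le)
      show "(\<alpha> * sqrt H)\<^sup>2 \<le> (3 * sqrt z)\<^sup>2"
        using H\<alpha> z \<open>0 \<le> H\<close> by (simp add: power_mult_distrib mult.commute)
    qed (use sz in simp)
    finally have "\<alpha> * sqrt v \<le> 6 * sqrt z + 16 * z" using H\<alpha> by simp
    then show ?thesis using D z_le unfolding z(2) \<alpha>_def[symmetric] by (simp add: z_def[symmetric])
  qed
qed

lemma kernel_bound_mean:
  assumes \<mu>: "is_dist S \<mu>" and p: "is_policy S A p" and K: "is_kernel S A K" and \<alpha>: "0 \<le> \<alpha>"
  shows "sa_mean S A \<mu> p (\<lambda>s a. \<alpha> * sqrt (kvar S K h s a) + \<beta>)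
      \<le> \<alpha> * sqrt (sa_mean S A \<mu> p (kvar S K h)) + \<beta>"
proof -
  have "sa_mean S A \<mu> p (\<lambda>s a. \<alpha> * sqrt (kvar S K h s a) + \<beta>)
      = \<alpha> * sa_mean S A \<mu> p (\<lambda>s a. sqrt (kvar S K h s a)) + \<beta>"
    by (simp add: sa_mean_add sa_mean_scale sa_mean_const[OF \<mu> p])
  then show ?thesis
    using sa_mean_sqrt_le[OF \<mu> p, of "kvar S K h"] kvar_nonneg[OF K] \<alpha> by (simp add: mult_left_mono)
qed

context
  fixes S A :: nat and N L :: kernel and r p h c s0 and H l n :: real
  assumes N: "is_kernel S A N" and L: "is_kernel S A L" and p: "is_policy S A p" and s0: "s0 < S"
    and poisson: "\<And>s. s < S \<Longrightarrow> rpol A r p s = c + h s - (\<Sum>a<A. p s a * krow S L a h s)"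
    and rc: "\<And>s. s < S \<Longrightarrow> \<bar>rpol A r p s - c\<bar> \<le> 1"
    and h: "\<And>s. s < S \<Longrightarrow> 0 \<le> h s \<and> h s \<le> H"
    and D1: "c - gain S A N r p s0 \<le> 1"
    and ln: "0 \<le> l" "0 < n"
begin

text \<open>\<open>h\<close> solves the Poisson equation of \<open>L\<close>, and the policy runs in
  \<open>N\<close>. Here the Bernstein variance and the stationary distribution both belong to
  \<open>N\<close>, so the second moment telescopes directly; replacing \<open>L\<close> by
  \<open>N\<close> in the Poisson equation costs the mean of \<open>|L h - N h|\<close>. Applied
  with the true kernel as \<open>N\<close>.\<close>

lemma gain_gap_stationary_variance:
  assumes conc: "\<And>s a. s < S \<Longrightarrow> a < A \<Longrightarrow> \<bar>krow S L a h s - krow S N a h s\<bar>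
      \<le> sqrt (8 * l / n) * sqrt (kvar S N h s a) + 30 * (H + 1) * l / n"
  shows "c - gain S A N r p s0 \<le> 52 * sqrt ((H + 1) * l / n)"
proof -
  define \<mu> where "\<mu> = limmat S (Ppol A N p) s0"
  have \<mu>: "is_dist S \<mu>" unfolding \<mu>_def using stochastic_Ppol[OF N p] s0 by (rule is_dist_limmat)
  let ?E = "sa_mean S A \<mu> p"
  let ?v = "?E (kvar S N h)" and ?\<alpha> = "sqrt (8 * l / n)" and ?\<beta> = "30 * (H + 1) * l / n"
  let ?\<Delta> = "\<lambda>s a. krow S L a h s - krow S N a h s"
  have H: "0 \<le> H" using h[OF s0] by linarith
  have \<alpha>: "0 \<le> ?\<alpha>" using ln by simp
  have X: "?E (\<lambda>s a. \<bar>?\<Delta> s a\<bar>) \<le> ?\<alpha> * sqrt ?v + ?\<beta>"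
    using sa_mean_mono[OF \<mu> p conc] kernel_bound_mean[OF \<mu> p N \<alpha>, of h ?\<beta>] by (rule order_trans)
  have st: "(\<Sum>s<S. \<mu> s * (h s)\<^sup>2) = ?E (\<lambda>s a. krow S N a (\<lambda>t. (h t)\<^sup>2) s)"
    unfolding \<mu>_def by (rule sa_mean_krow_stationary[OF N p s0, symmetric])
  have "?v = (\<Sum>s<S. \<mu> s * (h s)\<^sup>2) - ?E (\<lambda>s a. (krow S N a h s)\<^sup>2)"
    unfolding st by (simp add: kvar_def[abs_def] sa_mean_diff)
  also have "\<dots> \<le> 2 * H * (\<Sum>s<S. \<mu> s * (1 + (\<Sum>a<A. p s a * \<bar>?\<Delta> s a\<bar>)))"
  proof (rule second_moment_gap[OF \<mu> p h])
    fix s assume s: "s < S"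
    have "h s - (\<Sum>a<A. p s a * krow S N a h s) = (rpol A r p s - c) + (\<Sum>a<A. p s a * ?\<Delta> s a)"
      using poisson[OF s] by (simp add: right_diff_distrib sum_subtractf)
    moreover have "\<bar>\<Sum>a<A. p s a * ?\<Delta> s a\<bar> \<le> (\<Sum>a<A. p s a * \<bar>?\<Delta> s a\<bar>)"
      using p s by (intro order_trans[OF sum_abs] sum_mono) (auto simp: abs_mult is_policy_def)
    ultimately show "\<bar>h s - (\<Sum>a<A. p s a * krow S N a h s)\<bar> \<le> 1 + (\<Sum>a<A. p s a * \<bar>?\<Delta> s a\<bar>)"
      using rc[OF s] by linarith
  qed (use krow_bounds[OF N] h in blast)+
  also have "(\<Sum>s<S. \<mu> s * (1 + (\<Sum>a<A. p s a * \<bar>?\<Delta> s a\<bar>))) = 1 + ?E (\<lambda>s a. \<bar>?\<Delta> s a\<bar>)"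
    using \<mu> by (simp add: distrib_left sum.distrib is_dist_def sa_mean_def)
  finally have "?v \<le> 2 * H * (1 + ?E (\<lambda>s a. \<bar>?\<Delta> s a\<bar>))" .
  also have "\<dots> \<le> 2 * H * (1 + ?\<alpha> * sqrt ?v + ?\<beta>)"
    using X H by (intro mult_left_mono) auto
  finally have v: "?v \<le> 2 * H * (1 + ?\<alpha> * sqrt ?v + ?\<beta>)" .
  have "c - gain S A N r p s0 = ?E ?\<Delta>"
    unfolding \<mu>_def by (rule gain_difference[OF N p s0 poisson])
  also have "\<dots> \<le> ?E (\<lambda>s a. \<bar>?\<Delta> s a\<bar>)" by (intro sa_mean_mono[OF \<mu> p]) auto
  also note X
  finally have D: "c - gain S A N r p s0 \<le> ?\<alpha> * sqrt ?v + ?\<beta>" .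
  have "?E (\<lambda>s a. 0) \<le> ?v" using kvar_nonneg[OF N] by (intro sa_mean_mono[OF \<mu> p]) auto
  then have "0 \<le> ?v" by (simp add: sa_mean_def)
  then show ?thesis using ln H D1 v D by (rule self_bounding)
qed

text \<open>Now the variance belongs to \<open>L\<close> but the stationary distribution to
  \<open>N\<close>. The second moment must be carried from \<open>L\<close> to \<open>N\<close>
  before it telescopes, which is what \<open>conc2\<close> provides. Applied with the true kernel as
  \<open>L\<close>.\<close>

lemma gain_gap_reference_variance:
  assumes conc: "\<And>s a. s < S \<Longrightarrow> a < A \<Longrightarrow> \<bar>krow S L a h s - krow S N a h s\<bar>
      \<le> sqrt (8 * l / n) * sqrt (kvar S L h s a) + 30 * (H + 1) * l / n"
    and conc2: "\<And>s a. s < S \<Longrightarrow> a < A \<Longrightarrow> \<bar>krow S L a (\<lambda>t. (h t)\<^sup>2) s - krow S N a (\<lambda>t. (h t)\<^sup>2) s\<bar>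
      \<le> 2 * H * (sqrt (8 * l / n) * sqrt (kvar S L h s a) + 30 * (H + 1) * l / n)"
  shows "c - gain S A N r p s0 \<le> 52 * sqrt ((H + 1) * l / n)"
proof -
  define \<mu> where "\<mu> = limmat S (Ppol A N p) s0"
  have \<mu>: "is_dist S \<mu>" unfolding \<mu>_def using stochastic_Ppol[OF N p] s0 by (rule is_dist_limmat)
  let ?E = "sa_mean S A \<mu> p"
  let ?v = "?E (kvar S L h)" and ?\<alpha> = "sqrt (8 * l / n)" and ?\<beta> = "30 * (H + 1) * l / n"
  let ?\<Delta> = "\<lambda>s a. krow S L a h s - krow S N a h s"
  let ?\<Delta>2 = "\<lambda>s a. krow S L a (\<lambda>t. (h t)\<^sup>2) s - krow S N a (\<lambda>t. (h t)\<^sup>2) s"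
  have H: "0 \<le> H" using h[OF s0] by linarith
  have \<alpha>: "0 \<le> ?\<alpha>" using ln by simp
  let ?B = "\<lambda>s a. ?\<alpha> * sqrt (kvar S L h s a) + ?\<beta>"
  have B: "?E ?B \<le> ?\<alpha> * sqrt ?v + ?\<beta>" by (rule kernel_bound_mean[OF \<mu> p L \<alpha>])
  have st: "(\<Sum>s<S. \<mu> s * (h s)\<^sup>2) = ?E (\<lambda>s a. krow S N a (\<lambda>t. (h t)\<^sup>2) s)"
    unfolding \<mu>_def by (rule sa_mean_krow_stationary[OF N p s0, symmetric])
  have "?v = ?E ?\<Delta>2 + ((\<Sum>s<S. \<mu> s * (h s)\<^sup>2) - ?E (\<lambda>s a. (krow S L a h s)\<^sup>2))"
    unfolding st by (simp add: kvar_def[abs_def] sa_mean_diff)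
  also have "(\<Sum>s<S. \<mu> s * (h s)\<^sup>2) - ?E (\<lambda>s a. (krow S L a h s)\<^sup>2) \<le> 2 * H * (\<Sum>s<S. \<mu> s * 1)"
  proof (rule second_moment_gap[OF \<mu> p h])
    fix s assume s: "s < S"
    show "\<bar>h s - (\<Sum>a<A. p s a * krow S L a h s)\<bar> \<le> 1"
      using rc[OF s] poisson[OF s] by linarith
  qed (use krow_bounds[OF L] h in blast)+
  also have "(\<Sum>s<S. \<mu> s * 1) = 1" using \<mu> by (simp add: is_dist_def)
  also have "?E ?\<Delta>2 \<le> ?E (\<lambda>s a. 2 * H * ?B s a)"
    by (rule sa_mean_mono[OF \<mu> p order_trans[OF abs_ge_self conc2]])
  also have "\<dots> \<le> 2 * H * (?\<alpha> * sqrt ?v + ?\<beta>)"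
    unfolding sa_mean_scale using B H by (intro mult_left_mono) auto
  finally have v: "?v \<le> 2 * H * (1 + ?\<alpha> * sqrt ?v + ?\<beta>)" by (simp add: algebra_simps)
  have "c - gain S A N r p s0 = ?E ?\<Delta>"
    unfolding \<mu>_def by (rule gain_difference[OF N p s0 poisson])
  also have "\<dots> \<le> ?E ?B" by (rule sa_mean_mono[OF \<mu> p order_trans[OF abs_ge_self conc]])
  also note B
  finally have D: "c - gain S A N r p s0 \<le> ?\<alpha> * sqrt ?v + ?\<beta>" .
  have "?E (\<lambda>s a. 0) \<le> ?v" using kvar_nonneg[OF L] by (intro sa_mean_mono[OF \<mu> p]) auto
  then have "0 \<le> ?v" by (simp add: sa_mean_def)
  then show ?thesis using ln H D1 v D by (rule self_bounding)
qed

end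

section \<open>Span seminorm and the decomposition of the suboptimality\<close>

lemma spnorm_bounds:
  assumes "s < S"
  shows "Min (h ` {..<S}) \<le> h s" "h s \<le> Min (h ` {..<S}) + spnorm S h"
  using assms by (auto simp: spnorm_def intro!: Min_le Max_ge)

lemma spnorm_nonneg: "1 \<le> S \<Longrightarrow> 0 \<le> spnorm S h"
  using order_trans[OF spnorm_bounds[of 0 S h]] by simp

text \<open>The gain of \<open>bw\<close> under \<open>K'\<close> is inserted: it is at most the
  optimal gain of \<open>K'\<close>, which leaves one gap for \<open>bw\<close> with reference
  kernel \<open>K\<close> and one for \<open>pih\<close> with reference kernel \<open>K'\<close>.
  Both biases are shifted to minimum 0; a constant cancels in the Poisson equation and leaves
  variances unchanged.\<close>

lemma suboptimality_bound:
  assumes "finite_mdp S A K r" "finite_mdp S A K' r"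
    and wc: "weakly_communicating S A K" and wc': "weakly_communicating S A K'"
    and pih: "bias_optimal S A K' r pih" and s0: "s0 < S" and l: "0 \<le> l" "0 \<le> l'" "0 < n"
    and h_def: "h = opt_bias S A K r" and h'_def: "h' = opt_bias S A K' r"
    and c1: "\<And>s a. s < S \<Longrightarrow> a < A \<Longrightarrow> \<bar>krow S K a h s - krow S K' a h s\<bar>
      \<le> sqrt (8 * l / n) * sqrt (kvar S K h s a) + 30 * (spnorm S h + 1) * l / n"
    and c2: "\<And>s a. s < S \<Longrightarrow> a < A \<Longrightarrow>
      \<bar>krow S K a (\<lambda>t. (h t - Min (h ` {..<S}))\<^sup>2) s - krow S K' a (\<lambda>t. (h t - Min (h ` {..<S}))\<^sup>2) s\<bar>
      \<le> 2 * spnorm S h * (sqrt (8 * l / n) * sqrt (kvar S K h s a) + 30 * (spnorm S h + 1) * l / n)"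
    and c3: "\<And>s a. s < S \<Longrightarrow> a < A \<Longrightarrow> \<bar>krow S K' a h' s - krow S K a h' s\<bar>
      \<le> sqrt (8 * l' / n) * sqrt (kvar S K h' s a) + 30 * (spnorm S h' + 1) * l' / n"
  shows "opt_gain S A K r s0 - gain S A K r pih s0
     \<le> 52 * sqrt ((spnorm S h + 1) * l / n) + 52 * sqrt ((spnorm S h' + 1) * l' / n)"
proof -
  interpret M: finite_mdp S A K r by fact
  interpret M': finite_mdp S A K' r by fact
  obtain c where c: "\<And>s. s < S \<Longrightarrow> opt_gain S A K r s = c" "0 \<le> c" "c \<le> 1"
    using M.opt_gain_constant[OF wc] by blast
  obtain c' where c': "\<And>s. s < S \<Longrightarrow> opt_gain S A K' r s = c'" "0 \<le> c'" "c' \<le> 1"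
    using M'.opt_gain_constant[OF wc'] by blast
  have pol: "is_policy S A pih" using pih by (simp add: bias_optimal_def)
  define h0 where "h0 t = h t - Min (h ` {..<S})" for t
  define h0' where "h0' t = h' t - Min (h' ` {..<S})" for t
  have h0: "0 \<le> h0 t \<and> h0 t \<le> spnorm S h" if "t < S" for t
    using spnorm_bounds[OF that, of h] by (simp add: h0_def)
  have h0': "0 \<le> h0' t \<and> h0' t \<le> spnorm S h'" if "t < S" for t
    using spnorm_bounds[OF that, of h'] by (simp add: h0'_def)
  have shift: "(\<Sum>a<A. p s a * krow S L a (\<lambda>t. f t - d) s) = (\<Sum>a<A. p s a * krow S L a f s) - d"
    if "is_policy S A p" "is_kernel S A L" "s < S" for p s L f d
    using that krow_shift[OF that(2,3), of _ f d]
    by (simp add: right_diff_distrib sum_subtractf is_policy_def flip: sum_distrib_right)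
  have poisson: "rpol A r M.bw s = c + h0 s - (\<Sum>a<A. M.bw s a * krow S K a h0 s)" if s: "s < S" for s
  proof -
    have "rpol A r M.bw s = c + h s - (\<Sum>a<A. M.bw s a * krow S K a h s)"
      using poisson_equation[OF M.stoch_p[OF M.bw_policy] s, of "rpol A r M.bw"] c(1)[OF s]
      unfolding h_def M.opt_gain_bw M.opt_bias_bw gain_eq_mgain bias_eq_mbias[abs_def] mvec_Ppol by simp
    then show ?thesis unfolding h0_def[abs_def] shift[OF M.bw_policy M.kernel s] by simp
  qed
  \<comment> \<open>The Poisson equation of \<open>pih\<close> involves its own gain and bias; bias
    optimality replaces them by \<open>c'\<close> and \<open>h'\<close>.\<close>
  have poisson': "rpol A r pih s = c' + h0' s - (\<Sum>a<A. pih s a * krow S K' a h0' s)" if s: "s < S" for s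
  proof -
    have b: "mbias S (Ppol A K' pih) (rpol A r pih) t = h' t" if "t < S" for t
      using pih that unfolding bias_optimal_def h'_def by (simp flip: bias_eq_mbias)
    have g: "mgain S (Ppol A K' pih) (rpol A r pih) s = c'"
      using pih s c'(1)[OF s] unfolding bias_optimal_def by (simp flip: gain_eq_mgain)
    have "mvec S (Ppol A K' pih) (mbias S (Ppol A K' pih) (rpol A r pih)) s = mvec S (Ppol A K' pih) h' s"
      using b by (intro mvec_cong) auto
    then have "rpol A r pih s = c' + h' s - (\<Sum>a<A. pih s a * krow S K' a h' s)"
      using poisson_equation[OF M'.stoch_p[OF pol] s, of "rpol A r pih"] b[OF s] g by (simp add: mvec_Ppol)
    then show ?thesis unfolding h0'_def[abs_def] shift[OF pol M'.kernel s] by simp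
  qed
  have gain_nonneg: "0 \<le> gain S A L r p s0" if "finite_mdp S A L r" "is_policy S A p" for L p
  proof -
    interpret N: finite_mdp S A L r by fact
    have "mvec S (limmat S (Ppol A L p)) (\<lambda>_. 0) s0 \<le> gain S A L r p s0"
      unfolding gain_eq_mgain mgain_def using stochastic_limmat[OF N.stoch_p[OF that(2)]] s0 N.rpol_bounds[OF that(2)]
      by (intro mvec_mono) auto
    then show ?thesis by (simp add: mvec_def)
  qed
  have "c - gain S A K' r M.bw s0 \<le> 52 * sqrt ((spnorm S h + 1) * l / n)"
  proof (rule gain_gap_reference_variance[OF M'.kernel M.kernel M.bw_policy s0 poisson _ h0 _ l(1,3)])
    show "\<bar>rpol A r M.bw s - c\<bar> \<le> 1" if "s < S" for s
      using M.rpol_bounds[OF M.bw_policy that] c by (simp add: abs_le_iff)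
    show "c - gain S A K' r M.bw s0 \<le> 1"
      using gain_nonneg[OF assms(2) M.bw_policy] c by simp
    show "\<bar>krow S K a h0 s - krow S K' a h0 s\<bar>
      \<le> sqrt (8 * l / n) * sqrt (kvar S K h0 s a) + 30 * (spnorm S h + 1) * l / n" if "s < S" "a < A" for s a
      using c1[OF that] unfolding h0_def[abs_def] krow_shift[OF M.kernel that] krow_shift[OF M'.kernel that]
        kvar_shift[OF M.kernel that] by simp
    show "\<bar>krow S K a (\<lambda>t. (h0 t)\<^sup>2) s - krow S K' a (\<lambda>t. (h0 t)\<^sup>2) s\<bar>
      \<le> 2 * spnorm S h * (sqrt (8 * l / n) * sqrt (kvar S K h0 s a) + 30 * (spnorm S h + 1) * l / n)" if "s < S" "a < A" for s a
      using c2[OF that] unfolding h0_def[abs_def] kvar_shift[OF M.kernel that] .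
  qed
  moreover have "c' - gain S A K r pih s0 \<le> 52 * sqrt ((spnorm S h' + 1) * l' / n)"
  proof (rule gain_gap_stationary_variance[OF M.kernel M'.kernel pol s0 poisson' _ h0' _ l(2,3)])
    show "\<bar>rpol A r pih s - c'\<bar> \<le> 1" if "s < S" for s
      using M.rpol_bounds[OF pol that] c' by (simp add: abs_le_iff)
    show "c' - gain S A K r pih s0 \<le> 1"
      using gain_nonneg[OF assms(1) pol] c' by simp
    show "\<bar>krow S K' a h0' s - krow S K a h0' s\<bar>
      \<le> sqrt (8 * l' / n) * sqrt (kvar S K h0' s a) + 30 * (spnorm S h' + 1) * l' / n" if "s < S" "a < A" for s a
      using c3[OF that] unfolding h0'_def[abs_def] krow_shift[OF M.kernel that] krow_shift[OF M'.kernel that]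
        kvar_shift[OF M.kernel that] by simp
  qed
  moreover have "gain S A K' r M.bw s0 \<le> c'"
    using M'.gain_le_opt_gain[OF M.bw_policy s0] c'(1)[OF s0] by simp
  ultimately show ?thesis using c(1)[OF s0] by simp
qed

section \<open>Bernstein's inequality\<close>

lemma exp_le_quadratic:
  fixes x :: real
  assumes "\<bar>x\<bar> \<le> 1"
  shows "exp x \<le> 1 + x + x\<^sup>2"
proof (cases "0 \<le> x")
  case True
  then show ?thesis using assms by (intro exp_bound) auto
next
  case False
  define y where "y = - x"
  have y: "0 \<le> y" "y \<le> 1" using False assms by (auto simp: y_def)
  \<comment> \<open>The product equals 1 + y^3.\<close>
  have "1 \<le> (1 + y) * (1 - y + y\<^sup>2)"
    using y by (simp add: algebra_simps power2_eq_square)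
  also have "\<dots> \<le> exp y * (1 - y + y\<^sup>2)"
    using y exp_ge_add_one_self[of y] by (intro mult_right_mono) (auto intro: add_nonneg_nonneg)
  finally have "1 \<le> exp y * (1 - y + y\<^sup>2)" .
  moreover have "exp x * exp y = 1" by (simp add: y_def flip: exp_add)
  ultimately have "exp x * 1 \<le> 1 - y + y\<^sup>2"
    using mult_left_mono[of 1 "exp y * (1 - y + y\<^sup>2)" "exp x"] by (simp flip: mult.assoc)
  then show ?thesis by (simp add: y_def)
qed

lemma expectation_finite_support:
  fixes p :: "nat pmf"
  assumes "set_pmf p \<subseteq> {..<S}"
  shows "measure_pmf.expectation p f = (\<Sum>t<S. pmf p t * (f t :: real))"
  using assms by (subst integral_measure_pmf[of "{..<S}"]) auto

lemma integrable_finite_support: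
  "set_pmf p \<subseteq> {..<S} \<Longrightarrow> integrable (measure_pmf p) (f :: nat \<Rightarrow> real)"
  by (rule integrable_measure_pmf_finite) (rule finite_subset, auto)

lemma bernstein_mgf:
  fixes X :: "nat \<Rightarrow> real"
  assumes p: "set_pmf p \<subseteq> {..<S}" and mean: "(\<Sum>t<S. pmf p t * X t) = 0"
    and b: "\<And>t. t < S \<Longrightarrow> \<bar>\<theta> * X t\<bar> \<le> 1"
  shows "measure_pmf.expectation p (\<lambda>t. exp (\<theta> * X t)) \<le> exp (\<theta>\<^sup>2 * (\<Sum>t<S. pmf p t * (X t)\<^sup>2))"
proof -
  have one: "(\<Sum>t<S. pmf p t) = 1" using p by (intro sum_pmf_eq_1) auto
  have "(\<Sum>t<S. pmf p t * exp (\<theta> * X t)) \<le> (\<Sum>t<S. pmf p t * (1 + \<theta> * X t + (\<theta> * X t)\<^sup>2))"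
    using b by (intro sum_mono mult_left_mono exp_le_quadratic) auto
  also have "\<dots> = (\<Sum>t<S. pmf p t) + \<theta> * (\<Sum>t<S. pmf p t * X t) + \<theta>\<^sup>2 * (\<Sum>t<S. pmf p t * (X t)\<^sup>2)"
    by (simp add: sum.distrib sum_distrib_left algebra_simps power_mult_distrib)
  also have "\<dots> \<le> exp (\<theta>\<^sup>2 * (\<Sum>t<S. pmf p t * (X t)\<^sup>2))"
    using one mean exp_ge_add_one_self by (simp add: add.commute)
  finally show ?thesis by (simp add: expectation_finite_support[OF p])
qed

text \<open>Chernoff bound with theta the smaller of 1/b and sqrt(l/V), V being the total variance.
  The moment bound needs theta b <= 1. Of the two terms of the threshold, the one matching the
  active choice gives theta T >= 2 l, while theta^2 V <= l, so the exponent is at most -l.\<close>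

lemma bernstein_upper_tail:
  fixes X :: "nat \<Rightarrow> real"
  assumes p: "set_pmf p \<subseteq> {..<S}" and mean: "(\<Sum>t<S. pmf p t * X t) = 0"
    and b: "\<And>t. t < S \<Longrightarrow> \<bar>X t\<bar> \<le> b" and J: "finite J" and l: "0 < l" and b0: "0 < b"
  shows "measure_pmf.prob (Pi_pmf J d (\<lambda>_. p))
     {\<omega>. 2 * sqrt (card J * (\<Sum>t<S. pmf p t * (X t)\<^sup>2) * l) + 2 * b * l \<le> (\<Sum>j\<in>J. X (\<omega> j))} \<le> exp (- l)"
proof -
  define V where "V = card J * (\<Sum>t<S. pmf p t * (X t)\<^sup>2)"
  define T where "T = 2 * sqrt (V * l) + 2 * b * l"
  have V: "0 \<le> V" unfolding V_def by (auto intro!: mult_nonneg_nonneg sum_nonneg)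
  have "\<exists>\<theta>\<ge>0. \<theta> * b \<le> 1 \<and> \<theta>\<^sup>2 * V \<le> l \<and> 2 * l \<le> \<theta> * T"
  proof (cases "V \<le> l * b\<^sup>2")
    case True
    have "2 * l \<le> 1 / b * T" using b0 V l by (simp add: T_def field_simps)
    then show ?thesis using True b0 by (intro exI[of _ "1 / b"]) (auto simp: field_simps)
  next
    case False
    then have V0: "0 < V" using l b0 by (smt (verit) zero_less_mult_iff zero_less_power)
    have "sqrt (l / V) * sqrt (V * l) = l" using V0 l by (simp flip: real_sqrt_mult)
    then have "2 * l \<le> sqrt (l / V) * T" using b0 l V0 by (simp add: T_def algebra_simps)
    moreover have "sqrt (l / V) * b \<le> 1"
    proof (rule power2_le_imp_le)
      show "(sqrt (l / V) * b)\<^sup>2 \<le> 1\<^sup>2" using False V0 l by (simp add: power_mult_distrib field_simps)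
    qed simp
    ultimately show ?thesis using V0 l by (intro exI[of _ "sqrt (l / V)"]) auto
  qed
  then obtain \<theta> where \<theta>: "0 \<le> \<theta>" "\<theta> * b \<le> 1" "\<theta>\<^sup>2 * V \<le> l" "2 * l \<le> \<theta> * T" by blast
  let ?M = "Pi_pmf J d (\<lambda>_. p)" and ?u = "\<lambda>\<omega>. \<Prod>j\<in>J. exp (\<theta> * X (\<omega> j))"
  have b': "\<bar>\<theta> * X t\<bar> \<le> 1" if "t < S" for t
    using mult_left_mono[OF b[OF that] \<theta>(1)] \<theta> by (simp add: abs_mult)
  have u: "?u \<omega> = exp (\<theta> * (\<Sum>j\<in>J. X (\<omega> j)))" for \<omega>
    using J by (simp add: exp_sum sum_distrib_left)
  have "{\<omega>. T \<le> (\<Sum>j\<in>J. X (\<omega> j))} \<subseteq> {\<omega> \<in> space (measure_pmf ?M). exp (\<theta> * T) \<le> ?u \<omega>}"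
    unfolding u using \<theta>(1) by (auto intro: mult_left_mono)
  then have "measure_pmf.prob ?M {\<omega>. T \<le> (\<Sum>j\<in>J. X (\<omega> j))}
      \<le> measure_pmf.prob ?M {\<omega> \<in> space (measure_pmf ?M). exp (\<theta> * T) \<le> ?u \<omega>}"
    by (intro measure_pmf.finite_measure_mono) auto
  also have "\<dots> \<le> measure_pmf.expectation ?M ?u / exp (\<theta> * T)"
    by (rule integral_Markov_inequality_measure[where A = "{}"])
      (auto intro!: integrable_prod_Pi_pmf J integrable_finite_support[OF p] prod_nonneg)
  also have "measure_pmf.expectation ?M ?u = (\<Prod>j\<in>J. measure_pmf.expectation p (\<lambda>t. exp (\<theta> * X t)))"
    by (rule expectation_prod_Pi_pmf) (auto intro!: J integrable_finite_support[OF p])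
  also have "\<dots> \<le> (\<Prod>j\<in>J. exp (\<theta>\<^sup>2 * (\<Sum>t<S. pmf p t * (X t)\<^sup>2)))"
    by (intro prod_mono conjI bernstein_mgf[OF p mean b'] Bochner_Integration.integral_nonneg) auto
  also have "\<dots> = exp (\<theta>\<^sup>2 * V)"
    by (simp add: V_def mult_ac flip: exp_of_nat_mult)
  also have "exp (\<theta>\<^sup>2 * V) / exp (\<theta> * T) = exp (\<theta>\<^sup>2 * V - \<theta> * T)" by (simp add: exp_diff)
  also have "\<dots> \<le> exp (- l)" using \<theta> by simp
  finally show ?thesis by (simp add: T_def V_def divide_right_mono)
qed

text \<open>The strict deviation and the restriction to samples below \<open>S\<close> make the
  event empty when b = 0, the case excluded from the one-sided bound.\<close>

lemma bernstein_two_sided: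
  fixes X :: "nat \<Rightarrow> real"
  assumes p: "set_pmf p \<subseteq> {..<S}" and mean: "(\<Sum>t<S. pmf p t * X t) = 0"
    and b: "\<And>t. t < S \<Longrightarrow> \<bar>X t\<bar> \<le> b" and J: "finite J" and l: "0 < l" and b0: "0 \<le> b"
  shows "measure_pmf.prob (Pi_pmf J d (\<lambda>_. p))
     {\<omega>. (\<forall>j\<in>J. \<omega> j < S) \<and> 2 * sqrt (card J * (\<Sum>t<S. pmf p t * (X t)\<^sup>2) * l) + 2 * b * l < \<bar>\<Sum>j\<in>J. X (\<omega> j)\<bar>} \<le> 2 * exp (- l)"
    (is "measure_pmf.prob ?M {\<omega>. _ \<and> ?T < _} \<le> _")
proof (cases "b = 0")
  case True
  then have X0: "X t = 0" if "t < S" for t using b[OF that] by simp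
  have "(\<Sum>j\<in>J. X (\<omega> j)) = 0" if "\<forall>j\<in>J. \<omega> j < S" for \<omega>
    using that X0 by (intro sum.neutral) auto
  moreover have "0 \<le> ?T"
    using l b0 by (intro add_nonneg_nonneg mult_nonneg_nonneg real_sqrt_ge_zero sum_nonneg) auto
  ultimately have "{\<omega>. (\<forall>j\<in>J. \<omega> j < S) \<and> ?T < \<bar>\<Sum>j\<in>J. X (\<omega> j)\<bar>} = {}"
    by fastforce
  then show ?thesis by (simp only: measure_empty) simp
next
  case False
  then have b0: "0 < b" using b0 by simp
  let ?U = "{\<omega>. ?T \<le> (\<Sum>j\<in>J. X (\<omega> j))}" and ?L = "{\<omega>. ?T \<le> (\<Sum>j\<in>J. - X (\<omega> j))}"
  have "measure_pmf.prob ?M {\<omega>. (\<forall>j\<in>J. \<omega> j < S) \<and> ?T < \<bar>\<Sum>j\<in>J. X (\<omega> j)\<bar>} \<le> measure_pmf.prob ?M (?U \<union> ?L)"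
    by (intro measure_pmf.finite_measure_mono) (auto simp: sum_negf abs_if split: if_splits)
  also have "\<dots> \<le> measure_pmf.prob ?M ?U + measure_pmf.prob ?M ?L"
    by (intro measure_Un_le) auto
  also have "measure_pmf.prob ?M ?U \<le> exp (- l)"
    by (rule bernstein_upper_tail[OF p mean b J l b0])
  also have "measure_pmf.prob ?M ?L \<le> exp (- l)"
    using bernstein_upper_tail[OF p, of "\<lambda>t. - X t" b J l d] mean b J l b0 by (simp add: sum_negf)
  finally show ?thesis by simp
qed

section \<open>Independence and decoupling\<close>

lemma pair_pmf_prob_le:
  assumes "\<And>a. measure_pmf.prob N {b. (a, b) \<in> X} \<le> e" "0 \<le> e"
  shows "measure_pmf.prob (pair_pmf M N) X \<le> e"
proof -
  have "emeasure (measure_pmf (pair_pmf M N)) X = (\<integral>\<^sup>+a. \<integral>\<^sup>+b. indicator X (a, b) \<partial>N \<partial>M)"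
    by (simp add: nn_integral_pair_pmf' flip: nn_integral_indicator)
  also have "\<dots> = (\<integral>\<^sup>+a. emeasure (measure_pmf N) {b. (a, b) \<in> X} \<partial>M)"
  proof (intro nn_integral_cong)
    fix a
    have "(\<integral>\<^sup>+b. indicator X (a, b) \<partial>N) = (\<integral>\<^sup>+b. indicator {b. (a, b) \<in> X} b \<partial>N)"
      by (intro nn_integral_cong) (auto simp: indicator_def)
    then show "(\<integral>\<^sup>+b. indicator X (a, b) \<partial>N) = emeasure (measure_pmf N) {b. (a, b) \<in> X}" by simp
  qed
  also have "\<dots> \<le> (\<integral>\<^sup>+a. ennreal e \<partial>M)"
    using assms by (intro nn_integral_mono) (auto simp: measure_pmf.emeasure_eq_measure intro!: ennreal_leI)
  finally have "emeasure (measure_pmf (pair_pmf M N)) X \<le> ennreal e" by simp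
  then show ?thesis using assms(2) by (simp add: measure_pmf.emeasure_eq_measure)
qed

lemma pair_pmf_prob_le':
  assumes "\<And>b. measure_pmf.prob M {a. (a, b) \<in> X} \<le> e" "0 \<le> e"
  shows "measure_pmf.prob (pair_pmf M N) X \<le> e"
  unfolding pair_commute_pmf[of M N] measure_map_pmf
  by (rule pair_pmf_prob_le) (use assms in simp_all)

abbreviation (input) pmf_kernel :: "(nat \<Rightarrow> nat \<Rightarrow> nat pmf) \<Rightarrow> kernel" where
  "pmf_kernel P \<equiv> \<lambda>s a s'. pmf (P s a) s'"

lemma is_kernel_pmf:
  "(\<And>s a. s < S \<Longrightarrow> a < A \<Longrightarrow> set_pmf (P s a) \<subseteq> {..<S}) \<Longrightarrow> is_kernel S A (pmf_kernel P)"
  unfolding is_kernel_def stochastic_def by (auto intro!: sum_pmf_eq_1)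

lemma krow_emp_kernel:
  assumes "\<And>i. i < n \<Longrightarrow> \<omega> ((s, a), i) < S"
  shows "krow S (emp_kernel n \<omega>) a F s = (\<Sum>i<n. F (\<omega> ((s, a), i))) / real n"
proof -
  have "(\<Sum>i<n. F (\<omega> ((s, a), i))) = (\<Sum>t<S. \<Sum>i\<in>{i\<in>{..<n}. \<omega> ((s, a), i) = t}. F (\<omega> ((s, a), i)))"
    using assms by (intro sum.group[symmetric]) auto
  also have "\<dots> = (\<Sum>t<S. real (card {i. i < n \<and> \<omega> ((s, a), i) = t}) * F t)"
    by (intro sum.cong refl) simp
  finally show ?thesis by (simp add: mvec_def emp_kernel_def sum_divide_distrib)
qed

lemma bernstein_decoupled:
  fixes F :: "((nat \<times> nat) \<times> nat \<Rightarrow> nat) \<Rightarrow> nat \<Rightarrow> real"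
  assumes sa: "s < S" "a < A" and n: "1 \<le> n" and l: "0 < l"
    and P: "\<And>s a. s < S \<Longrightarrow> a < A \<Longrightarrow> set_pmf (P s a) \<subseteq> {..<S}"
    and F: "\<And>\<omega> \<omega>'. (\<And>x i. x \<noteq> (s, a) \<Longrightarrow> \<omega> (x, i) = \<omega>' (x, i)) \<Longrightarrow> F \<omega> = F \<omega>'"
  shows "measure_pmf.prob (sample_pmf S A n P)
    {\<omega>. 2 * sqrt (kvar S (pmf_kernel P) (F \<omega>) s a * l / n) + 2 * spnorm S (F \<omega>) * l / n
        < \<bar>krow S (emp_kernel n \<omega>) a (F \<omega>) s - krow S (pmf_kernel P) a (F \<omega>) s\<bar>} \<le> 2 * exp (- l)"
    (is "measure_pmf.prob ?M {\<omega>. ?bad \<omega>} \<le> _")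
proof -
  let ?J = "{(s, a)} \<times> {..<n}" and ?I = "(({..<S} \<times> {..<A}) - {(s, a)}) \<times> {..<n}"
  let ?p = "\<lambda>((s, a), i). P s a"
  let ?N = "Pi_pmf ?J 0 (\<lambda>_. P s a)"
  let ?m = "\<lambda>(g, f) x. if x \<in> ?J then g x else (f x :: nat)"
  have K: "is_kernel S A (pmf_kernel P)" using P by (rule is_kernel_pmf)
  \<comment> \<open>The product measure is split into the samples at (s, a) and all the
    others.\<close>
  have "?M = Pi_pmf (?J \<union> ?I) 0 ?p"
    unfolding sample_pmf_def using sa by (intro arg_cong2[where f = "\<lambda>I. Pi_pmf I 0"]) auto
  also have "\<dots> = map_pmf ?m (pair_pmf (Pi_pmf ?J 0 ?p) (Pi_pmf ?I 0 ?p))"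
    by (rule Pi_pmf_union) auto
  also have "Pi_pmf ?J 0 ?p = ?N" by (intro Pi_pmf_cong) auto
  finally have M: "?M = map_pmf ?m (pair_pmf ?N (Pi_pmf ?I 0 ?p))" .
  have sup: "\<omega> ((s, a), i) < S" if "\<omega> \<in> set_pmf ?M" "i < n" for \<omega> i
    using that sa P by (fastforce simp: sample_pmf_def set_Pi_pmf PiE_dflt_def)
  have "measure_pmf.prob ?M {\<omega>. ?bad \<omega>} \<le> measure_pmf.prob ?M {\<omega>. (\<forall>i<n. \<omega> ((s, a), i) < S) \<and> ?bad \<omega>}"
    using sup by (subst measure_Int_set_pmf[symmetric], intro measure_pmf.finite_measure_mono) auto
  also have "\<dots> \<le> 2 * exp (- l)"
    unfolding M measure_map_pmf
  proof (rule pair_pmf_prob_le')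
    fix f :: "(nat \<times> nat) \<times> nat \<Rightarrow> nat"
    \<comment> \<open>The zeros stand in for the samples at (s, a), which \<open>F\<close> does not
      read.\<close>
    define G where "G = F (?m (\<lambda>_. 0, f))"
    define \<mu> where "\<mu> = krow S (pmf_kernel P) a G s"
    define X where "X t = G t - \<mu>" for t
    have FG: "F (?m (g, f)) = G" for g unfolding G_def by (rule F) auto
    have mean: "(\<Sum>t<S. pmf (P s a) t * X t) = 0"
      using krow_shift[OF K sa, of G \<mu>] by (simp add: X_def \<mu>_def mvec_def)
    have var: "(\<Sum>t<S. pmf (P s a) t * (X t)\<^sup>2) = kvar S (pmf_kernel P) G s a"
      using kvar_eq_centered[OF K sa, of G \<mu>] by (simp add: X_def \<mu>_def mvec_def)
    have b: "\<bar>X t\<bar> \<le> spnorm S G" if "t < S" for t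
    proof -
      have "0 \<le> krow S (pmf_kernel P) a (\<lambda>t. G t - Min (G ` {..<S})) s
          \<and> krow S (pmf_kernel P) a (\<lambda>t. G t - Min (G ` {..<S})) s \<le> spnorm S G"
        using spnorm_bounds[of _ S G] by (intro krow_bounds[OF K sa(2,1)]) (auto simp: algebra_simps)
      then show ?thesis using spnorm_bounds[OF that, of G] unfolding X_def \<mu>_def krow_shift[OF K sa] by linarith
    qed
    have b0: "0 \<le> spnorm S G" using sa by (intro spnorm_nonneg) simp
    have "{g. (g, f) \<in> ?m -` {\<omega>. (\<forall>i<n. \<omega> ((s, a), i) < S) \<and> ?bad \<omega>}}
      \<subseteq> {g. (\<forall>j\<in>?J. g j < S) \<and> 2 * sqrt (card ?J * (\<Sum>t<S. pmf (P s a) t * (X t)\<^sup>2) * l) + 2 * spnorm S G * l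
            < \<bar>\<Sum>j\<in>?J. X (g j)\<bar>}"
    proof (intro subsetI CollectI conjI)
      fix g assume "g \<in> {g. (g, f) \<in> ?m -` {\<omega>. (\<forall>i<n. \<omega> ((s, a), i) < S) \<and> ?bad \<omega>}}"
      then have g: "\<forall>i<n. ?m (g, f) ((s, a), i) < S" "?bad (?m (g, f))" by auto
      have g1: "g ((s, a), i) < S" if "i < n" for i using g(1) that by auto
      then show "\<forall>j\<in>?J. g j < S" by auto
      have "krow S (emp_kernel n (?m (g, f))) a G s = (\<Sum>i<n. G (g ((s, a), i))) / real n"
        using g(1) by (subst krow_emp_kernel) auto
      moreover have "(\<Sum>j\<in>?J. X (g j)) = (\<Sum>i<n. G (g ((s, a), i))) - n * \<mu>"
      proof -
        have "?J = Pair (s, a) ` {..<n}" by auto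
        then have "(\<Sum>j\<in>?J. X (g j)) = (\<Sum>i<n. X (g ((s, a), i)))"
          by (simp only:) (subst sum.reindex, auto simp: inj_on_def)
        then show ?thesis by (simp add: X_def sum_subtractf)
      qed
      ultimately have dev: "(\<Sum>j\<in>?J. X (g j)) = n * (krow S (emp_kernel n (?m (g, f))) a G s - \<mu>)"
        using n by (simp add: field_simps)
      \<comment> \<open>Multiplying by n turns averages into sums; n enters the root squared, so one
        power of n remains beside the variance.\<close>
      have "n * (2 * sqrt (kvar S (pmf_kernel P) G s a * l / n) + 2 * spnorm S G * l / n)
          < n * \<bar>krow S (emp_kernel n (?m (g, f))) a G s - \<mu>\<bar>"
        using g(2) n unfolding FG \<mu>_def by (intro mult_strict_left_mono) auto
      moreover have "n * (2 * sqrt (kvar S (pmf_kernel P) G s a * l / n) + 2 * spnorm S G * l / n)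
          = 2 * sqrt (n * kvar S (pmf_kernel P) G s a * l) + 2 * spnorm S G * l"
      proof -
        have "real n * sqrt (kvar S (pmf_kernel P) G s a * l / n)
            = sqrt ((real n)\<^sup>2 * (kvar S (pmf_kernel P) G s a * l / n))"
          by (subst real_sqrt_mult) simp
        also have "(real n)\<^sup>2 * (kvar S (pmf_kernel P) G s a * l / n) = n * kvar S (pmf_kernel P) G s a * l"
          using n by (simp add: power2_eq_square)
        finally show ?thesis using n by (simp add: distrib_left mult.left_commute)
      qed
      ultimately show "2 * sqrt (card ?J * (\<Sum>t<S. pmf (P s a) t * (X t)\<^sup>2) * l) + 2 * spnorm S G * l
            < \<bar>\<Sum>j\<in>?J. X (g j)\<bar>"
        unfolding dev var by (simp add: card_cartesian_product abs_mult)
    qed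
    then have "measure_pmf.prob ?N {g. (g, f) \<in> ?m -` {\<omega>. (\<forall>i<n. \<omega> ((s, a), i) < S) \<and> ?bad \<omega>}}
      \<le> measure_pmf.prob ?N {g. (\<forall>j\<in>?J. g j < S) \<and> 2 * sqrt (card ?J * (\<Sum>t<S. pmf (P s a) t * (X t)\<^sup>2) * l) + 2 * spnorm S G * l
            < \<bar>\<Sum>j\<in>?J. X (g j)\<bar>}"
      by (intro measure_pmf.finite_measure_mono) auto
    also have "\<dots> \<le> 2 * exp (- l)"
      by (rule bernstein_two_sided[OF P[OF sa] mean b _ l b0]) auto
    finally show "measure_pmf.prob ?N {g. (g, f) \<in> ?m -` {\<omega>. (\<forall>i<n. \<omega> ((s, a), i) < S) \<and> ?bad \<omega>}} \<le> 2 * exp (- l)" .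
  qed simp
  finally show ?thesis .
qed

section \<open>Stability of variance and span under perturbation\<close>

text \<open>The variance is the least mean square deviation, so any convenient center
  \<open>d\<close> gives an upper bound.\<close>

lemma krow_centered_mono:
  assumes K: "is_kernel S A K" and sa: "s < S" "a < A"
    and le: "\<And>t. t < S \<Longrightarrow> (f t - d)\<^sup>2 \<le> c * (h t - krow S K a h s)\<^sup>2 + e"
  shows "kvar S K f s a \<le> c * kvar S K h s a + e"
proof -
  have "kvar S K f s a \<le> krow S K a (\<lambda>t. (f t - d)\<^sup>2) s"
    by (simp add: kvar_eq_centered[OF K sa])
  also have "\<dots> \<le> krow S K a (\<lambda>t. c * (h t - krow S K a h s)\<^sup>2 + e) s"
    using le by (intro mvec_mono krow_stochastic[OF K sa(2)] sa)
  also have "\<dots> = c * kvar S K h s a + e"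
    using mvec_const[OF krow_stochastic[OF K sa(2)] sa(1)]
    by (simp add: mvec_add mvec_scale kvar_eq_centered[OF K sa])
  finally show ?thesis .
qed

text \<open>With center m^2, where m is the mean of h, each deviation factors as (h + m)(h - m),
  whose first factor is at most 2H.\<close>

lemma kvar_square_le:
  assumes K: "is_kernel S A K" and sa: "s < S" "a < A" and h: "\<And>t. t < S \<Longrightarrow> 0 \<le> h t \<and> h t \<le> H"
  shows "kvar S K (\<lambda>t. (h t)\<^sup>2) s a \<le> 4 * H\<^sup>2 * kvar S K h s a"
proof -
  let ?m = "krow S K a h s"
  have "kvar S K (\<lambda>t. (h t)\<^sup>2) s a \<le> 4 * H\<^sup>2 * kvar S K h s a + 0"
  proof (rule krow_centered_mono[OF K sa, where d = "?m\<^sup>2"])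
    fix t assume t: "t < S"
    have m: "0 \<le> ?m" "?m \<le> H" using krow_bounds[OF K sa(2,1) h] by auto
    have "((h t)\<^sup>2 - ?m\<^sup>2)\<^sup>2 = (h t + ?m)\<^sup>2 * (h t - ?m)\<^sup>2" by (simp add: power2_eq_square algebra_simps)
    also have "\<dots> \<le> (2 * H)\<^sup>2 * (h t - ?m)\<^sup>2"
      using h[OF t] m by (intro mult_right_mono power_mono) auto
    finally show "((h t)\<^sup>2 - ?m\<^sup>2)\<^sup>2 \<le> 4 * H\<^sup>2 * (h t - ?m)\<^sup>2 + 0" by (simp add: power_mult_distrib)
  qed
  then show ?thesis by simp
qed

lemma kvar_perturb_le:
  assumes K: "is_kernel S A K" and sa: "s < S" "a < A"
    and e: "\<And>t. t < S \<Longrightarrow> \<bar>f t - (h t + c)\<bar> \<le> e"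
  shows "kvar S K f s a \<le> 2 * kvar S K h s a + 2 * e\<^sup>2"
proof (rule krow_centered_mono[OF K sa, where d = "krow S K a h s + c"])
  fix t assume t: "t < S"
  let ?x = "f t - (h t + c)" and ?y = "h t - krow S K a h s"
  have sq: "(x + y)\<^sup>2 \<le> 2 * y\<^sup>2 + 2 * x\<^sup>2" for x y :: real
    using sum_squares_bound[of x y] by (simp add: power2_sum)
  have "(f t - (krow S K a h s + c))\<^sup>2 = (?x + ?y)\<^sup>2" by (rule arg_cong[of _ _ "\<lambda>x. x\<^sup>2"]) simp
  also have "\<dots> \<le> 2 * ?y\<^sup>2 + 2 * ?x\<^sup>2" by (rule sq)
  also have "?x\<^sup>2 \<le> e\<^sup>2" using power_mono[OF e[OF t], of 2] by simp
  finally show "(f t - (krow S K a h s + c))\<^sup>2 \<le> 2 * ?y\<^sup>2 + 2 * e\<^sup>2" by simp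
qed

lemma spnorm_le:
  assumes S: "1 \<le> S" and "\<And>t. t < S \<Longrightarrow> lo \<le> f t" "\<And>t. t < S \<Longrightarrow> f t \<le> hi"
  shows "spnorm S f \<le> hi - lo"
proof -
  have "f ` {..<S} \<noteq> {}" "finite (f ` {..<S})" using S by (auto simp: lessThan_empty_iff)
  then have "Max (f ` {..<S}) \<le> hi" "lo \<le> Min (f ` {..<S})" using assms by auto
  then show ?thesis by (simp add: spnorm_def)
qed

lemma spnorm_perturb_le:
  assumes "1 \<le> S" and e: "\<And>t. t < S \<Longrightarrow> \<bar>f t - (h t + c)\<bar> \<le> e"
  shows "spnorm S f \<le> spnorm S h + 2 * e"
proof -
  have "spnorm S f \<le> (Min (h ` {..<S}) + spnorm S h + c + e) - (Min (h ` {..<S}) + c - e)"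
  proof (rule spnorm_le[OF assms(1)])
    fix t assume t: "t < S"
    show "f t \<le> Min (h ` {..<S}) + spnorm S h + c + e" "Min (h ` {..<S}) + c - e \<le> f t"
      using spnorm_bounds[OF t, of h] e[OF t] by linarith+
  qed
  then show ?thesis by simp
qed

text \<open>Doubling the variance of \<open>h\<close> to cover that of \<open>f\<close> turns the
  factor 2 into sqrt 8. The remaining terms are multiples of l/n: 10 from the perturbed variance, 12
  from the perturbed span and 6 from moving two averages by 3/n. They total 28, besides 2 times the
  span of \<open>h\<close>; both fit under 30.\<close>

lemma deviation_transfer:
  fixes n :: nat and l :: real
  assumes K: "is_kernel S A K" and K': "is_kernel S A K'" and sa: "s < S" "a < A"
    and n: "1 \<le> n" and l: "1 \<le> l"
    and e: "\<And>t. t < S \<Longrightarrow> \<bar>f t - (h t + c)\<bar> \<le> 3 / n"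
    and dev: "\<bar>krow S K' a f s - krow S K a f s\<bar> \<le> 2 * sqrt (kvar S K f s a * l / n) + 2 * spnorm S f * l / n"
  shows "\<bar>krow S K' a h s - krow S K a h s\<bar>
      \<le> sqrt (8 * l / n) * sqrt (kvar S K h s a) + 30 * (spnorm S h + 1) * l / n"
proof -
  have S: "1 \<le> S" using sa by simp
  have close: "\<bar>krow S L a f s - (krow S L a h s + c)\<bar> \<le> 3 / n" if L: "is_kernel S A L" for L
  proof -
    have "krow S L a f s - (krow S L a h s + c) = krow S L a (\<lambda>t. f t - (h t + c)) s"
      using mvec_const[OF krow_stochastic[OF L sa(2)] sa(1)] by (simp add: mvec_diff mvec_add)
    then show ?thesis using mvec_abs_le[OF krow_stochastic[OF L sa(2)] sa(1) e] by simp
  qed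
  have "\<bar>krow S K' a h s - krow S K a h s\<bar> \<le> \<bar>krow S K' a f s - krow S K a f s\<bar> + 6 / n"
    using close[OF K] close[OF K'] by (simp add: abs_le_iff add_divide_distrib[symmetric]) linarith
  also note dev
  finally have 1: "\<bar>krow S K' a h s - krow S K a h s\<bar>
      \<le> 2 * sqrt (kvar S K f s a * l / n) + 2 * spnorm S f * l / n + 6 / n" by simp
  have ln: "0 \<le> l / n" using l by simp
  let ?v = "kvar S K h s a"
  have v: "0 \<le> ?v" by (rule kvar_nonneg[OF K sa])
  have "2 * sqrt (kvar S K f s a * l / n) \<le> 2 * sqrt ((2 * ?v + 2 * (3 / n)\<^sup>2) * (l / n))"
    using mult_right_mono[OF kvar_perturb_le[OF K sa e] ln] by simp
  also have "(2 * ?v + 2 * (3 / n)\<^sup>2) * (l / n) = 2 * ?v * (l / n) + 18 * l / n / (n * n)"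
    by (simp add: power2_eq_square algebra_simps add_divide_distrib)
  also have "2 * sqrt (2 * ?v * (l / n) + 18 * l / n / (n * n)) \<le> 2 * (sqrt (2 * ?v * (l / n)) + sqrt (18 * l / n / (n * n)))"
    using v l by (intro mult_left_mono sqrt_add_le_add_sqrt mult_nonneg_nonneg divide_nonneg_nonneg) auto
  finally have "2 * sqrt (kvar S K f s a * l / n)
      \<le> 2 * sqrt (2 * ?v * (l / n)) + 2 * sqrt (18 * l / n / (n * n))" by (simp only: distrib_left)
  moreover have "2 * sqrt (2 * ?v * (l / n)) = sqrt (8 * l / n) * sqrt ?v"
  proof -
    have "2 * sqrt (2 * ?v * (l / n)) = sqrt (4 * (2 * ?v * (l / n)))" by (simp only: real_sqrt_mult real_sqrt_four)
    also have "\<dots> = sqrt (8 * l / n * ?v)" by (simp add: mult_ac)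
    finally show ?thesis by (simp only: real_sqrt_mult)
  qed
  ultimately have 2: "2 * sqrt (kvar S K f s a * l / n) \<le> sqrt (8 * l / n) * sqrt ?v + 2 * sqrt (18 * l / n / (n * n))"
    by (simp only:)
  have "sqrt (18 * l / n / (n * n)) \<le> 5 * l / n"
  proof (rule real_le_lsqrt)
    have "18 * l / n / (n * n) \<le> 25 * (l * l) / (n * n)"
    proof -
      have "18 * l / n \<le> 25 * (l * l)"
      proof -
        have "18 * l / n \<le> 18 * l / 1" using n l by (intro divide_left_mono) auto
        also have "\<dots> \<le> 25 * (l * l)" using l mult_right_mono[of 1 l l] by simp
        finally show ?thesis .
      qed
      then show ?thesis by (intro divide_right_mono) auto
    qed
    then show "18 * l / n / (n * n) \<le> (5 * l / n)\<^sup>2" by (simp add: power2_eq_square field_simps)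
  qed (use l in auto)
  moreover have "2 * spnorm S f * l / n \<le> 2 * spnorm S h * l / n + 12 * l / n"
  proof -
    have "spnorm S f \<le> spnorm S h + 6" 
    proof -
      have "3 / real n \<le> 3" using n by (simp add: field_simps)
      then show ?thesis using spnorm_perturb_le[of S f h c "3 / n", OF S e] by simp
    qed
    then have "2 * spnorm S f * (l / n) \<le> 2 * (spnorm S h + 6) * (l / n)" using ln by (intro mult_right_mono) auto
    then show ?thesis by (simp add: algebra_simps add_divide_distrib)
  qed
  moreover have "6 / n \<le> 6 * l / n" using l by (intro divide_right_mono) auto
  moreover have "30 * (spnorm S h + 1) * l / n = 30 * (spnorm S h * (l / n)) + 30 * (l / n)"
    by (simp add: algebra_simps add_divide_distrib)
  moreover have "0 \<le> spnorm S h * (l / n)" using spnorm_nonneg[OF S] ln by (rule mult_nonneg_nonneg)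
  ultimately show ?thesis using 1 2 ln by simp
qed

section \<open>Union bound over pairs, scales and grid points\<close>

locale sampled_mdp =
  fixes S A n :: nat and P :: "nat \<Rightarrow> nat \<Rightarrow> nat pmf" and r :: "nat \<Rightarrow> nat \<Rightarrow> real" and \<delta> :: real
  assumes S1: "1 \<le> S" and A1: "1 \<le> A" and n1: "1 \<le> n"
    and P: "\<And>s a. s < S \<Longrightarrow> a < A \<Longrightarrow> set_pmf (P s a) \<subseteq> {..<S}"
    and r: "\<And>s a. s < S \<Longrightarrow> a < A \<Longrightarrow> 0 \<le> r s a \<and> r s a \<le> 1"
    and \<delta>: "0 < \<delta>" "\<delta> < 1"
begin

abbreviation "K \<equiv> pmf_kernel P"
abbreviation "M \<equiv> sample_pmf S A n P"

definition h where "h = opt_bias S A K r"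
definition hc where "hc t = h t - Min (h ` {..<S})"
text \<open>Chosen so that exp(-lev k) is delta / (8 S A n 4^k). Here S A counts the pairs, n 2^k
  the grid points up to a factor 2, and the second 2^k makes the scales summable.\<close>

definition lev :: "nat \<Rightarrow> real" where "lev k = ln (8 * S * A * n * 4 ^ k / \<delta>)"
definition disc_factor :: "nat \<Rightarrow> real" where "disc_factor k = 1 - 1 / 2 ^ k"
text \<open>Enough iterations to make the truncation error at most 1/n; such a number exists by
  \<open>disc_factor_bounds\<close>.\<close>

definition depth :: "nat \<Rightarrow> nat" where "depth k = (SOME m. disc_factor k ^ m * 2 ^ k \<le> 1 / n)"
definition pin where "pin s k j \<omega> = pinned S A (emp_kernel n \<omega>) r (disc_factor k) s (real j / n) (depth k)"
definition bad where
  "bad s a l F = {\<omega>. 2 * sqrt (kvar S K (F \<omega>) s a * l / n) + 2 * spnorm S (F \<omega>) * l / n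
        < \<bar>krow S (emp_kernel n \<omega>) a (F \<omega>) s - krow S K a (F \<omega>) s\<bar>}"
definition bad_pin where "bad_pin s a k = (\<Union>j\<in>{..n * 2 ^ k}. bad s a (lev k) (pin s k j))"
text \<open>The two deterministic vectors are tested at level 0; the pinned iterations use the
  scales from 1 on.\<close>

definition bad_sa where
  "bad_sa s a = bad s a (lev 0) (\<lambda>_. h) \<union> bad s a (lev 0) (\<lambda>_ t. (hc t)\<^sup>2) \<union> (\<Union>k. bad_pin s a (Suc k))"
definition bad_all where "bad_all = (\<Union>x\<in>{..<S} \<times> {..<A}. bad_sa (fst x) (snd x))"

lemma kernel_K: "is_kernel S A K" using P by (rule is_kernel_pmf)

lemma kernel_emp:
  assumes "\<omega> \<in> set_pmf M"
  shows "is_kernel S A (emp_kernel n \<omega>)"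
proof -
  have sup: "\<omega> ((s, a), i) < S" if "s < S" "a < A" "i < n" for s a i
    using that assms P by (fastforce simp: sample_pmf_def set_Pi_pmf PiE_dflt_def)
  have "(\<Sum>s'<S. emp_kernel n \<omega> s a s') = 1" if "s < S" "a < A" for s a
    using krow_emp_kernel[of n \<omega> s a S "\<lambda>_. 1"] sup[OF that] n1 by (simp add: mvec_def)
  then show ?thesis by (auto simp: is_kernel_def stochastic_def emp_kernel_def)
qed

lemma mdp_K: "finite_mdp S A K r"
  using S1 A1 r kernel_K by unfold_locales auto

lemma mdp_emp: "\<omega> \<in> set_pmf M \<Longrightarrow> finite_mdp S A (emp_kernel n \<omega>) r"
  using S1 A1 r kernel_emp by unfold_locales auto

lemma sizes: "1 \<le> real S" "1 \<le> real A" "1 \<le> real n" "1 \<le> real S * real A * real n"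
proof -
  show a: "1 \<le> real S" "1 \<le> real A" "1 \<le> real n" using S1 A1 n1 by auto
  have "1 * 1 * 1 \<le> real S * real A * real n" using a by (intro mult_mono) auto
  then show "1 \<le> real S * real A * real n" by simp
qed

lemma lev_pos_arg: "0 < 8 * S * A * n * 4 ^ k / \<delta>"
  using sizes \<delta> by (intro divide_pos_pos mult_pos_pos) auto

lemma exp_lev: "exp (- lev k) = \<delta> / (8 * S * A * n * 4 ^ k)"
  unfolding lev_def exp_minus using lev_pos_arg[of k] by (simp add: exp_ln)

lemma lev_ge_1: "1 \<le> lev k"
proof -
  have "8 * 1 * 1 \<le> 8 * (real S * real A * real n) * 4 ^ k"
    using sizes by (intro mult_mono) auto
  also have "\<dots> \<le> 8 * (real S * real A * real n) * 4 ^ k / \<delta>"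
    using \<delta> sizes by (simp add: field_simps)
  finally have "exp 1 \<le> 8 * (real S * real A * real n) * 4 ^ k / \<delta>"
    using exp_le by linarith
  then show ?thesis unfolding lev_def using lev_pos_arg[of k]
    by (subst ln_ge_iff) (auto simp: mult_ac)
qed

lemma prob_bad:
  assumes "s < S" "a < A"
    and "\<And>\<omega> \<omega>'. (\<And>x i. x \<noteq> (s, a) \<Longrightarrow> \<omega> (x, i) = \<omega>' (x, i)) \<Longrightarrow> F \<omega> = F \<omega>'"
  shows "measure_pmf.prob M (bad s a (lev k) F) \<le> 2 * (\<delta> / (8 * S * A * n * 4 ^ k))"
  unfolding bad_def exp_lev[symmetric]
  by (rule bernstein_decoupled[OF assms(1,2) n1 _ P assms(3)]) (use lev_ge_1[of k] in auto)

text \<open>There are at most 2 n 2^k grid points, each failing with probability at most 2 delta /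
  (8 S A n 4^k).\<close>

lemma prob_bad_pin:
  assumes sa: "s < S" "a < A"
  shows "measure_pmf.prob M (bad_pin s a k) \<le> \<delta> / (2 * S * A) * (1 / 2) ^ k"
proof -
  let ?e = "2 * (\<delta> / (8 * S * A * n * 4 ^ k))"
  have "measure_pmf.prob M (bad_pin s a k) \<le> (\<Sum>j\<in>{..n * 2 ^ k}. measure_pmf.prob M (bad s a (lev k) (pin s k j)))"
    unfolding bad_pin_def by (rule measure_pmf.finite_measure_subadditive_finite) auto
  also have "\<dots> \<le> (\<Sum>j\<in>{..n * 2 ^ k}. ?e)"
  proof (intro sum_mono prob_bad[OF sa])
    fix j and \<omega> \<omega>' :: "(nat \<times> nat) \<times> nat \<Rightarrow> nat"
    assume *: "\<And>x i. x \<noteq> (s, a) \<Longrightarrow> \<omega> (x, i) = \<omega>' (x, i)"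
    \<comment> \<open>Samples at (s, a) affect only rows of state \<open>s\<close>, and the pinned
      iteration reads none of these.\<close>
    have "emp_kernel n \<omega> t b = emp_kernel n \<omega>' t b" if "t \<noteq> s" for t b
      using * that by (intro ext) (simp add: emp_kernel_def)
    then show "pin s k j \<omega> = pin s k j \<omega>'" unfolding pin_def by (rule ext[OF pinned_cong])
  qed
  also have "\<dots> = (real n * 2 ^ k + 1) * ?e" by (simp add: add.commute)
  also have "\<dots> \<le> (2 * (real n * 2 ^ k)) * ?e"
  proof (rule mult_right_mono)
    have "1 * 1 \<le> real n * 2 ^ k" using sizes by (intro mult_mono) auto
    then show "real n * 2 ^ k + 1 \<le> 2 * (real n * 2 ^ k)" by simp
  qed (use \<delta> in simp)
  also have "\<dots> = \<delta> / (2 * S * A) * (1 / 2) ^ k"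
  proof -
    have "(4::real) ^ k = 2 ^ k * 2 ^ k" by (simp flip: power_mult_distrib)
    then show ?thesis using sizes by (simp add: field_simps power_divide)
  qed
  finally show ?thesis .
qed

text \<open>The share delta / (S A) of one pair is spent as one quarter on each deterministic vector
  and one half on all scales, using the geometric series with sum 1.\<close>

lemma prob_bad_sa:
  assumes sa: "s < S" "a < A"
  shows "measure_pmf.prob M (bad_sa s a) \<le> \<delta> / (S * A)"
proof -
  have sums: "(\<lambda>k. \<delta> / (2 * S * A) * (1 / 2) ^ Suc k) sums (\<delta> / (2 * S * A) * 1)"
    by (intro sums_mult power_half_series)
  have sm: "summable (\<lambda>k. measure_pmf.prob M (bad_pin s a (Suc k)))"
    by (rule summable_comparison_test[OF _ sums_summable[OF sums]])
      (use prob_bad_pin[OF sa] in \<open>auto simp del: power_Suc\<close>)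
  have "measure_pmf.prob M (\<Union>k. bad_pin s a (Suc k)) \<le> (\<Sum>k. measure_pmf.prob M (bad_pin s a (Suc k)))"
    by (rule measure_pmf.finite_measure_subadditive_countably) (use sm in auto)
  also have "\<dots> \<le> (\<Sum>k. \<delta> / (2 * S * A) * (1 / 2) ^ Suc k)"
    by (rule suminf_le[OF prob_bad_pin[OF sa] sm sums_summable[OF sums]])
  also have "\<dots> = \<delta> / (2 * S * A)" unfolding sums_unique[OF sums, symmetric] by simp
  finally have 1: "measure_pmf.prob M (\<Union>k. bad_pin s a (Suc k)) \<le> \<delta> / (2 * S * A)" .
  let ?e = "2 * (\<delta> / (8 * S * A * n * 4 ^ 0))"
  have 2: "measure_pmf.prob M (bad s a (lev 0) (\<lambda>_. h)) \<le> ?e"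
    "measure_pmf.prob M (bad s a (lev 0) (\<lambda>_ t. (hc t)\<^sup>2)) \<le> ?e"
    by (rule prob_bad[OF sa]; simp)+
  have 3: "?e \<le> \<delta> / (4 * S * A)"
    using sizes \<delta> by (simp add: field_simps)
  have "measure_pmf.prob M (bad_sa s a) \<le> measure_pmf.prob M (bad s a (lev 0) (\<lambda>_. h) \<union> bad s a (lev 0) (\<lambda>_ t. (hc t)\<^sup>2))
      + measure_pmf.prob M (\<Union>k. bad_pin s a (Suc k))"
    unfolding bad_sa_def by (rule measure_Un_le) auto
  also have "measure_pmf.prob M (bad s a (lev 0) (\<lambda>_. h) \<union> bad s a (lev 0) (\<lambda>_ t. (hc t)\<^sup>2))
      \<le> measure_pmf.prob M (bad s a (lev 0) (\<lambda>_. h)) + measure_pmf.prob M (bad s a (lev 0) (\<lambda>_ t. (hc t)\<^sup>2))"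
    by (rule measure_Un_le) auto
  finally have "measure_pmf.prob M (bad_sa s a) \<le> \<delta> / (4 * S * A) + \<delta> / (4 * S * A) + \<delta> / (2 * S * A)"
    using 1 2 3 by linarith
  also have "\<dots> = \<delta> / (S * A)" using sizes by (simp add: field_simps)
  finally show ?thesis .
qed

lemma prob_bad_all: "measure_pmf.prob M bad_all \<le> \<delta>"
proof -
  have "measure_pmf.prob M bad_all \<le> (\<Sum>x\<in>{..<S} \<times> {..<A}. measure_pmf.prob M (bad_sa (fst x) (snd x)))"
    unfolding bad_all_def by (rule measure_pmf.finite_measure_subadditive_finite) auto
  also have "\<dots> \<le> (\<Sum>x\<in>{..<S} \<times> {..<A}. \<delta> / (S * A))"
    by (intro sum_mono prob_bad_sa) auto
  also have "\<dots> = \<delta>" using sizes by (simp add: card_cartesian_product)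
  finally show ?thesis .
qed

section \<open>Deviation bounds outside the bad event\<close>

text \<open>For the squares, H being the span of \<open>h\<close>, the standard deviation grows by
  at most 2H and the span is at most H^2. This produces the factor 2H in front of the bound for
  \<open>h\<close> itself.\<close>

lemma deviation_true_bias:
  assumes sa: "s < S" "a < A" and \<omega>: "\<omega> \<notin> bad_all"
  shows "\<bar>krow S K a h s - krow S (emp_kernel n \<omega>) a h s\<bar>
      \<le> sqrt (8 * lev 0 / n) * sqrt (kvar S K h s a) + 30 * (spnorm S h + 1) * lev 0 / n"
    and "\<bar>krow S K a (\<lambda>t. (hc t)\<^sup>2) s - krow S (emp_kernel n \<omega>) a (\<lambda>t. (hc t)\<^sup>2) s\<bar>
      \<le> 2 * spnorm S h * (sqrt (8 * lev 0 / n) * sqrt (kvar S K h s a) + 30 * (spnorm S h + 1) * lev 0 / n)"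
proof -
  define l where "l = lev 0"
  let ?H = "spnorm S h" and ?v = "kvar S K h s a"
  have ln: "0 \<le> l / n" using lev_ge_1[of 0] by (simp add: l_def)
  have H: "0 \<le> ?H" using S1 by (rule spnorm_nonneg)
  have v: "0 \<le> ?v" by (rule kvar_nonneg[OF kernel_K sa])
  have "\<omega> \<notin> bad_sa s a" using \<omega> sa by (auto simp: bad_all_def)
  then have b1: "\<omega> \<notin> bad s a l (\<lambda>_. h)" and b2: "\<omega> \<notin> bad s a l (\<lambda>_ t. (hc t)\<^sup>2)"
    by (simp_all add: bad_sa_def l_def)
  have sq: "2 * sqrt (?v * l / n) \<le> sqrt (8 * l / n) * sqrt ?v"
  proof -
    have "2 * sqrt (?v * l / n) = sqrt (4 * (?v * l / n))" by (simp only: real_sqrt_mult real_sqrt_four)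
    also have "\<dots> \<le> sqrt (8 * (?v * l / n))" using v ln mult_nonneg_nonneg[OF v ln] by (intro real_sqrt_le_mono) simp
    also have "8 * (?v * l / n) = 8 * l / n * ?v" by simp
    finally show ?thesis by (simp only: real_sqrt_mult)
  qed
  have Hl: "0 \<le> ?H * (l / n)" using H ln by (rule mult_nonneg_nonneg)
  have e30: "30 * (?H + 1) * l / n = 30 * (?H * (l / n)) + 30 * (l / n)"
    by (simp add: algebra_simps add_divide_distrib)
  show "\<bar>krow S K a h s - krow S (emp_kernel n \<omega>) a h s\<bar>
      \<le> sqrt (8 * lev 0 / n) * sqrt ?v + 30 * (?H + 1) * lev 0 / n"
    using b1 sq Hl ln e30 unfolding bad_def l_def[symmetric] by (simp add: not_less abs_minus_commute)
  have hc: "0 \<le> hc t \<and> hc t \<le> ?H" if "t < S" for t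
    using spnorm_bounds[OF that, of h] by (simp add: hc_def)
  have "kvar S K (\<lambda>t. (hc t)\<^sup>2) s a \<le> 4 * ?H\<^sup>2 * kvar S K hc s a"
    by (rule kvar_square_le[OF kernel_K sa hc])
  also have "kvar S K hc s a = ?v" unfolding hc_def[abs_def] by (rule kvar_shift[OF kernel_K sa])
  finally have "kvar S K (\<lambda>t. (hc t)\<^sup>2) s a * (l / n) \<le> (2 * ?H)\<^sup>2 * (?v * l / n)"
    using mult_right_mono[OF _ ln] by (fastforce simp: power_mult_distrib)
  then have "sqrt (kvar S K (\<lambda>t. (hc t)\<^sup>2) s a * (l / n)) \<le> sqrt ((2 * ?H)\<^sup>2 * (?v * l / n))"
    by (rule real_sqrt_le_mono)
  also have "\<dots> = 2 * ?H * sqrt (?v * l / n)" using H by (subst real_sqrt_mult, subst real_sqrt_abs) simp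
  finally have q1: "2 * sqrt (kvar S K (\<lambda>t. (hc t)\<^sup>2) s a * l / n) \<le> 2 * ?H * (2 * sqrt (?v * l / n))" by simp
  also have "\<dots> \<le> 2 * ?H * (sqrt (8 * l / n) * sqrt ?v)" using sq H by (intro mult_left_mono) auto
  finally have q1: "2 * sqrt (kvar S K (\<lambda>t. (hc t)\<^sup>2) s a * l / n) \<le> 2 * ?H * (sqrt (8 * l / n) * sqrt ?v)" .
  have "spnorm S (\<lambda>t. (hc t)\<^sup>2) \<le> ?H\<^sup>2 - 0"
    using hc by (intro spnorm_le S1) (auto intro: power_mono)
  then have "2 * spnorm S (\<lambda>t. (hc t)\<^sup>2) * (l / n) \<le> 2 * ?H\<^sup>2 * (l / n)"
    using ln by (intro mult_right_mono) auto
  also have "\<dots> = 2 * ?H * (?H * (l / n))" by (simp add: power2_eq_square)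
  also have "\<dots> \<le> 2 * ?H * (30 * (?H + 1) * l / n)"
  proof (rule mult_left_mono)
    show "?H * (l / n) \<le> 30 * (?H + 1) * l / n" unfolding e30 using Hl ln by linarith
  qed (use H in simp)
  finally have q2: "2 * spnorm S (\<lambda>t. (hc t)\<^sup>2) * l / n \<le> 2 * ?H * (30 * (?H + 1) * l / n)" by simp
  have "\<bar>krow S K a (\<lambda>t. (hc t)\<^sup>2) s - krow S (emp_kernel n \<omega>) a (\<lambda>t. (hc t)\<^sup>2) s\<bar>
      \<le> 2 * sqrt (kvar S K (\<lambda>t. (hc t)\<^sup>2) s a * l / n) + 2 * spnorm S (\<lambda>t. (hc t)\<^sup>2) * l / n"
    using b2 unfolding bad_def by (simp add: not_less abs_minus_commute)
  then show "\<bar>krow S K a (\<lambda>t. (hc t)\<^sup>2) s - krow S (emp_kernel n \<omega>) a (\<lambda>t. (hc t)\<^sup>2) s\<bar>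
      \<le> 2 * ?H * (sqrt (8 * lev 0 / n) * sqrt ?v + 30 * (?H + 1) * lev 0 / n)"
    using q1 q2 unfolding l_def[symmetric] distrib_left by linarith
qed

lemma disc_factor_bounds:
  assumes "1 \<le> k"
  shows "0 \<le> disc_factor k" "disc_factor k < 1" "1 / (1 - disc_factor k) = 2 ^ k"
    "disc_factor k ^ depth k / (1 - disc_factor k) \<le> 1 / n"
proof -
  have "(1::real) \<le> 2 ^ k" by simp
  then show g: "0 \<le> disc_factor k" "disc_factor k < 1" "1 / (1 - disc_factor k) = 2 ^ k"
    by (simp_all add: disc_factor_def)
  have "(\<lambda>m. disc_factor k ^ m * 2 ^ k) \<longlonglongrightarrow> 0 * 2 ^ k"
    using g by (intro tendsto_intros LIMSEQ_power_zero) simp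
  then have "\<forall>\<^sub>F m in sequentially. disc_factor k ^ m * 2 ^ k < 1 / n"
    by (rule order_tendstoD) (use n1 in simp)
  then have "\<exists>m. disc_factor k ^ m * 2 ^ k \<le> 1 / n"
    by (auto simp: eventually_sequentially intro: less_imp_le)
  then have "disc_factor k ^ depth k * 2 ^ k \<le> 1 / n" unfolding depth_def by (rule someI_ex)
  then show "disc_factor k ^ depth k / (1 - disc_factor k) \<le> 1 / n"
    using g(3) by (simp add: divide_inverse)
qed

text \<open>The error 3/n has three equal parts: rounding the pinned value to the grid, truncating
  the iteration, and replacing the discounted value by the bias up to a constant.\<close>

lemma deviation_empirical_bias:
  assumes sa: "s < S" "a < A" and \<omega>: "\<omega> \<notin> bad_all" "\<omega> \<in> set_pmf M"
    and wc: "weakly_communicating S A (emp_kernel n \<omega>)"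
    and k: "1 \<le> k" "gamma_star S A n (emp_kernel n \<omega>) r < disc_factor k"
    and h'_def: "h' = opt_bias S A (emp_kernel n \<omega>) r"
  shows "\<bar>krow S (emp_kernel n \<omega>) a h' s - krow S K a h' s\<bar>
      \<le> sqrt (8 * lev k / n) * sqrt (kvar S K h' s a) + 30 * (spnorm S h' + 1) * lev k / n"
proof -
  let ?K' = "emp_kernel n \<omega>" and ?g = "disc_factor k"
  interpret E: finite_mdp S A ?K' r by (rule mdp_emp[OF \<omega>(2)])
  note g = disc_factor_bounds[OF k(1)]
  let ?V = "Vstar S A ?K' r ?g"
  obtain c where c: "\<And>t. t < S \<Longrightarrow> \<bar>?V t - h' t - c\<bar> \<le> 1 / n"
    using E.gamma_star_properties(3)[OF wc n1 k(2) g(2)] unfolding h'_def by blast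
  \<comment> \<open>This grid index depends on the samples, but it is at most n 2^k, and outside
    \<open>bad_all\<close> every such index is controlled.\<close>
  define j where "j = nat \<lfloor>n * ?V s\<rfloor>"
  have V: "0 \<le> ?V s" "?V s \<le> 2 ^ k" using E.Vstar_bellman(3)[OF g(1,2) sa(1)] g(3) by auto
  then have nV: "0 \<le> n * ?V s" "n * ?V s \<le> n * 2 ^ k" by (auto intro: mult_left_mono)
  have j: "real j \<le> n * ?V s" "n * ?V s < real j + 1"
    using nV unfolding j_def by linarith+
  have "real j \<le> real (n * 2 ^ k)" using j(1) nV(2) by simp
  then have jle: "j \<le> n * 2 ^ k" by (simp only: of_nat_le_iff)
  have u: "\<bar>real j / n - ?V s\<bar> \<le> 1 / n"
  proof -
    have "real j / n - ?V s = (real j - n * ?V s) / n" using n1 by (simp add: diff_divide_distrib)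
    moreover have "\<bar>real j - n * ?V s\<bar> \<le> 1" using j by linarith
    ultimately show ?thesis by (simp add: abs_divide divide_right_mono)
  qed
  have e: "\<bar>pin s k j \<omega> t - (h' t + c)\<bar> \<le> 3 / n" if t: "t < S" for t
  proof -
    have "\<bar>pin s k j \<omega> t - ?V t\<bar> \<le> \<bar>real j / n - ?V s\<bar> + ?g ^ depth k / (1 - ?g)"
      unfolding pin_def by (rule E.pinned_error[OF g(1,2) sa(1) t])
    then have "\<bar>pin s k j \<omega> t - (h' t + c)\<bar> \<le> 1 / n + 1 / n + 1 / n"
      using u g(4) c[OF t] by linarith
    then show ?thesis by simp
  qed
  obtain k' where k': "k = Suc k'" using k(1) by (cases k) auto
  have "\<omega> \<notin> bad_sa s a" using \<omega> sa by (auto simp: bad_all_def)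
  then have "\<omega> \<notin> bad_pin s a k" unfolding bad_sa_def k' by blast
  then have "\<omega> \<notin> bad s a (lev k) (pin s k j)" unfolding bad_pin_def using jle by blast
  then have dev: "\<bar>krow S ?K' a (pin s k j \<omega>) s - krow S K a (pin s k j \<omega>) s\<bar>
      \<le> 2 * sqrt (kvar S K (pin s k j \<omega>) s a * lev k / n) + 2 * spnorm S (pin s k j \<omega>) * lev k / n"
    by (simp add: bad_def not_less)
  show ?thesis by (rule deviation_transfer[OF kernel_K kernel_emp[OF \<omega>(2)] sa n1 lev_ge_1 e dev])
qed

section \<open>Choice of the scale and the final constants\<close>

text \<open>The least k with 2^-k < 1 - g: minimality gives the bound on 2^k, and strictness puts
  the scale strictly above g, where the bias approximation holds.\<close>

lemma ex_scale:
  fixes g :: real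
  assumes "0 \<le> g" "g < 1"
  obtains k where "1 \<le> k" "g < disc_factor k" "2 ^ k \<le> 2 / (1 - g)"
proof -
  define k where "k = (LEAST k. (1 / 2) ^ k < 1 - g)"
  have ex: "\<exists>k. (1 / 2) ^ k < 1 - g" using assms by (intro real_arch_pow_inv) auto
  then have k: "(1 / 2) ^ k < 1 - g" unfolding k_def by (rule LeastI_ex)
  obtain k' where k': "k = Suc k'" using k assms by (cases k) auto
  have "\<not> (1 / 2) ^ k' < 1 - g" using not_less_Least[of k' "\<lambda>k. (1 / 2) ^ k < 1 - g"] by (simp add: k_def[symmetric] k')
  then have "2 ^ k \<le> 2 / (1 - g)" using assms by (simp add: k' field_simps power_divide)
  moreover have "g < disc_factor k" using k by (simp add: disc_factor_def power_divide)
  moreover have "1 \<le> k" by (simp add: k')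
  ultimately show ?thesis using that by blast
qed

text \<open>As 4^k <= 4 / (1 - g)^2, the argument of the logarithm is at most 32 times the square of
  the one in \<open>L\<close>. This gives 5 ln 2 + 2 L <= 7 L.\<close>

lemma lev_le:
  assumes g: "0 \<le> g" "g < 1" and k: "2 ^ k \<le> 2 / (1 - g)" and two: "2 \<le> real S * real A * real n"
    and L_def: "L = ln (real S * real A * real n / (\<delta> * (1 - g)))"
  shows "lev k \<le> 16 * L ^ 3"
proof -
  let ?N = "real S * real A * real n"
  have \<delta>g: "0 < \<delta> * (1 - g)" "\<delta> * (1 - g) \<le> 1" using \<delta> g by (auto intro: mult_le_one)
  have a1: "2 \<le> ?N / (\<delta> * (1 - g))"
  proof -
    have "2 \<le> ?N / 1" using two by simp
    also have "\<dots> \<le> ?N / (\<delta> * (1 - g))" using \<delta>g two by (intro divide_left_mono) auto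
    finally show ?thesis .
  qed
  then have "ln 2 \<le> L" unfolding L_def by (subst ln_le_cancel_iff) auto
  have L: "2 / 3 \<le> L" using \<open>ln 2 \<le> L\<close> ln2_ge_two_thirds by linarith
  have "8 * S * A * n * 4 ^ k / \<delta> \<le> 2 ^ 5 * (?N / (\<delta> * (1 - g)))\<^sup>2"
  proof -
    have "(4::real) ^ k = (2 ^ k)\<^sup>2" by (simp add: power2_eq_square flip: power_mult_distrib)
    also have "\<dots> \<le> (2 / (1 - g))\<^sup>2" using k by (intro power_mono) auto
    finally have "8 * ?N * 4 ^ k / \<delta> \<le> 8 * ?N * (2 / (1 - g))\<^sup>2 / \<delta>"
      using \<delta> two by (intro divide_right_mono mult_left_mono) auto
    also have "\<dots> = 2 ^ 5 * (?N * \<delta> / (\<delta> * (1 - g))\<^sup>2)"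
    proof -
      have "8 * N * (2 / x)\<^sup>2 / d = 2 ^ 5 * (N * d / (d * x)\<^sup>2)" if "0 < x" "0 < d" for N x d :: real
        using that by (simp add: power2_eq_square field_simps)
      then show ?thesis using \<delta> g by simp
    qed
    also have "\<dots> \<le> 2 ^ 5 * (?N * ?N / (\<delta> * (1 - g))\<^sup>2)"
      using \<delta> two by (intro mult_left_mono divide_right_mono) auto
    finally show ?thesis by (simp add: power2_eq_square mult_ac)
  qed
  then have "lev k \<le> ln (2 ^ 5 * (?N / (\<delta> * (1 - g)))\<^sup>2)"
    unfolding lev_def using lev_pos_arg[of k] a1 S1 A1 n1 by (subst ln_le_cancel_iff) auto
  also have "\<dots> = 5 * ln 2 + 2 * L"
  proof -
    have "ln (2 ^ 5 * Y\<^sup>2) = 5 * ln 2 + 2 * ln Y" if "2 \<le> Y" for Y :: real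
      using that ln_realpow[of 2 5] by (subst ln_mult) (simp_all add: ln_realpow)
    then show ?thesis using a1 by (simp only: L_def)
  qed
  also have "\<dots> \<le> 7 * L" using \<open>ln 2 \<le> L\<close> by simp
  also have "\<dots> \<le> 16 * L ^ 3"
  proof -
    \<comment> \<open>L >= 2/3 gives 16 L^2 >= 64/9 > 7, which is where the 16 comes from.\<close>
    have "(2 / 3) * (2 / 3) \<le> L * L" using L by (intro mult_mono) auto
    then have "7 * L \<le> 16 * (L * L) * L" using L by (intro mult_right_mono) auto
    then show ?thesis by (simp add: power3_eq_cube mult_ac)
  qed
  finally show ?thesis .
qed

text \<open>Settles S A n = 1, where the logarithm has no positive lower bound: all policies share
  the same gain and the suboptimality is 0.\<close>

lemma gain_single_state_action:
  assumes "S = 1" "A = 1" "is_policy S A p" "s < S"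
  shows "gain S A K r p s = r 0 0"
proof -
  have "stochastic S (limmat S (Ppol A K p))"
    using stochastic_Ppol[OF kernel_K assms(3)] by (rule stochastic_limmat)
  then show ?thesis using assms
    by (simp add: gain_eq_mgain mgain_def mvec_def stochastic_def rpol_def is_policy_def)
qed

lemma good_event:
  assumes wcK: "weakly_communicating S A K" and \<omega>: "\<omega> \<notin> bad_all" "\<omega> \<in> set_pmf M"
    and wc: "weakly_communicating S A (emp_kernel n \<omega>)"
    and pih: "bias_optimal S A (emp_kernel n \<omega>) r pih" and s: "s < S"
  shows "opt_gain S A K r s - gain S A K r pih s
      \<le> sqrt (200000 * (ln (real S * real A * real n / (\<delta> * (1 - gamma_star S A n (emp_kernel n \<omega>) r)))) ^ 3 / real n
          * (spnorm S (opt_bias S A K r) + spnorm S (opt_bias S A (emp_kernel n \<omega>) r) + 1))"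
proof -
  let ?K' = "emp_kernel n \<omega>"
  interpret T: finite_mdp S A K r by (rule mdp_K)
  interpret E: finite_mdp S A ?K' r by (rule mdp_emp[OF \<omega>(2)])
  define g where "g = gamma_star S A n ?K' r"
  define L where "L = ln (real S * real A * real n / (\<delta> * (1 - g)))"
  define h' where "h' = opt_bias S A ?K' r"
  have g: "0 \<le> g" "g < 1" using E.gamma_star_properties[OF wc n1] by (simp_all add: g_def)
  have H: "0 \<le> spnorm S h" "0 \<le> spnorm S h'" using spnorm_nonneg[OF S1] by auto
  have "opt_gain S A K r s - gain S A K r pih s \<le> sqrt (200000 * L ^ 3 / real n * (spnorm S h + spnorm S h' + 1))"
  proof (cases "2 \<le> real S * real A * real n")
    case True
    obtain k where k: "1 \<le> k" "g < disc_factor k" "2 ^ k \<le> 2 / (1 - g)" using ex_scale[OF g] .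
    have lk: "lev k \<le> 16 * L ^ 3" by (rule lev_le[OF g k(3) True L_def])
    \<comment> \<open>The true bias was tested at level 0 and the empirical one at level k;
      monotonicity puts both under one bound.\<close>
    have "lev 0 \<le> lev k"
    proof -
      have "8 * S * A * n * 4 ^ 0 / \<delta> \<le> 8 * S * A * n * 4 ^ k / \<delta>"
        by (intro divide_right_mono of_nat_mono mult_le_mono order_refl) (use \<delta> in simp_all)
      then show ?thesis unfolding lev_def using lev_pos_arg[of 0] lev_pos_arg[of k] S1 A1 n1
        by (subst ln_le_cancel_iff) auto
    qed
    then have l0: "lev 0 \<le> 16 * L ^ 3" using lk by simp
    let ?R = "(spnorm S h + spnorm S h' + 1) * (16 * L ^ 3) / n"
    have lev0: "0 \<le> lev 0" "0 \<le> lev k" using lev_ge_1[of 0] lev_ge_1[of k] by auto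
    have "opt_gain S A K r s - gain S A K r pih s
        \<le> 52 * sqrt ((spnorm S h + 1) * lev 0 / n) + 52 * sqrt ((spnorm S h' + 1) * lev k / n)"
    proof (rule suboptimality_bound[OF mdp_K mdp_emp[OF \<omega>(2)] wcK wc pih s lev0 _ h_def h'_def])
      show "0 < real n" using n1 by simp
      show "\<bar>krow S K a h s - krow S ?K' a h s\<bar>
          \<le> sqrt (8 * lev 0 / n) * sqrt (kvar S K h s a) + 30 * (spnorm S h + 1) * lev 0 / n"
        if "s < S" "a < A" for s a by (rule deviation_true_bias(1)[OF that \<omega>(1)])
      show "\<bar>krow S K a (\<lambda>t. (h t - Min (h ` {..<S}))\<^sup>2) s - krow S ?K' a (\<lambda>t. (h t - Min (h ` {..<S}))\<^sup>2) s\<bar>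
          \<le> 2 * spnorm S h * (sqrt (8 * lev 0 / n) * sqrt (kvar S K h s a) + 30 * (spnorm S h + 1) * lev 0 / n)"
        if "s < S" "a < A" for s a
        using deviation_true_bias(2)[OF that \<omega>(1)] unfolding hc_def .
      show "\<bar>krow S ?K' a h' s - krow S K a h' s\<bar>
          \<le> sqrt (8 * lev k / n) * sqrt (kvar S K h' s a) + 30 * (spnorm S h' + 1) * lev k / n"
        if "s < S" "a < A" for s a
        by (rule deviation_empirical_bias[OF that \<omega> wc k(1) _ h'_def]) (use k(2) in \<open>simp add: g_def\<close>)
    qed
    also have "\<dots> \<le> 52 * sqrt ?R + 52 * sqrt ?R"
      using H l0 lk lev0 by (intro add_mono mult_left_mono real_sqrt_le_mono divide_right_mono mult_mono) auto
    also have "\<dots> = sqrt (104\<^sup>2 * ?R)" by (subst real_sqrt_mult) simp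
    also have "\<dots> \<le> sqrt (200000 * L ^ 3 / real n * (spnorm S h + spnorm S h' + 1))"
    proof (rule real_sqrt_le_mono)
      have "0 \<le> L ^ 3" using l0 lev0 by linarith
      then have "0 \<le> L ^ 3 / real n * (spnorm S h + spnorm S h' + 1)" using H by simp
      \<comment> \<open>104 = 52 + 52 from the two gain gaps, 16 from \<open>lev_le\<close>; the
        product 173056 is rounded up to 200000.\<close>
      then have "104\<^sup>2 * 16 * (L ^ 3 / real n * (spnorm S h + spnorm S h' + 1))
          \<le> 200000 * (L ^ 3 / real n * (spnorm S h + spnorm S h' + 1))"
        by (intro mult_right_mono) auto
      then show "104\<^sup>2 * ?R \<le> 200000 * L ^ 3 / real n * (spnorm S h + spnorm S h' + 1)"
        by (simp add: mult_ac)
    qed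
    finally show ?thesis .
  next
    case False
    have "real S * 1 \<le> real S * real A * real n" "1 * real A \<le> real S * real A * real n"
    proof -
      have "real S * (1 * 1) \<le> real S * (real A * real n)" using sizes by (intro mult_left_mono mult_mono) auto
      then show "real S * 1 \<le> real S * real A * real n" by (simp add: mult_ac)
      have "1 * real A * 1 \<le> real S * real A * real n" using sizes by (intro mult_mono) auto
      then show "1 * real A \<le> real S * real A * real n" by simp
    qed
    then have one: "S = 1" "A = 1" using False S1 A1 by linarith+
    have pol: "is_policy S A pih" using pih by (simp add: bias_optimal_def)
    have "opt_gain S A K r s = r 0 0"
      unfolding T.opt_gain_bw by (rule gain_single_state_action[OF one T.bw_policy s])
    then have "opt_gain S A K r s - gain S A K r pih s = 0"
      using gain_single_state_action[OF one pol s] by (simp only: diff_self)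
    moreover have "0 \<le> L"
    proof -
      have "0 < \<delta> * (1 - g)" "\<delta> * (1 - g) \<le> 1" using \<delta> g by (auto intro: mult_le_one)
      then have "1 \<le> real S * real A * real n / (\<delta> * (1 - g))" using sizes by (simp add: field_simps)
      then show ?thesis unfolding L_def by (rule ln_ge_zero)
    qed
    ultimately show ?thesis using H by simp
  qed
  then show ?thesis by (simp add: L_def g_def h'_def h_def)
qed

end

theorem mainTheorem1:
  "\<exists>C>0. \<forall>S A n (P :: nat \<Rightarrow> nat \<Rightarrow> nat pmf) (r :: nat \<Rightarrow> nat \<Rightarrow> real) (\<delta> :: real).
     1 \<le> S \<and> 1 \<le> A \<and> 1 \<le> n \<and>
     (\<forall>s<S. \<forall>a<A. set_pmf (P s a) \<subseteq> {..<S}) \<and>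
     (\<forall>s<S. \<forall>a<A. 0 \<le> r s a \<and> r s a \<le> 1) \<and>
     weakly_communicating S A (\<lambda>s a s'. pmf (P s a) s') \<and>
     0 < \<delta> \<and> \<delta> < 1 \<longrightarrow>
     measure_pmf.prob (sample_pmf S A n P)
       {\<omega>. weakly_communicating S A (emp_kernel n \<omega>) \<longrightarrow>
          (\<forall>pih. bias_optimal S A (emp_kernel n \<omega>) r pih \<longrightarrow>
            (\<forall>s<S.
               opt_gain S A (\<lambda>s a s'. pmf (P s a) s') r s
                 - gain S A (\<lambda>s a s'. pmf (P s a) s') r pih s
               \<le> sqrt (C * (ln (real S * real A * real n /
                          (\<delta> * (1 - gamma_star S A n (emp_kernel n \<omega>) r)))) ^ 3 / real n
                     * (spnorm S (opt_bias S A (\<lambda>s a s'. pmf (P s a) s') r)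
                        + spnorm S (opt_bias S A (emp_kernel n \<omega>) r) + 1))))}
     \<ge> 1 - \<delta>"
proof (intro exI[of _ 200000] conjI allI impI)
  fix S A n :: nat and P :: "nat \<Rightarrow> nat \<Rightarrow> nat pmf" and r :: "nat \<Rightarrow> nat \<Rightarrow> real" and \<delta> :: real
  assume hyp: "1 \<le> S \<and> 1 \<le> A \<and> 1 \<le> n \<and>
     (\<forall>s<S. \<forall>a<A. set_pmf (P s a) \<subseteq> {..<S}) \<and>
     (\<forall>s<S. \<forall>a<A. 0 \<le> r s a \<and> r s a \<le> 1) \<and>
     weakly_communicating S A (\<lambda>s a s'. pmf (P s a) s') \<and> 0 < \<delta> \<and> \<delta> < 1"
  interpret sampled_mdp S A n P r \<delta> using hyp by unfold_locales auto
  have wcK: "weakly_communicating S A K" using hyp by blast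
  let ?G = "{\<omega>. weakly_communicating S A (emp_kernel n \<omega>) \<longrightarrow>
          (\<forall>pih. bias_optimal S A (emp_kernel n \<omega>) r pih \<longrightarrow>
            (\<forall>s<S. opt_gain S A K r s - gain S A K r pih s
               \<le> sqrt (200000 * (ln (real S * real A * real n /
                          (\<delta> * (1 - gamma_star S A n (emp_kernel n \<omega>) r)))) ^ 3 / real n
                     * (spnorm S (opt_bias S A K r)
                        + spnorm S (opt_bias S A (emp_kernel n \<omega>) r) + 1))))}"
  have "1 - \<delta> \<le> 1 - measure_pmf.prob M bad_all" using prob_bad_all by simp
  also have "\<dots> = measure_pmf.prob M (- bad_all)"
    using measure_pmf.prob_compl[of bad_all M] by (simp add: Compl_eq_Diff_UNIV)
  \<comment> \<open>Outside the support the empirical kernel need not be stochastic on the state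
    space, so the good event is intersected with the support at no cost in probability.\<close>
  also have "\<dots> = measure_pmf.prob M (- bad_all \<inter> set_pmf M)" by (rule measure_Int_set_pmf[symmetric])
  also have "\<dots> \<le> measure_pmf.prob M ?G"
    by (intro measure_pmf.finite_measure_mono subsetI CollectI impI allI good_event[OF wcK]) auto
  finally show "1 - \<delta> \<le> measure_pmf.prob M ?G" .
qed simp

end
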